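(* As formal power series in $t$ (with coefficients polynomials in $y,z$), $$\sum_{M\in\mathcal{M}(P_1)}y^{\mathrm{fcr}(M)}z^{\mathrm{bl}(M)}t^{|M|}=\sum_{M\in\mathcal{M}(P_2)}y^{\mathrm{fcr}(M)}z^{\mathrm{bl}(M)}t^{|M|}=\sum_{P\in\mathcal{P}(\mathbf{3+1})}y^{\mathrm{min}(P)}z^{\mathrm{ssd}(P)}t^{|P|}$$ $$=\sum_{P\in\mathcal{P}(\mathbf{N})}y^{\mathrm{min}(P)}z^{\mathrm{smc}(P)}t^{|P|}=\sum_{\alpha\in\mathcal{A}(101)}y^{\mathrm{zero}(\alpha)}z^{\mathrm{rmin}(\alpha)}t^{|\alpha|}=\sum_{\pi\in\mathcal{F}(3142)}y^{\mathrm{idr}(\pi)}z^{\mathrm{lmax}(\pi)}t^{|\pi|}$$ $$=1+\frac{4yzt}{\left(2-y(1-\sqrt{1-4t})\right)\left(2-z(1-\sqrt{1-4t})\right)}=1+yzt\,C(y,t)\,C(z,t),$$ where $C(x,t)=\frac{1}{1-xtC(t)}$ and $C(t)=\frac{1-\sqrt{1-4t}}{2t}$. In particular this joint distribution is symmetric in $y$ and $z$.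
   Context: All statistics take the value $0$ on the empty object, and $|\cdot|$ denotes size (number of arcs, elements, or length). Matchings. A matching of length $n$ is a partition of $\{1,\ldots,2n\}$ into blocks of size 2, called arcs, written $[a,b]$ with $a<b$ ($a$ the opener, $b$ the closer). A matching is a Stoimenow matching if it contains neither a pair of arcs $[i,\ell],[i+1,k]$ with $i+1<k<\ell$ nor a pair of arcs $[k,j+1],[\ell,j]$ with $k<\ell<j$. $\mathcal{M}_n$ is the set of Stoimenow matchings of length $n$. A matching contains a pattern (another matching) if, after removing some (possibly no) arcs and relabelling the remaining endpoints increasingly by $1,2,\ldots$, one obtains that pattern; otherwise it avoids it. $\mathcal{M}_n(P_i)$ is the set of matchings in $\mathcal{M}_n$ avoiding $P_i$, where $P_1=\{[1,3],[2,7],[4,5],[6,8]\}$, $P_2=\{[1,3],[2,5],[4,7],[6,8]\}$; $\mathcal{M}(P_i)=\bigcup_{n\ge0}\mathcal{M}_n(P_i)$. A $k$-crossing is a set of $k\ge 1$ arcs with $a_{i_1}<\cdots<a_{i_k}<b_{i_1}<\cdots<b_{i_k}$; $\mathrm{fcr}(M)$ is the largest $k$ such that $M$ has a $k$-crossing containing the arc with opener $1$. A matching of length $n$ is reducible if for some $1\le i<n$ the set $\{1,\ldots,2i\}$ contains as many openers as closers, and irreducible otherwise; every matching decomposes uniquely as a juxtaposition of nonempty irreducible blocks, and $\mathrm{bl}(M)$ is the number of these blocks. Posets. Posets are unlabelled (up to isomorphism). $\mathcal{P}_n$ is the set of $n$-element posets with no induced subposet isomorphic to $\mathbf{2+2}$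 (disjoint union of two 2-element chains). $\mathbf{3+1}$ is the disjoint union of a 3-element chain and a 1-element chain; $\mathbf{N}$ is the poset on $\{a,b,c,d\}$ whose strict relations are exactly $a<c$, $a<d$, $b<d$. $\mathcal{P}_n(X)$ is the set of posets in $\mathcal{P}_n$ with no induced subposet isomorphic to $X$; $\mathcal{P}(X)=\bigcup_{n\ge0}\mathcal{P}_n(X)$. $\mathrm{min}(P)$ is the number of minimal elements; $\mathrm{smc}(P)$ is the size of the shortest maximal chain. The ordinal sum $R\oplus Q$ is the disjoint union of $R$ and $Q$ with the orders of $R$ and $Q$ and every element of $R$ below every element of $Q$; a nonempty poset is irreducible if it is not an ordinal sum of two nonempty posets, each poset is uniquely an ordinal sum of irreducible posets, and $\mathrm{ssd}(P)$ is the number of irreducible summands. Ascent sequences. $\mathcal{A}_n$ is the set of integer sequences $(\alpha_1,\ldots,\alpha_n)$ with $\alpha_1=0$ and $0\le\alpha_i\le1+\mathrm{asc}(\alpha_1,\ldots,\alpha_{i-1})$ for $2\le i\le n$, where $\mathrm{asc}$ counts indices $j$ whose entry is smaller than the next entry. $\mathcal{A}_n(101)$ is the subset having no $i<j<k$ with $\alpha_i=\alpha_k>\alpha_j$; $\mathcal{A}(101)=\bigcup_{n\ge0}\mathcal{A}_n(101)$. $\mathrm{zero}(\alpha)$ is the number of zeros; $\mathrm{rmin}(\alpha)=\#\{i:\alpha_i<\alpha_j\text{ for all }j>i\}$. Permutations. $\mathcal{F}_n$ is the set of permutations $\pi$ of $\{1,\ldots,n\}$ for which there are no $i,j$ with $j>i+1$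 and $\pi_j+1=\pi_i<\pi_{i+1}$. $\mathcal{F}_n(3142)$ is the subset avoiding the classical pattern $3142$; $\mathcal{F}(3142)=\bigcup_{n\ge0}\mathcal{F}_n(3142)$. $\mathrm{idr}(\pi)$ is the length of the initial descending run, i.e. the largest $j$ with $\pi_1>\pi_2>\cdots>\pi_j$; $\mathrm{lmax}(\pi)=\#\{i:\pi_i>\pi_j\text{ for all }j<i\}$. *)

theory Defs
  imports
    Complex_Main
    "HOL-Computational_Algebra.Computational_Algebra"
    "HOL-Combinatorics.Combinatorics"
    "HOL-Library.Disjoint_Sets"
    "HOL-Library.Sublist"
begin

section \<open>Matchings\<close>

text \<open>
  A matching is a set of two-element blocks. The arc $[a,b]$ is the block \<open>{a, b}\<close> with
  \<open>a < b\<close>, and the length of a matching \<open>M\<close> is \<open>card M\<close>.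
\<close>

definition matching :: "nat \<Rightarrow> nat set set \<Rightarrow> bool" where
  "matching n M \<longleftrightarrow> partition_on {1..2*n} M \<and> (\<forall>B\<in>M. card B = 2)"

definition openers :: "nat set set \<Rightarrow> nat set" where
  "openers M = {a. \<exists>b. a < b \<and> {a, b} \<in> M}"

definition closers :: "nat set set \<Rightarrow> nat set" where
  "closers M = {b. \<exists>a. a < b \<and> {a, b} \<in> M}"

definition stoimenow :: "nat set set \<Rightarrow> bool" where
  "stoimenow M \<longleftrightarrow>
     \<not> (\<exists>i k l. i + 1 < k \<and> k < l \<and> {i, l} \<in> M \<and> {i + 1, k} \<in> M) \<and>
     \<not> (\<exists>k l j. k < l \<and> l < j \<and> {k, j + 1} \<in> M \<and> {l, j} \<in> M)"

text \<open>Every remaining endpoint is replaced by its rank among the remaining endpoints.\<close>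

definition relabel :: "nat set set \<Rightarrow> nat set set" where
  "relabel N = (\<lambda>B. (\<lambda>x. card {u \<in> \<Union>N. u \<le> x}) ` B) ` N"

definition matching_contains :: "nat set set \<Rightarrow> nat set set \<Rightarrow> bool" where
  "matching_contains M P \<longleftrightarrow> (\<exists>N\<subseteq>M. relabel N = P)"

definition pattern1 :: "nat set set" where
  "pattern1 = {{1,3}, {2,7}, {4,5}, {6,8}}"

definition pattern2 :: "nat set set" where
  "pattern2 = {{1,3}, {2,5}, {4,7}, {6,8}}"

definition matchings_avoiding :: "nat set set \<Rightarrow> nat \<Rightarrow> nat set set set" where
  "matchings_avoiding P n = {M. matching n M \<and> stoimenow M \<and> \<not> matching_contains M P}"

definition crossing :: "nat set set \<Rightarrow> nat list \<Rightarrow> nat list \<Rightarrow> bool" where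
  "crossing M us vs \<longleftrightarrow> us \<noteq> [] \<and> length us = length vs \<and>
     sorted_wrt (<) (us @ vs) \<and> (\<forall>i<length us. {us ! i, vs ! i} \<in> M)"

definition fcr :: "nat set set \<Rightarrow> nat" where
  "fcr M = (if M = {} then 0
            else Max {length us | us vs. crossing M us vs \<and> 1 \<in> set us})"

definition reducible_matching :: "nat set set \<Rightarrow> bool" where
  "reducible_matching M \<longleftrightarrow>
     (\<exists>i. 1 \<le> i \<and> i < card M \<and> card (openers M \<inter> {1..2*i}) = card (closers M \<inter> {1..2*i}))"

definition irreducible_block :: "nat set set \<Rightarrow> bool" where
  "irreducible_block M \<longleftrightarrow> M \<noteq> {} \<and> matching (card M) M \<and> \<not> reducible_matching M"

fun juxtapose :: "nat set set list \<Rightarrow> nat set set" where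
  "juxtapose [] = {}"
| "juxtapose (M # Ms) = M \<union> (\<lambda>B. (\<lambda>x. 2 * card M + x) ` B) ` juxtapose Ms"

definition bl :: "nat set set \<Rightarrow> nat" where
  "bl M = (THE k. \<exists>Ms. length Ms = k \<and> (\<forall>N\<in>set Ms. irreducible_block N) \<and> juxtapose Ms = M)"


section \<open>Posets\<close>

text \<open>
  A poset is given by its reflexive order relation \<open>r\<close>; the ground set is then \<open>Field r\<close>.
  Unlabelled posets of size \<open>n\<close> are isomorphism classes of partial orders on \<open>{1..n}\<close>.
\<close>

definition poset_iso :: "'a rel \<Rightarrow> 'b rel \<Rightarrow> bool" where
  "poset_iso r s \<longleftrightarrow> (\<exists>f. bij_betw f (Field r) (Field s) \<and>
     (\<forall>x\<in>Field r. \<forall>y\<in>Field r. (x, y) \<in> r \<longleftrightarrow> (f x, f y) \<in> s))"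

definition poset_contains :: "'a rel \<Rightarrow> 'b rel \<Rightarrow> bool" where
  "poset_contains r q \<longleftrightarrow> (\<exists>A\<subseteq>Field r. poset_iso (Restr r A) q)"

definition poset_2_plus_2 :: "nat rel" where
  "poset_2_plus_2 = Id_on {1..4} \<union> {(1,2), (3,4)}"

definition poset_3_plus_1 :: "nat rel" where
  "poset_3_plus_1 = Id_on {1..4} \<union> {(1,2), (2,3), (1,3)}"

definition poset_N :: "nat rel" where
  "poset_N = Id_on {1..4} \<union> {(1,3), (1,4), (2,4)}"

definition unlabelled :: "'a rel set \<Rightarrow> 'a rel set set" where
  "unlabelled A = A // {(r, s). r \<in> A \<and> s \<in> A \<and> poset_iso r s}"

definition posets_avoiding :: "nat rel \<Rightarrow> nat \<Rightarrow> nat rel set set" where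
  "posets_avoiding X n = unlabelled
     {r. partial_order_on {1..n} r \<and> \<not> poset_contains r poset_2_plus_2 \<and> \<not> poset_contains r X}"

text \<open>The value of an isomorphism-invariant statistic on an isomorphism class.\<close>

definition class_stat :: "('a rel \<Rightarrow> nat) \<Rightarrow> 'a rel set \<Rightarrow> nat" where
  "class_stat f c = the_elem (f ` c)"

definition min_count :: "'a rel \<Rightarrow> nat" where
  "min_count r = card {x \<in> Field r. \<forall>y. (y, x) \<in> r \<longrightarrow> y = x}"

definition smc :: "'a rel \<Rightarrow> nat" where
  "smc r = Min (card ` {C \<in> Chains r. \<forall>D\<in>Chains r. C \<subseteq> D \<longrightarrow> D = C})"

definition ordinal_sum :: "'a rel \<Rightarrow> 'a rel \<Rightarrow> 'a rel" where
  "ordinal_sum r q = r \<union> q \<union> Field r \<times> Field q"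

definition irreducible_poset :: "'a rel \<Rightarrow> bool" where
  "irreducible_poset r \<longleftrightarrow> Partial_order r \<and> r \<noteq> {} \<and>
     \<not> (\<exists>p q. Partial_order p \<and> Partial_order q \<and> p \<noteq> {} \<and> q \<noteq> {} \<and>
             Field p \<inter> Field q = {} \<and> r = ordinal_sum p q)"

definition ssd :: "'a rel \<Rightarrow> nat" where
  "ssd r = (THE k. \<exists>rs. length rs = k \<and> (\<forall>p\<in>set rs. irreducible_poset p) \<and>
     sorted_wrt (\<lambda>p q. Field p \<inter> Field q = {}) rs \<and> foldr ordinal_sum rs {} = r)"


section \<open>Ascent sequences\<close>

definition asc :: "nat list \<Rightarrow> nat" where
  "asc xs = card {j. Suc j < length xs \<and> xs ! j < xs ! Suc j}"

text \<open>List positions start at \<open>0\<close>: \<open>xs ! i\<close> is the entry $\alpha_{i+1}$.\<close>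

definition ascent_seqs :: "nat \<Rightarrow> nat list set" where
  "ascent_seqs n = {xs. length xs = n \<and> (0 < n \<longrightarrow> xs ! 0 = 0) \<and>
     (\<forall>i. 1 \<le> i \<and> i < n \<longrightarrow> xs ! i \<le> 1 + asc (take i xs))}"

definition ascent_seqs_101 :: "nat \<Rightarrow> nat list set" where
  "ascent_seqs_101 n = {xs \<in> ascent_seqs n.
     \<not> (\<exists>i j k. i < j \<and> j < k \<and> k < n \<and> xs ! i = xs ! k \<and> xs ! k > xs ! j)}"

definition zero_count :: "nat list \<Rightarrow> nat" where
  "zero_count xs = count_list xs 0"

definition rmin :: "nat list \<Rightarrow> nat" where
  "rmin xs = card {i. i < length xs \<and> (\<forall>j. i < j \<and> j < length xs \<longrightarrow> xs ! i < xs ! j)}"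


section \<open>Permutations\<close>

text \<open>Permutations of \<open>{1..n}\<close> are lists in one-line notation.\<close>

definition fishburn_perms :: "nat \<Rightarrow> nat list set" where
  "fishburn_perms n = {p \<in> permutations_of_set {1..n}.
     \<not> (\<exists>i j. i + 1 < j \<and> j < n \<and> p ! j + 1 = p ! i \<and> p ! i < p ! (i + 1))}"

definition perm_contains :: "nat list \<Rightarrow> nat list \<Rightarrow> bool" where
  "perm_contains p s \<longleftrightarrow> (\<exists>q. subseq q p \<and> length q = length s \<and>
     (\<forall>i<length s. \<forall>j<length s. q ! i < q ! j \<longleftrightarrow> s ! i < s ! j))"

definition fishburn_perms_3142 :: "nat \<Rightarrow> nat list set" where
  "fishburn_perms_3142 n = {p \<in> fishburn_perms n. \<not> perm_contains p [3, 1, 4, 2]}"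

definition idr :: "nat list \<Rightarrow> nat" where
  "idr p = Max {j. j \<le> length p \<and> sorted_wrt (>) (take j p)}"

definition lmax :: "nat list \<Rightarrow> nat" where
  "lmax p = card {i. i < length p \<and> (\<forall>j<i. p ! i > p ! j)}"


section \<open>Generating functions\<close>

text \<open>
  The series live in $K[[t]]$ with $K$ the field of fractions of $\mathbb{Q}[y,z]$, so that the
  quotients in the closed form are the library's division of power series over a field. Elements
  of $\mathbb{Q}[y,z]$ are polynomials in $z$ whose coefficients are polynomials in $y$.
\<close>

type_synonym coeff_field = "rat poly poly fract"

definition y_var :: coeff_field where
  "y_var = to_fract [:[:0, 1:]:]"

definition z_var :: coeff_field where
  "z_var = to_fract [:0, 1:]"

definition joint_gf ::
    "(nat \<Rightarrow> 'a set) \<Rightarrow> ('a \<Rightarrow> nat) \<Rightarrow> ('a \<Rightarrow> nat) \<Rightarrow> coeff_field fps" where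
  "joint_gf S f g = Abs_fps (\<lambda>n. \<Sum>x\<in>S n. y_var ^ f x * z_var ^ g x)"

text \<open>
  $\sqrt{1-4t}$ with constant term $1$: the first argument of \<open>fps_radical\<close> selects the
  root of the constant term.
\<close>

definition sqrt_1_minus_4t :: "coeff_field fps" where
  "sqrt_1_minus_4t = fps_radical (\<lambda>_ _. 1) 2 (1 - 4 * fps_X)"

definition catalan_gf :: "coeff_field fps" where
  "catalan_gf = (1 - sqrt_1_minus_4t) / (2 * fps_X)"

definition catalan_gf2 :: "coeff_field fps \<Rightarrow> coeff_field fps" where
  "catalan_gf2 x = 1 / (1 - x * fps_X * catalan_gf)"

definition symmetric_joint ::
    "(nat \<Rightarrow> 'a set) \<Rightarrow> ('a \<Rightarrow> nat) \<Rightarrow> ('a \<Rightarrow> nat) \<Rightarrow> bool" where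
  "symmetric_joint S f g \<longleftrightarrow>
     (\<forall>n i j. card {x \<in> S n. f x = i \<and> g x = j} = card {x \<in> S n. f x = j \<and> g x = i})"

end

theory Submission imports Defs begin

text \<open>
  All six classes are equidistributed with binary trees, carrying the lengths of the left and of the right
  spine; mirroring a tree exchanges the two, and splitting at the root gives
  $G(y,z) = 1 + yzt\,G(y,1)\,G(1,z)$.

  Ascent sequences, permutations and semiorders grow in the same way as trees: an object with statistics
  $(i,j)$ has children $(i+1,1),(i,2),\dots,(i,j+1)$. For ascent sequences one appends an entry, for
  permutations one inserts the maximum, and a semiorder is read as the sorted list of its down-set sizes. A
  poset without 2+2 and N is uniquely an ordinal sum of pieces consisting of an isolated point and a smaller
  such poset, which is the recursive structure of binary trees.

  A Stoimenow matching is determined by the interval order of its arcs: the arcs are opened in the order of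
  their down-sets and closed in the order of their up-sets, ties being broken by the other of the two. Under
  this correspondence the patterns $P_1$ and $P_2$ become 3+1 and N.
\<close>

section \<open>Binary trees\<close>

text \<open>The blocks of a matching correspond to the ordinal summands of its interval order, hence
  to \<open>ssd\<close>, but for N-free posets the second statistic is \<open>smc\<close>. On that
  class both obey one recursion: a summand with an isolated point cannot be cut further and has a
  maximal chain of length 1, so it adds one to either. In the generating tree a child is singled out
  by its second label, and its first label follows from the parent and that label; so for each class
  it is enough to know how the second statistic runs through the children of one object. In
  semiorders the roles of the two statistics are exchanged, which mirroring repairs. Two obstacles
  shape the rest. Posets are isomorphism classes, so each family needs explicit representatives and
  statistics in invariant form; the number of summands is therefore computed as a number of cuts.
  And P1, P2 ask for more than 3+1 and N: some of their arcs must cross where comparability alone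
  would also allow nesting. The two forbidden nestings of neighbouring endpoints are what forces
  these crossings, after an exchange of the outer arcs.\<close>

datatype bintree = Leaf | Branch bintree bintree

fun nodes :: "bintree \<Rightarrow> nat" where
  "nodes Leaf = 0"
| "nodes (Branch l r) = Suc (nodes l + nodes r)"

fun left_spine :: "bintree \<Rightarrow> nat" where
  "left_spine Leaf = 0"
| "left_spine (Branch l r) = Suc (left_spine l)"

fun right_spine :: "bintree \<Rightarrow> nat" where
  "right_spine Leaf = 0"
| "right_spine (Branch l r) = Suc (right_spine r)"

fun mirror :: "bintree \<Rightarrow> bintree" where
  "mirror Leaf = Leaf"
| "mirror (Branch l r) = Branch (mirror r) (mirror l)"

definition trees :: "nat \<Rightarrow> bintree set" where
  "trees n = {t. nodes t = n}"

lemma trees_0: "trees 0 = {Leaf}"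
  by (auto simp: trees_def elim: nodes.elims)

lemma trees_Suc: "trees (Suc n) = (\<Union>k\<le>n. case_prod Branch ` (trees k \<times> trees (n - k)))"
proof (intro equalityI subsetI)
  fix t assume "t \<in> trees (Suc n)"
  then obtain l r where t: "t = Branch l r" "nodes l + nodes r = n"
    by (cases t) (auto simp: trees_def)
  then have "nodes l \<le> n" "l \<in> trees (nodes l)" "r \<in> trees (n - nodes l)"
    by (auto simp: trees_def)
  then show "t \<in> (\<Union>k\<le>n. case_prod Branch ` (trees k \<times> trees (n - k)))"
    unfolding t(1) by (intro UN_I[of "nodes l"] image_eqI[of _ _ "(l, r)"]) simp_all
qed (auto simp: trees_def)

lemma finite_trees: "finite (trees n)"
proof (induction n rule: less_induct)
  case (less n)
  then have "finite (trees (Suc m))" if "n = Suc m" for m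
    unfolding trees_Suc using that by (intro finite_UN_I finite_imageI finite_cartesian_product) auto
  then show ?case
    by (cases n) (simp_all add: trees_0)
qed

lemma mirror_mirror [simp]: "mirror (mirror t) = t"
  by (induction t) auto

lemma nodes_mirror [simp]: "nodes (mirror t) = nodes t"
  by (induction t) auto

lemma spine_mirror [simp]:
  "left_spine (mirror t) = right_spine t" "right_spine (mirror t) = left_spine t"
  by (induction t) auto

section \<open>Equidistribution\<close>

text \<open>A bijection instead of an equality of counts: it composes, and it yields both the
  weighted sums (\<open>equidist_sum\<close>) and the counts (\<open>equidist_card\<close>) without
  any finiteness assumption on the classes.\<close>

definition equidist ::
    "'a set \<Rightarrow> ('a \<Rightarrow> nat) \<Rightarrow> ('a \<Rightarrow> nat) \<Rightarrow> 'b set \<Rightarrow> ('b \<Rightarrow> nat) \<Rightarrow> ('b \<Rightarrow> nat) \<Rightarrow> bool" where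
  "equidist A f g B f' g' \<longleftrightarrow>
     (\<exists>h. bij_betw h A B \<and> (\<forall>x\<in>A. f' (h x) = f x \<and> g' (h x) = g x))"

lemma equidistI:
  assumes "bij_betw h A B" "\<And>x. x \<in> A \<Longrightarrow> f' (h x) = f x" "\<And>x. x \<in> A \<Longrightarrow> g' (h x) = g x"
  shows "equidist A f g B f' g'"
  using assms unfolding equidist_def by blast

lemma equidist_trans:
  assumes "equidist A f g B f' g'" "equidist B f' g' C f'' g''"
  shows "equidist A f g C f'' g''"
proof -
  obtain h k where h: "bij_betw h A B" "\<forall>x\<in>A. f' (h x) = f x \<and> g' (h x) = g x"
    and k: "bij_betw k B C" "\<forall>x\<in>B. f'' (k x) = f' x \<and> g'' (k x) = g' x"
    using assms unfolding equidist_def by blast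
  show ?thesis
    by (rule equidistI[of "k \<circ> h"]) (use h k in \<open>auto intro: bij_betw_trans dest: bij_betwE\<close>)
qed

lemma equidist_swap: "equidist A f g B f' g' \<Longrightarrow> equidist A g f B g' f'"
  unfolding equidist_def by blast

lemma equidist_sum:
  assumes "equidist A f g B f' g'"
  shows "(\<Sum>x\<in>B. w (f' x) (g' x)) = (\<Sum>x\<in>A. w (f x) (g x))"
proof -
  obtain h where h: "bij_betw h A B" "\<forall>x\<in>A. f' (h x) = f x \<and> g' (h x) = g x"
    using assms unfolding equidist_def by blast
  show ?thesis
    by (rule sum.reindex_bij_betw[OF h(1), symmetric, THEN trans]) (use h(2) in auto)
qed

lemma equidist_card:
  assumes "equidist A f g B f' g'"
  shows "card {x \<in> B. f' x = i \<and> g' x = j} = card {x \<in> A. f x = i \<and> g x = j}"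
proof -
  obtain h where h: "bij_betw h A B" "\<forall>x\<in>A. f' (h x) = f x \<and> g' (h x) = g x"
    using assms unfolding equidist_def by blast
  have "bij_betw h {x \<in> A. f x = i \<and> g x = j} {x \<in> B. f' x = i \<and> g' x = j}"
    using h by (force simp: bij_betw_def inj_on_def)
  then show ?thesis
    using bij_betw_same_card by fastforce
qed

lemma trees_equidist_mirror:
  "equidist (trees n) left_spine right_spine (trees n) right_spine left_spine"
  by (rule equidistI[of mirror])
    (auto intro!: bij_betwI[where g = mirror] simp: trees_def)

text \<open>The class inherits the symmetry of trees: through \<open>mirror\<close> the trees are
  also equidistributed with the class when its two statistics are exchanged, and both counts equal
  the same count of trees.\<close>

lemma symmetric_joint_if_equidist:
  assumes "\<And>n. equidist (trees n) left_spine right_spine (S n) f g"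
  shows "symmetric_joint S f g"
proof -
  have "equidist (trees n) left_spine right_spine (S n) g f" for n
    using equidist_trans[OF trees_equidist_mirror equidist_swap[OF assms]] .
  note swapped = equidist_card[OF this]
  show ?thesis
    unfolding symmetric_joint_def
  proof (intro allI)
    fix n i j
    have "card {x \<in> S n. f x = i \<and> g x = j} = card {t \<in> trees n. left_spine t = i \<and> right_spine t = j}"
      by (rule equidist_card[OF assms])
    also have "\<dots> = card {x \<in> S n. g x = i \<and> f x = j}"
      by (rule swapped[symmetric])
    finally show "card {x \<in> S n. f x = i \<and> g x = j} = card {x \<in> S n. f x = j \<and> g x = i}"
      by (simp add: conj_commute)
  qed
qed

section \<open>Generating trees\<close>

text \<open>
  In the generating tree \<open>(i, j) \<rightarrow> (i + 1, 1), (i, 2), \<dots>, (i, j + 1)\<close> the children of a node are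
  identified by the second component of their labels.
\<close>

locale generating_tree =
  fixes S :: "nat \<Rightarrow> 'a set" and f g :: "'a \<Rightarrow> nat" and parent :: "'a \<Rightarrow> 'a" and root :: 'a
  assumes S_0: "S 0 = {root}" and root: "f root = 0" "g root = 0"
    and parent: "\<And>n w. w \<in> S (Suc n) \<Longrightarrow> parent w \<in> S n"
    and children: "\<And>n x. x \<in> S n \<Longrightarrow> bij_betw g {w \<in> S (Suc n). parent w = x} {1..Suc (g x)}"
    and f_child: "\<And>n w. w \<in> S (Suc n) \<Longrightarrow> f w = (if g w = 1 then Suc (f (parent w)) else f (parent w))"
begin

lemma children_cases:
  assumes "w \<in> S (Suc n)"
  shows "g w \<in> {1..Suc (g (parent w))}"
  using bij_betwE[OF children[OF parent[OF assms]]] assms by blast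

lemma child_ex:
  assumes "x \<in> S n" "k \<in> {1..Suc (g x)}"
  obtains w where "w \<in> S (Suc n)" "parent w = x" "g w = k"
  using children[OF assms(1)] assms(2) unfolding bij_betw_def by (auto dest!: equalityD2)

lemma child_unique:
  assumes "w \<in> S (Suc n)" "w' \<in> S (Suc n)" "parent w = parent w'" "g w = g w'"
  shows "w = w'"
  using children[OF parent[OF assms(1)]] assms unfolding bij_betw_def inj_on_def by auto

end

text \<open>Induction on the level. The labels available to children depend only on the second label
  of the parent, and parent and label determine the child; so a bijection that respects labels lifts
  by sending a child of x to the equally labelled child of the image of x. The first labels then
  agree by \<open>f_child\<close>.\<close>

lemma generating_trees_equidist:
  assumes "generating_tree S f g p r" "generating_tree S' f' g' p' r'"
  shows "equidist (S n) f g (S' n) f' g'"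
proof (induction n)
  interpret A: generating_tree S f g p r by fact
  interpret B: generating_tree S' f' g' p' r' by fact
  case 0
  show ?case
    by (rule equidistI[of "\<lambda>_. r'"]) (simp_all add: A.S_0 B.S_0 A.root B.root bij_betw_def)
next
  interpret A: generating_tree S f g p r by fact
  interpret B: generating_tree S' f' g' p' r' by fact
  case (Suc n)
  then obtain h where h: "bij_betw h (S n) (S' n)" "\<forall>x\<in>S n. f' (h x) = f x \<and> g' (h x) = g x"
    unfolding equidist_def by blast
  have hS: "h x \<in> S' n" if "x \<in> S n" for x
    using h(1) that by (auto dest: bij_betwE)
  have "\<exists>w'. w' \<in> S' (Suc n) \<and> p' w' = h (p w) \<and> g' w' = g w" if w: "w \<in> S (Suc n)" for w
    using B.child_ex[OF hS[OF A.parent[OF w]]] A.children_cases[OF w] h(2) A.parent[OF w] by metis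
  then obtain k where k: "\<And>w. w \<in> S (Suc n) \<Longrightarrow> k w \<in> S' (Suc n) \<and> p' (k w) = h (p w) \<and> g' (k w) = g w"
    by metis
  have "inj_on k (S (Suc n))"
  proof (rule inj_onI)
    fix v w assume vw: "v \<in> S (Suc n)" "w \<in> S (Suc n)" "k v = k w"
    then have "h (p v) = h (p w)" "g v = g w"
      using k by metis+
    then show "v = w"
      using A.child_unique[OF vw(1,2)] h(1) A.parent vw(1,2) by (auto simp: bij_betw_def inj_on_def)
  qed
  moreover have "w' \<in> k ` S (Suc n)" if w': "w' \<in> S' (Suc n)" for w'
  proof -
    obtain x where x: "x \<in> S n" "h x = p' w'"
      using h(1) B.parent[OF w'] by (auto simp: bij_betw_def dest!: equalityD2)
    obtain w where w: "w \<in> S (Suc n)" "p w = x" "g w = g' w'"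
      using A.child_ex[OF x(1)] B.children_cases[OF w'] x h(2) by metis
    have "k w = w'"
      using B.child_unique[of "k w" n w'] k[OF w(1)] w x w' by auto
    then show ?thesis
      using w(1) by blast
  qed
  ultimately have "bij_betw k (S (Suc n)) (S' (Suc n))"
    using k unfolding bij_betw_def by blast
  then show ?case
  proof (rule equidistI)
    fix w assume w: "w \<in> S (Suc n)"
    show "f' (k w) = f w"
      using A.f_child[OF w] B.f_child[of "k w" n] k[OF w] h(2) A.parent[OF w] by simp
    show "g' (k w) = g w"
      using k[OF w] by simp
  qed
qed

text \<open>The inverse of growing a tree: a new node is put on the right spine and takes the
  subtree found there as its left subtree. Its depth becomes the right spine of the child and hence
  the label; only at depth 1, above the old root, does it lengthen the left spine.\<close>

fun remove_rightmost :: "bintree \<Rightarrow> bintree" where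
  "remove_rightmost Leaf = Leaf"
| "remove_rightmost (Branch l Leaf) = l"
| "remove_rightmost (Branch l r) = Branch l (remove_rightmost r)"

lemma remove_rightmost_Branch:
  "r \<noteq> Leaf \<Longrightarrow> remove_rightmost (Branch l r) = Branch l (remove_rightmost r)"
  by (cases r) auto

lemma nodes_remove_rightmost: "nodes (remove_rightmost t) = nodes t - 1"
  by (induction t rule: remove_rightmost.induct) auto

lemma right_spine_pos: "t \<noteq> Leaf \<Longrightarrow> 0 < right_spine t"
  by (cases t) auto

lemma remove_rightmost_child_ex:
  "1 \<le> k \<Longrightarrow> k \<le> Suc (right_spine x) \<Longrightarrow>
     \<exists>w. w \<noteq> Leaf \<and> nodes w = Suc (nodes x) \<and> remove_rightmost w = x \<and> right_spine w = k"
proof (induction x arbitrary: k)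
  case Leaf
  then show ?case
    by (intro exI[of _ "Branch Leaf Leaf"]) auto
next
  case (Branch l r)
  show ?case
  proof (cases "k = 1")
    case True
    then show ?thesis
      by (intro exI[of _ "Branch (Branch l r) Leaf"]) auto
  next
    case False
    then have "1 \<le> k - 1" "k - 1 \<le> Suc (right_spine r)"
      using Branch.prems by auto
    then obtain w where "w \<noteq> Leaf" "nodes w = Suc (nodes r)" "remove_rightmost w = r" "right_spine w = k - 1"
      using Branch.IH(2) by blast
    then show ?thesis
      using False Branch.prems by (intro exI[of _ "Branch l w"]) (auto simp: remove_rightmost_Branch)
  qed
qed

lemma right_spine_child:
  "t \<noteq> Leaf \<Longrightarrow> right_spine t \<in> {1..Suc (right_spine (remove_rightmost t))}"
  by (induction t rule: remove_rightmost.induct) auto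

lemma remove_rightmost_inj:
  "v \<noteq> Leaf \<Longrightarrow> w \<noteq> Leaf \<Longrightarrow> remove_rightmost v = remove_rightmost w \<Longrightarrow> right_spine v = right_spine w \<Longrightarrow> v = w"
proof (induction v arbitrary: w)
  case (Branch l r)
  obtain l' r' where w: "w = Branch l' r'"
    using Branch.prems by (cases w) auto
  \<comment> \<open>The equal remainders alone would allow the removed node to be the root of just
    one of the two trees; the equal right spines exclude this.\<close>
  have "r = Leaf \<longleftrightarrow> r' = Leaf"
    using Branch.prems(4) w right_spine_pos[of r] right_spine_pos[of r'] by (cases r; cases r') auto
  then show ?case
    using Branch w by (cases "r = Leaf") (auto simp: remove_rightmost_Branch)
qed simp

lemma left_spine_child:
  "t \<noteq> Leaf \<Longrightarrow> left_spine t =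
     (if right_spine t = 1 then Suc (left_spine (remove_rightmost t)) else left_spine (remove_rightmost t))"
proof (cases t)
  case (Branch l r)
  then show ?thesis
    using right_spine_pos[of r] by (cases "r = Leaf") (auto simp: remove_rightmost_Branch)
qed simp

lemma generating_tree_trees: "generating_tree trees left_spine right_spine remove_rightmost Leaf"
proof unfold_locales
  fix n x assume x: "x \<in> trees n"
  have "inj_on right_spine {w \<in> trees (Suc n). remove_rightmost w = x}"
    by (rule inj_onI, rule remove_rightmost_inj) (auto simp: trees_def)
  moreover have "right_spine w \<in> {1..Suc (right_spine x)}" if "w \<in> trees (Suc n)" "remove_rightmost w = x" for w
    using right_spine_child[of w] that by (cases "w = Leaf") (auto simp: trees_def)
  moreover have "k \<in> right_spine ` {w \<in> trees (Suc n). remove_rightmost w = x}" if "k \<in> {1..Suc (right_spine x)}" for k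
    using remove_rightmost_child_ex[of k x] that x by (force simp: trees_def)
  ultimately show "bij_betw right_spine {w \<in> trees (Suc n). remove_rightmost w = x} {1..Suc (right_spine x)}"
    unfolding bij_betw_def by blast
next
  fix n w assume "w \<in> trees (Suc n)"
  then have "w \<noteq> Leaf" "nodes w = Suc n"
    by (auto simp: trees_def)
  then show "remove_rightmost w \<in> trees n"
      "left_spine w = (if right_spine w = 1 then Suc (left_spine (remove_rightmost w)) else left_spine (remove_rightmost w))"
    using left_spine_child by (simp_all add: trees_def nodes_remove_rightmost)
qed (simp_all add: trees_0)

lemma generating_tree_equidist:
  assumes "generating_tree S f g p r"
  shows "equidist (trees n) left_spine right_spine (S n) f g"
  using generating_trees_equidist[OF generating_tree_trees assms] .

text \<open>For semiorders, where the first statistic of the theorem, the number of minimal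
  elements, is the one that identifies a child.\<close>

lemma generating_tree_equidist_swap:
  assumes "generating_tree S g f p r"
  shows "equidist (trees n) left_spine right_spine (S n) f g"
  using equidist_trans[OF trees_equidist_mirror equidist_swap[OF generating_tree_equidist[OF assms]]] .

section \<open>The generating function\<close>

text \<open>The weights are ring elements instead of fixed variables, so that the specialisations to
  1 on the right of the recursion are again instances of the same series.\<close>

definition tree_gf :: "'a::comm_ring_1 \<Rightarrow> 'a \<Rightarrow> 'a fps" where
  "tree_gf a b = Abs_fps (\<lambda>n. \<Sum>t\<in>trees n. a ^ left_spine t * b ^ right_spine t)"

text \<open>The left spine sees only the left subtree and the right spine only the right one; in
  each factor the other statistic is forgotten by setting its weight to 1.\<close>

lemma tree_gf_rec: "tree_gf a b = 1 + fps_const (a * b) * fps_X * tree_gf a 1 * tree_gf 1 b"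
proof (rule fps_ext)
  fix n
  show "tree_gf a b $ n = (1 + fps_const (a * b) * fps_X * tree_gf a 1 * tree_gf 1 b) $ n"
  proof (cases n)
    case 0
    then show ?thesis by (simp add: tree_gf_def trees_0 fps_mult_nth)
  next
    case (Suc m)
    have "tree_gf a b $ n = (\<Sum>k\<le>m. \<Sum>t\<in>case_prod Branch ` (trees k \<times> trees (m - k)). a ^ left_spine t * b ^ right_spine t)"
      unfolding tree_gf_def fps_nth_Abs_fps Suc trees_Suc
      by (rule sum.UNION_disjoint) (auto simp: finite_trees, auto simp: trees_def)
    also have "\<dots> = (\<Sum>k\<le>m. \<Sum>(u, v)\<in>trees k \<times> trees (m - k). a * b * (a ^ left_spine u * b ^ right_spine v))"
      by (intro sum.cong refl, subst sum.reindex) (auto simp: inj_on_def algebra_simps intro!: sum.cong)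
    also have "\<dots> = a * b * (\<Sum>k\<le>m. tree_gf a 1 $ k * tree_gf 1 b $ (m - k))"
    proof -
      have "(\<Sum>(u, v)\<in>A \<times> B. a * b * (p u * q v)) = a * b * (sum p A * sum q B)"
        for A B :: "bintree set" and p q :: "bintree \<Rightarrow> 'a"
        unfolding sum_product sum.cartesian_product sum_distrib_left[of "a * b"] split_def ..
      then show ?thesis
        by (simp add: tree_gf_def sum_distrib_left[of "a * b"])
    qed
    also have "\<dots> = (1 + fps_const (a * b) * fps_X * tree_gf a 1 * tree_gf 1 b) $ n"
      by (simp add: Suc mult.assoc fps_mult_nth[of "tree_gf a 1"] atLeast0AtMost)
    finally show ?thesis .
  qed
qed

lemma joint_gf_if_equidist:
  assumes "\<And>n. equidist (trees n) left_spine right_spine (S n) f g"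
  shows "joint_gf S f g = tree_gf y_var z_var"
  unfolding joint_gf_def tree_gf_def by (rule fps_ext) (simp add: equidist_sum[OF assms, of "\<lambda>i j. y_var ^ i * z_var ^ j"])

text \<open>At y = z = 1 the recursion is the quadratic equation G = 1 + t G^2, so 1 - 2tG squares
  to 1 - 4t. Of the two square roots the constant term selects the right one.\<close>

lemma sqrt_eq: "1 - sqrt_1_minus_4t = 2 * fps_X * tree_gf 1 1"
proof -
  let ?G = "tree_gf 1 1 :: coeff_field fps"
  have G: "?G = 1 + fps_X * ?G * ?G"
    using tree_gf_rec[of "1::coeff_field" 1] by simp
  have "(1 - 2 * fps_X * ?G) ^ 2 = 1 - 4 * fps_X * (?G - fps_X * ?G * ?G)"
    by (simp add: power2_eq_square algebra_simps)
  also have "?G - fps_X * ?G * ?G = 1"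
    using G by (metis add_diff_cancel_right')
  finally have "(1 - 2 * fps_X * ?G) ^ 2 = 1 - 4 * fps_X"
    by simp
  \<comment> \<open>\<open>fps_radical\<close> is a square root as soon as the prescribed root of
    the constant term is one, and 1^2 = 1.\<close>
  moreover have "sqrt_1_minus_4t ^ 2 = 1 - 4 * fps_X"
    unfolding sqrt_1_minus_4t_def numeral_2_eq_2
    by (subst power_radical[symmetric]) auto
  ultimately have "(sqrt_1_minus_4t - (1 - 2 * fps_X * ?G)) * (sqrt_1_minus_4t + (1 - 2 * fps_X * ?G)) = 0"
    by algebra
  \<comment> \<open>Both summands have constant term 1, so this factor has constant term 2 and the
    other factor must vanish.\<close>
  moreover have "(sqrt_1_minus_4t + (1 - 2 * fps_X * ?G)) $ 0 \<noteq> 0"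
    by (simp add: sqrt_1_minus_4t_def fps_mult_nth)
  then have "sqrt_1_minus_4t + (1 - 2 * fps_X * ?G) \<noteq> 0"
    by (metis fps_zero_nth)
  ultimately have "sqrt_1_minus_4t - (1 - 2 * fps_X * ?G) = 0"
    unfolding mult_eq_0_iff by blast
  then show ?thesis
    by (simp add: algebra_simps)
qed

text \<open>The divisor 2t is not a unit; the division is exact because \<open>sqrt_eq\<close>
  exhibits 2t as a factor of the numerator.\<close>

lemma catalan_gf_eq: "catalan_gf = tree_gf 1 1"
proof -
  have "(2::coeff_field fps) * fps_X \<noteq> 0"
    by simp
  then show ?thesis
    unfolding catalan_gf_def sqrt_eq by (metis nonzero_mult_div_cancel_left)
qed

lemma fps_eq_divide_if: 
  fixes u v w :: "'a::field fps"
  assumes "u * w = v" "w $ 0 \<noteq> 0"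
  shows "u = v / w"
  using assms by (metis fps_zero_nth nonzero_mult_div_cancel_right)

text \<open>With one weight set to 1 the recursion becomes a linear equation whose coefficient
  involves only G(1,1) = C(t); its solution is the quotient C(a,t).\<close>

lemma catalan_gf2_eq:
  "catalan_gf2 (fps_const a) = tree_gf a 1" "catalan_gf2 (fps_const a) = tree_gf 1 a"
proof -
  have l: "tree_gf a 1 = 1 + fps_const a * fps_X * tree_gf a 1 * tree_gf 1 1"
    using tree_gf_rec[of a 1] by simp
  have r: "tree_gf 1 a = 1 + fps_const a * fps_X * tree_gf 1 1 * tree_gf 1 a"
    using tree_gf_rec[of 1 a] by simp
  have nz: "(1 - fps_const a * fps_X * tree_gf 1 1) $ 0 \<noteq> 0"
    by (simp add: fps_mult_nth)
  have "tree_gf a 1 * (1 - fps_const a * fps_X * tree_gf 1 1) = tree_gf a 1 - fps_const a * fps_X * tree_gf a 1 * tree_gf 1 1"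
    by (simp add: algebra_simps)
  also have "\<dots> = 1"
    by (subst (1) l) simp
  finally show "catalan_gf2 (fps_const a) = tree_gf a 1"
    unfolding catalan_gf2_def catalan_gf_eq using fps_eq_divide_if[OF _ nz] by metis
  have "tree_gf 1 a * (1 - fps_const a * fps_X * tree_gf 1 1) = tree_gf 1 a - fps_const a * fps_X * tree_gf 1 1 * tree_gf 1 a"
    by (simp add: algebra_simps)
  also have "\<dots> = 1"
    by (subst (1) r) simp
  finally show "catalan_gf2 (fps_const a) = tree_gf 1 a"
    unfolding catalan_gf2_def catalan_gf_eq using fps_eq_divide_if[OF _ nz] by metis
qed

lemma tree_gf_closed:
  "tree_gf a b = 1 + fps_const a * fps_const b * fps_X * catalan_gf2 (fps_const a) * catalan_gf2 (fps_const b)"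
  unfolding catalan_gf2_eq(1)[of a] catalan_gf2_eq(2)[of b] using tree_gf_rec[of a b] by simp

text \<open>By \<open>sqrt_eq\<close> each factor of the denominator is twice 1 - x t C(t), so the
  two factors 2 cancel the 4 in the numerator.\<close>

lemma closed_form_eq:
  "1 + 4 * fps_const a * fps_const b * fps_X
         / ((2 - fps_const a * (1 - sqrt_1_minus_4t)) * (2 - fps_const b * (1 - sqrt_1_minus_4t)))
     = 1 + fps_const a * fps_const b * fps_X * catalan_gf2 (fps_const a) * catalan_gf2 (fps_const b)"
proof -
  define u v where "u = 1 - fps_const a * fps_X * catalan_gf" and "v = 1 - fps_const b * fps_X * catalan_gf"
  have "2 - fps_const a * (1 - sqrt_1_minus_4t) = 2 * u" "2 - fps_const b * (1 - sqrt_1_minus_4t) = 2 * v"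
    by (simp_all add: u_def v_def sqrt_eq catalan_gf_eq algebra_simps)
  moreover have nz: "u $ 0 \<noteq> 0" "v $ 0 \<noteq> 0"
    by (simp_all add: u_def v_def fps_mult_nth)
  moreover have uv: "catalan_gf2 (fps_const a) = 1 / u" "catalan_gf2 (fps_const b) = 1 / v"
    by (simp_all add: u_def v_def catalan_gf2_def)
  moreover have "(1 / u) * u = 1" "(1 / v) * v = 1"
    using nz by (simp_all add: fps_divide_unit inverse_mult_eq_1)
  then have "fps_const a * fps_const b * fps_X * (1 / u) * (1 / v) * (2 * u * (2 * v)) = 4 * fps_const a * fps_const b * fps_X"
    by algebra
  then have "fps_const a * fps_const b * fps_X * (1 / u) * (1 / v) = 4 * fps_const a * fps_const b * fps_X / (2 * u * (2 * v))"
    by (rule fps_eq_divide_if) (use nz in \<open>simp add: fps_mult_nth\<close>)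
  ultimately show ?thesis
    by simp
qed

section \<open>Ascent sequences avoiding 101\<close>

text \<open>Supplies consecutive labels 1, 2, ... wherever objects are told apart by numbers from a
  finite set: the entries that may be appended to an ascent sequence, and the openers of
  indistinguishable arcs.\<close>

lemma bij_betw_rank:
  fixes A :: "nat set"
  assumes "finite A"
  shows "bij_betw (\<lambda>x. Suc (card {v \<in> A. v < x})) A {1..card A}"
proof -
  have mono: "card {v \<in> A. v < x} < card {v \<in> A. v < y}" if "x \<in> A" "x < y" for x y
    by (rule psubset_card_mono) (use assms that in auto)
  have inj: "inj_on (\<lambda>x. Suc (card {v \<in> A. v < x})) A"
  proof (rule inj_onI)
    fix x y assume "x \<in> A" "y \<in> A" "Suc (card {v \<in> A. v < x}) = Suc (card {v \<in> A. v < y})"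
    then show "x = y"
      using mono[of x y] mono[of y x] by (cases x y rule: linorder_cases) simp_all
  qed
  have "card {v \<in> A. v < x} < card A" if "x \<in> A" for x
    by (rule psubset_card_mono) (use assms that in auto)
  then have "(\<lambda>x. Suc (card {v \<in> A. v < x})) ` A \<subseteq> {1..card A}"
    by (intro image_subsetI) (simp add: Suc_le_eq)
  then have "(\<lambda>x. Suc (card {v \<in> A. v < x})) ` A = {1..card A}"
    by (intro card_subset_eq) (simp_all add: card_image[OF inj])
  then show ?thesis
    using inj by (simp add: bij_betw_def)
qed

text \<open>Values instead of positions, because these are the old values that can be appended once
  more without creating 101.\<close>

definition rmin_values :: "nat list \<Rightarrow> nat set" where
  "rmin_values xs = {xs ! i | i. i < length xs \<and> (\<forall>j. i < j \<and> j < length xs \<longrightarrow> xs ! i < xs ! j)}"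

lemma rmin_values_Nil [simp]: "rmin_values [] = {}"
  by (simp add: rmin_values_def)

lemma finite_rmin_values [simp]: "finite (rmin_values xs)"
  by (simp add: rmin_values_def)

lemma rmin_values_subset: "rmin_values xs \<subseteq> set xs"
  by (auto simp: rmin_values_def)

lemma rmin_eq_card: "rmin xs = card (rmin_values xs)"
proof -
  let ?I = "{i. i < length xs \<and> (\<forall>j. i < j \<and> j < length xs \<longrightarrow> xs ! i < xs ! j)}"
  have "inj_on ((!) xs) ?I"
    by (rule inj_onI) (metis (mono_tags, lifting) less_irrefl linorder_neqE_nat mem_Collect_eq)
  moreover have "rmin_values xs = (!) xs ` ?I"
    by (auto simp: rmin_values_def)
  ultimately show ?thesis
    by (simp add: rmin_def card_image)
qed

lemma rmin_values_snoc: "rmin_values (xs @ [x]) = insert x {v \<in> rmin_values xs. v < x}"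
proof (intro equalityI subsetI)
  fix v assume "v \<in> rmin_values (xs @ [x])"
  then obtain i where i: "v = (xs @ [x]) ! i" "i < Suc (length xs)"
    "\<And>j. i < j \<Longrightarrow> j < Suc (length xs) \<Longrightarrow> (xs @ [x]) ! i < (xs @ [x]) ! j"
    by (auto simp: rmin_values_def)
  show "v \<in> insert x {v \<in> rmin_values xs. v < x}"
  proof (cases "i = length xs")
    case False
    then have "i < length xs"
      using i(2) by simp
    moreover have "xs ! i < xs ! j" if "i < j" "j < length xs" for j
      using i(3)[of j] that by (simp add: nth_append)
    moreover have "xs ! i < x"
      using i(3)[of "length xs"] \<open>i < length xs\<close> by (simp add: nth_append)
    ultimately show ?thesis
      using i(1) by (auto simp: rmin_values_def nth_append)
  qed (use i in simp)
next
  fix v assume "v \<in> insert x {v \<in> rmin_values xs. v < x}"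
  then consider "v = x" | i where "v = xs ! i" "i < length xs" "xs ! i < x"
      "\<And>j. i < j \<Longrightarrow> j < length xs \<Longrightarrow> xs ! i < xs ! j"
    by (auto simp: rmin_values_def)
  then show "v \<in> rmin_values (xs @ [x])"
  proof cases
    case 1
    then show ?thesis
      unfolding rmin_values_def by (intro CollectI exI[of _ "length xs"]) auto
  next
    case 2
    then show ?thesis
      unfolding rmin_values_def by (intro CollectI exI[of _ i]) (auto simp: nth_append less_Suc_eq)
  qed
qed

definition has_101 :: "nat list \<Rightarrow> bool" where
  "has_101 xs \<longleftrightarrow> (\<exists>i j k. i < j \<and> j < k \<and> k < length xs \<and> xs ! i = xs ! k \<and> xs ! k > xs ! j)"

text \<open>Appending x completes a 101 exactly if some x is followed by a smaller entry. For the
  last occurrence of x this means that it is not a right-to-left minimum; conversely, if x is the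
  value of such a minimum, then any smaller entry after an earlier x comes before that minimum and
  forms a 101 already in xs.\<close>

lemma has_101_snoc:
  "has_101 (xs @ [x]) \<longleftrightarrow> has_101 xs \<or> x \<in> set xs - rmin_values xs"
proof
  assume "has_101 (xs @ [x])"
  then obtain i j k where ijk: "i < j" "j < k" "k < Suc (length xs)"
    "(xs @ [x]) ! i = (xs @ [x]) ! k" "(xs @ [x]) ! k > (xs @ [x]) ! j"
    by (auto simp: has_101_def)
  show "has_101 xs \<or> x \<in> set xs - rmin_values xs"
  proof (cases "k = length xs")
    case True
    then have x: "xs ! i = x" "xs ! j < x" "i < j" "j < length xs"
      using ijk by (auto simp: nth_append)
    have "x \<notin> rmin_values xs" if nh: "\<not> has_101 xs"
    proof
      assume "x \<in> rmin_values xs"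
      then obtain l where l: "x = xs ! l" "l < length xs" "\<And>j. l < j \<Longrightarrow> j < length xs \<Longrightarrow> xs ! l < xs ! j"
        by (auto simp: rmin_values_def)
      then have "j < l"
        using x by (metis linorder_neqE_nat order_less_asym)
      then show False
        using nh x l unfolding has_101_def by metis
    qed
    then show ?thesis
      using x by force
  next
    case False
    then show ?thesis
      using ijk unfolding has_101_def by (intro disjI1 exI[of _ i] exI[of _ j] exI[of _ k]) (auto simp: nth_append)
  qed
next
  assume "has_101 xs \<or> x \<in> set xs - rmin_values xs"
  then show "has_101 (xs @ [x])"
  proof
    assume "has_101 xs"
    then obtain i j k where "i < j" "j < k" "k < length xs" "xs ! i = xs ! k" "xs ! k > xs ! j"
      by (auto simp: has_101_def)
    then show ?thesis
      unfolding has_101_def by (intro exI[of _ i] exI[of _ j] exI[of _ k]) (auto simp: nth_append)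
  next
    assume x: "x \<in> set xs - rmin_values xs"
    let ?I = "{i. i < length xs \<and> xs ! i = x}"
    define i where "i = Max ?I"
    have "?I \<noteq> {}" "finite ?I"
      using x by (auto simp: in_set_conv_nth)
    then have i: "i < length xs" "xs ! i = x"
      unfolding i_def using Max_in by blast+
    have last: "j \<le> i" if "j < length xs" "xs ! j = x" for j
      unfolding i_def using that \<open>finite ?I\<close> by (intro Max_ge) auto
    obtain j where j: "i < j" "j < length xs" "\<not> xs ! i < xs ! j"
      using x i by (auto simp: rmin_values_def)
    then have "xs ! j < x"
      using last[of j] i by (metis linorder_neqE_nat not_le)
    then show ?thesis
      unfolding has_101_def using i j by (intro exI[of _ i] exI[of _ j] exI[of _ "length xs"]) (auto simp: nth_append)
  qed
qed

lemma asc_snoc: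
  "asc (xs @ [x]) = asc xs + (if xs \<noteq> [] \<and> last xs < x then 1 else 0)"
proof -
  have "{j. Suc j < length (xs @ [x]) \<and> (xs @ [x]) ! j < (xs @ [x]) ! Suc j}
      = {j. Suc j < length xs \<and> xs ! j < xs ! Suc j} \<union> (if xs \<noteq> [] \<and> last xs < x then {length xs - 1} else {})"
  proof (cases xs rule: rev_cases)
    case (snoc ys l)
    have len: "length xs = Suc (length ys)" "last xs = l" "xs \<noteq> []"
      by (simp_all add: snoc)
    have nth: "(xs @ [x]) ! length ys = l" "(xs @ [x]) ! Suc (length ys) = x"
      by (simp_all add: snoc nth_append)
    have "Suc j < length (xs @ [x]) \<and> (xs @ [x]) ! j < (xs @ [x]) ! Suc j \<longleftrightarrow>
        Suc j < length xs \<and> xs ! j < xs ! Suc j \<or> j = length ys \<and> l < x" for j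
    proof (cases "j = length ys")
      case True
      then show ?thesis
        using nth by (simp add: len)
    next
      case False
      then show ?thesis
        by (cases "Suc j < length xs") (auto simp: len nth_append)
    qed
    then show ?thesis
      using len by auto
  qed simp
  moreover have "length xs - 1 \<notin> {j. Suc j < length xs \<and> xs ! j < xs ! Suc j}"
    by auto
  moreover have "finite {j. Suc j < length xs \<and> xs ! j < xs ! Suc j}"
    by (rule finite_subset[of _ "{..<length xs}"]) auto
  ultimately show ?thesis
    by (simp add: asc_def)
qed

lemma ascent_seqs_snoc:
  "xs @ [x] \<in> ascent_seqs (Suc n) \<longleftrightarrow> xs \<in> ascent_seqs n \<and> x \<le> (if xs = [] then 0 else 1 + asc xs)"
proof (cases "length xs = n")
  case True
  have "(\<forall>i. 1 \<le> i \<and> i < Suc n \<longrightarrow> (xs @ [x]) ! i \<le> 1 + asc (take i (xs @ [x]))) \<longleftrightarrow>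
    (\<forall>i. 1 \<le> i \<and> i < n \<longrightarrow> xs ! i \<le> 1 + asc (take i xs)) \<and> (1 \<le> n \<longrightarrow> x \<le> 1 + asc xs)"
    using True by (auto simp: less_Suc_eq nth_append)
  then show ?thesis
    using True by (cases "xs = []"; cases n) (simp_all add: ascent_seqs_def nth_append)
qed (simp add: ascent_seqs_def)

lemma ascent_seqs_101_alt: "ascent_seqs_101 n = {xs \<in> ascent_seqs n. \<not> has_101 xs}"
  by (auto simp: ascent_seqs_101_def has_101_def ascent_seqs_def)

text \<open>
  In a 101-avoiding sequence every ascent leads to a new value, so such ascent sequences are
  restricted growth functions.
\<close>

lemma ascent_seqs_101_values:
  "xs \<in> ascent_seqs_101 n \<Longrightarrow>
     set xs = {..<if xs = [] then 0 else Suc (asc xs)} \<and> (xs \<noteq> [] \<longrightarrow> 0 \<in> rmin_values xs)"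
proof (induction xs arbitrary: n rule: rev_induct)
  case Nil
  then show ?case by simp
next
  case (snoc x xs)
  have "n \<noteq> 0"
    using snoc.prems by (auto simp: ascent_seqs_101_def ascent_seqs_def)
  then obtain m where n: "n = Suc m"
    using not0_implies_Suc by blast
  have xs: "xs \<in> ascent_seqs_101 m" and x: "x \<le> (if xs = [] then 0 else 1 + asc xs)" "x \<notin> set xs - rmin_values xs"
    using snoc.prems unfolding n ascent_seqs_101_alt by (auto simp: ascent_seqs_snoc has_101_snoc)
  show ?case
  proof (cases "xs = []")
    case True
    then show ?thesis
      using x rmin_values_snoc[of "[]" 0] by (simp add: asc_def lessThan_Suc)
  next
    case False
    have IH: "set xs = {..<Suc (asc xs)}" "0 \<in> rmin_values xs"
      using snoc.IH[OF xs] False by auto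
    have last: "last xs < Suc (asc xs)"
      using last_in_set[OF False] unfolding IH by simp
    show ?thesis
    proof (cases "x < Suc (asc xs)")
      case True
      \<comment> \<open>An old value can be repeated only if it is a right-to-left minimum; then it
        does not exceed the last entry, so no ascent and no new value arise.\<close>
      then have "x \<in> rmin_values xs"
        using x IH by simp
      then obtain i where i: "x = xs ! i" "i < length xs" "\<And>j. i < j \<Longrightarrow> j < length xs \<Longrightarrow> xs ! i < xs ! j"
        by (auto simp: rmin_values_def)
      then have "i = length xs - 1 \<or> xs ! i < xs ! (length xs - 1)"
        using False by (metis Suc_pred diff_less length_greater_0_conv less_antisym zero_less_one One_nat_def)
      then have "\<not> last xs < x"
        using False i(1) by (auto simp: last_conv_nth)
      then show ?thesis
        using True IH by (auto simp: asc_snoc rmin_values_snoc)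
    next
      case x_new: False
      then have x_eq: "x = Suc (asc xs)"
        using x(1) False by simp
      have "set (xs @ [x]) = insert x {..<x}"
        by (simp add: IH x_eq)
      also have "\<dots> = {..<Suc x}"
        by auto
      finally have "set (xs @ [x]) = {..<Suc x}" .
      moreover have "asc (xs @ [x]) = x"
        using last False by (simp add: asc_snoc x_eq)
      moreover have "0 \<in> rmin_values (xs @ [x])"
        using IH(2) by (simp add: rmin_values_snoc x_eq)
      ultimately show ?thesis
        by simp
    qed
  qed
qed

text \<open>The largest entry that the ascent condition admits. The values used so far are exactly
  the smaller ones, so it is also the only new value.\<close>

definition next_value :: "nat list \<Rightarrow> nat" where
  "next_value xs = (if xs = [] then 0 else Suc (asc xs))"

lemma rmin_values_less:
  assumes "xs \<in> ascent_seqs_101 n" "v \<in> rmin_values xs"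
  shows "v < next_value xs"
proof -
  have "v \<in> set xs"
    using assms rmin_values_subset by blast
  then show ?thesis
    using ascent_seqs_101_values[OF assms(1)] by (auto simp: next_value_def)
qed

lemma ascent_seqs_101_snoc:
  assumes "xs \<in> ascent_seqs_101 n"
  shows "xs @ [x] \<in> ascent_seqs_101 (Suc n) \<longleftrightarrow> x \<in> insert (next_value xs) (rmin_values xs)"
proof -
  have set: "y \<in> set xs \<longleftrightarrow> y < next_value xs" for y
    using ascent_seqs_101_values[OF assms] by (auto simp: next_value_def)
  have "xs \<in> ascent_seqs n" "\<not> has_101 xs"
    using assms by (simp_all add: ascent_seqs_101_alt)
  then have "xs @ [x] \<in> ascent_seqs_101 (Suc n) \<longleftrightarrow> x \<le> next_value xs \<and> x \<notin> set xs - rmin_values xs"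
    unfolding ascent_seqs_101_alt next_value_def by (simp add: ascent_seqs_snoc has_101_snoc)
  also have "\<dots> \<longleftrightarrow> x \<in> insert (next_value xs) (rmin_values xs)"
    unfolding Diff_iff set using rmin_values_less[OF assms, of x] by auto
  finally show ?thesis .
qed

lemma ascent_seqs_101_butlast:
  assumes "xs \<in> ascent_seqs_101 (Suc n)"
  shows "butlast xs \<in> ascent_seqs_101 n" "xs = butlast xs @ [last xs]"
proof -
  have "xs \<noteq> []"
    using assms by (auto simp: ascent_seqs_101_def ascent_seqs_def)
  then show *: "xs = butlast xs @ [last xs]"
    by simp
  have "butlast xs @ [last xs] \<in> ascent_seqs_101 (Suc n)"
    using assms * by simp
  then show "butlast xs \<in> ascent_seqs_101 n"
    unfolding ascent_seqs_101_alt by (auto simp: ascent_seqs_snoc has_101_snoc simp del: append_butlast_last_id)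
qed

text \<open>There are rmin + 1 admissible entries, and after appending one of them the right-to-left
  minima are exactly the admissible values up to it: its rank is the label of the child. Rank 1
  belongs to the value 0, the only one that adds a zero.\<close>

lemma generating_tree_ascent_seqs:
  "generating_tree ascent_seqs_101 zero_count rmin butlast []"
proof unfold_locales
  fix n xs assume xs: "xs \<in> ascent_seqs_101 n"
  define A where "A = insert (next_value xs) (rmin_values xs)"
  note lt = rmin_values_less[OF xs]
  have "next_value xs \<notin> rmin_values xs"
    using lt by blast
  then have A: "card A = Suc (rmin xs)" "finite A"
    by (simp_all add: A_def rmin_eq_card)
  have rmin: "rmin (xs @ [x]) = Suc (card {v \<in> A. v < x})" if "x \<in> A" for x
  proof -
    have "\<not> next_value xs < x"
      using that lt[of x] by (auto simp: A_def)
    then have "{v \<in> rmin_values xs. v < x} = {v \<in> A. v < x}"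
      by (auto simp: A_def)
    then show ?thesis
      by (simp add: rmin_eq_card rmin_values_snoc)
  qed
  have W: "{w \<in> ascent_seqs_101 (Suc n). butlast w = xs} = (\<lambda>x. xs @ [x]) ` A"
  proof (intro equalityI subsetI)
    fix w assume w: "w \<in> {w \<in> ascent_seqs_101 (Suc n). butlast w = xs}"
    then have eq: "w = xs @ [last w]"
      using ascent_seqs_101_butlast(2)[of w n] by simp
    then have "xs @ [last w] \<in> ascent_seqs_101 (Suc n)"
      using w by simp
    then show "w \<in> (\<lambda>x. xs @ [x]) ` A"
      unfolding ascent_seqs_101_snoc[OF xs] A_def by (subst eq) blast
  next
    fix w assume "w \<in> (\<lambda>x. xs @ [x]) ` A"
    then show "w \<in> {w \<in> ascent_seqs_101 (Suc n). butlast w = xs}"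
      using ascent_seqs_101_snoc[OF xs] by (auto simp: A_def)
  qed
  have "bij_betw (\<lambda>x. rmin (xs @ [x])) A {1..Suc (rmin xs)}"
    using bij_betw_rank[OF A(2)] by (subst bij_betw_cong[OF rmin]) (simp_all add: A)
  then show "bij_betw rmin {w \<in> ascent_seqs_101 (Suc n). butlast w = xs} {1..Suc (rmin xs)}"
    unfolding W bij_betw_def by (simp add: image_image inj_on_def)
next
  fix n w assume w: "w \<in> ascent_seqs_101 (Suc n)"
  obtain xs x where wx: "w = xs @ [x]" and xs: "xs \<in> ascent_seqs_101 n"
    using ascent_seqs_101_butlast[OF w] by blast
  have x: "x \<in> insert (next_value xs) (rmin_values xs)"
    using w xs wx ascent_seqs_101_snoc by blast
  have "rmin w = Suc (card {v \<in> rmin_values xs. v < x})"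
    by (simp add: wx rmin_eq_card rmin_values_snoc)
  moreover have "{v \<in> rmin_values xs. v < x} = {} \<longleftrightarrow> x = 0"
    using ascent_seqs_101_values[OF xs] x by (cases "xs = []") (auto simp: next_value_def)
  ultimately show "zero_count w = (if rmin w = 1 then Suc (zero_count (butlast w)) else zero_count (butlast w))"
    by (auto simp: wx zero_count_def)
qed (auto simp: ascent_seqs_101_butlast, auto simp: ascent_seqs_101_def ascent_seqs_def zero_count_def rmin_def)

section \<open>Fishburn permutations avoiding 3142\<close>

definition has_3142 :: "nat list \<Rightarrow> bool" where
  "has_3142 p \<longleftrightarrow> (\<exists>a b c d. subseq [a, b, c, d] p \<and> b < d \<and> d < a \<and> a < c)"

lemma perm_contains_3142: "perm_contains p [3, 1, 4, 2] \<longleftrightarrow> has_3142 p"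
proof
  assume "perm_contains p [3, 1, 4, 2]"
  then obtain q where q: "subseq q p" "length q = 4"
    "\<And>i j. i < 4 \<Longrightarrow> j < 4 \<Longrightarrow> q ! i < q ! j \<longleftrightarrow> [3, 1, 4, 2::nat] ! i < [3, 1, 4, 2] ! j"
    by (auto simp: perm_contains_def)
  obtain a b c d where abcd: "q = [a, b, c, d]"
    using q(2) by (auto simp: length_Suc_conv numeral_eq_Suc)
  then have "b < d" "d < a" "a < c"
    using q(3)[of 1 3] q(3)[of 3 0] q(3)[of 0 2] by simp_all
  then show "has_3142 p"
    using q(1) abcd by (auto simp: has_3142_def)
next
  assume "has_3142 p"
  then obtain a b c d where "subseq [a, b, c, d] p" "b < d" "d < a" "a < c"
    by (auto simp: has_3142_def)
  then show "perm_contains p [3, 1, 4, 2]"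
    unfolding perm_contains_def
    by (intro exI[of _ "[a, b, c, d]"]) (auto simp: less_Suc_eq numeral_eq_Suc)
qed

text \<open>A decomposition of the list instead of indices, so that inserting or deleting the
  maximum becomes a case distinction on the part into which it falls. The guard \<open>0 < a\<close>
  makes the truncated \<open>a - 1\<close> the true predecessor.\<close>

definition has_fishburn :: "nat list \<Rightarrow> bool" where
  "has_fishburn p \<longleftrightarrow> (\<exists>u a b v. p = u @ a # b # v \<and> a < b \<and> 0 < a \<and> a - 1 \<in> set v)"

lemma fishburn_perms_alt: "fishburn_perms n = {p \<in> permutations_of_set {1..n}. \<not> has_fishburn p}"
proof -
  have "(\<exists>i j. i + 1 < j \<and> j < n \<and> p ! j + 1 = p ! i \<and> p ! i < p ! (i + 1)) \<longleftrightarrow> has_fishburn p"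
    if "length p = n" for p :: "nat list"
  proof
    assume "\<exists>i j. i + 1 < j \<and> j < n \<and> p ! j + 1 = p ! i \<and> p ! i < p ! (i + 1)"
    then obtain i j where ij: "i + 1 < j" "j < n" "p ! j + 1 = p ! i" "p ! i < p ! (i + 1)"
      by blast
    have "drop (Suc (Suc i)) p ! (j - Suc (Suc i)) = p ! (Suc (Suc i) + (j - Suc (Suc i)))"
      using ij that by (intro nth_drop) simp
    moreover have "Suc (Suc i) + (j - Suc (Suc i)) = j"
      using ij by simp
    ultimately have nth: "drop (Suc (Suc i)) p ! (j - Suc (Suc i)) = p ! j"
      by (simp only:)
    have "p = take i p @ p ! i # p ! Suc i # drop (Suc (Suc i)) p"
      using ij that by (metis Cons_nth_drop_Suc Suc_eq_plus1 Suc_lessD append_take_drop_id less_trans)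
    moreover have "p ! i - 1 = drop (Suc (Suc i)) p ! (j - Suc (Suc i))" "j - Suc (Suc i) < length (drop (Suc (Suc i)) p)"
      using ij that by (simp_all only: nth) auto
    then have "p ! i - 1 \<in> set (drop (Suc (Suc i)) p)"
      by (metis nth_mem)
    ultimately show "has_fishburn p"
      unfolding has_fishburn_def using ij(3,4) by (metis Suc_eq_plus1 zero_less_Suc)
  next
    assume "has_fishburn p"
    then obtain u a b v where p: "p = u @ a # b # v" "a < b" "0 < a" "a - 1 \<in> set v"
      by (auto simp: has_fishburn_def)
    then obtain k where "k < length v" "v ! k = a - 1"
      by (auto simp: in_set_conv_nth)
    then show "\<exists>i j. i + 1 < j \<and> j < n \<and> p ! j + 1 = p ! i \<and> p ! i < p ! (i + 1)"
      using p that by (intro exI[of _ "length u"] exI[of _ "length u + 2 + k"]) (auto simp: nth_append)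
  qed
  moreover have "length p = n" if "p \<in> permutations_of_set {1..n}" for p :: "nat list"
    using length_finite_permutations_of_set[OF that] by simp
  ultimately show ?thesis
    unfolding fishburn_perms_def by blast
qed

lemma fishburn_perms_3142_iff:
  "p \<in> fishburn_perms_3142 n \<longleftrightarrow> set p = {1..n} \<and> distinct p \<and> \<not> has_fishburn p \<and> \<not> has_3142 p"
  unfolding fishburn_perms_3142_def fishburn_perms_alt perm_contains_3142 permutations_of_set_def by auto

text \<open>The prefixes after which the maximum \<open>n + 1\<close> may be inserted.\<close>

definition full_prefix :: "nat list \<Rightarrow> bool" where
  "full_prefix u \<longleftrightarrow> set u = {1..length u}"

lemma full_prefix_Nil [simp]: "full_prefix []"
  by (simp add: full_prefix_def)

lemma set_subseq: "subseq xs ys \<Longrightarrow> set xs \<subseteq> set ys"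
  by (auto elim: list_emb_set)

lemma subseq_Cons_appendI: "subseq xs v \<Longrightarrow> subseq (x # xs) (u @ x # v)"
  by (rule list_emb_append2) simp

text \<open>Let M be the maximum of u and c the largest value below M missing from u. Then c + 1
  occurs in u and c after m. If the entry following c + 1 is larger, these two and c form the
  Fishburn pattern; if it is some smaller b, then c + 1, b, m, c is a 3142. The lemma is used for an
  inserted maximum m and also for an old left-to-right maximum m, in front of which a larger maximum
  is to be inserted.\<close>

lemma full_prefix_if_ascent:
  assumes "distinct (u @ m # v)" "set (u @ m # v) = {1..n}" "\<not> has_fishburn (u @ m # v)" "\<not> has_3142 (u @ m # v)"
    and "\<And>x. x \<in> set u \<Longrightarrow> x < m"
  shows "full_prefix u"
proof (rule ccontr)
  assume nf: "\<not> full_prefix u"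
  then have ne: "u \<noteq> []"
    by auto
  define M where "M = Max (set u)"
  have M: "M \<in> set u" "\<And>x. x \<in> set u \<Longrightarrow> x \<le> M"
    using ne by (simp_all add: M_def)
  have u_pos: "set u \<subseteq> {1..M}"
    using M(2) assms(2) by auto
  have "{1..M} - set u \<noteq> {}"
  proof
    assume "{1..M} - set u = {}"
    then have "set u = {1..M}"
      using u_pos by blast
    moreover from this have "length u = M"
      using distinct_card[of u] assms(1) by simp
    ultimately show False
      using nf by (simp add: full_prefix_def)
  qed
  define c where "c = Max ({1..M} - set u)"
  have c: "c \<in> {1..M} - set u"
    unfolding c_def by (rule Max_in) (use \<open>{1..M} - set u \<noteq> {}\<close> in auto)
  have c_max: "x \<in> set u" if "c < x" "x \<le> M" for x
    using that Max_ge[of "{1..M} - set u" x] c unfolding c_def[symmetric] by (metis Diff_iff atLeastAtMost_iff finite_Diff finite_atLeastAtMost le_trans less_imp_le not_le)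
  have "c < M"
    using c M(1) by (metis DiffE atLeastAtMost_iff le_neq_implies_less)
  then have "Suc c \<in> set u"
    using c_max by simp
  then obtain u1 u2 where u: "u = u1 @ Suc c # u2"
    by (auto simp: in_set_conv_decomp)
  have "M < m"
    using M assms(5) by blast
  then have "c \<in> set v"
  proof -
    have "M \<in> {1..n}"
      using assms(2) M(1) by (metis UnI1 set_append)
    then have "c \<in> set (u @ m # v)"
      using assms(2) c by auto
    then show ?thesis
      using c \<open>c < M\<close> \<open>M < m\<close> by auto
  qed
  show False
  proof (cases u2)
    case Nil
    then have "u @ m # v = u1 @ Suc c # m # v"
      using u by simp
    then have "has_fishburn (u @ m # v)"
      unfolding has_fishburn_def using \<open>c \<in> set v\<close> \<open>c < M\<close> \<open>M < m\<close>
      by (intro exI[of _ u1] exI[of _ "Suc c"] exI[of _ m] exI[of _ v]) auto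
    then show False
      using assms(3) by simp
  next
    case (Cons b u3)
    then have dec: "u @ m # v = u1 @ Suc c # b # (u3 @ m # v)"
      using u by simp
    have "\<not> Suc c < b"
      using assms(3) dec \<open>c \<in> set v\<close> unfolding has_fishburn_def by (metis Suc_eq_plus1 UnCI add_diff_cancel_right' in_set_conv_decomp set_append zero_less_Suc list.set_intros(2))
    moreover have "b \<noteq> Suc c" "b \<noteq> c"
      using assms(1) dec \<open>c \<in> set v\<close> by auto
    ultimately have "b < c"
      by simp
    moreover have "subseq [Suc c, b, m, c] (u @ m # v)"
    proof -
      obtain v1 v2 where "v = v1 @ c # v2"
        using \<open>c \<in> set v\<close> by (auto simp: in_set_conv_decomp)
      then have "subseq [m, c] (u3 @ m # v)"
        by (intro subseq_Cons_appendI) (simp add: subseq_singleton_left)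
      then show ?thesis
        unfolding dec by (intro subseq_Cons_appendI) simp
    qed
    moreover have "c < Suc c" "Suc c < m"
      using \<open>M < m\<close> \<open>c < M\<close> by auto
    ultimately have "has_3142 (u @ m # v)"
      unfolding has_3142_def by blast
    then show False
      using assms(4) by simp
  qed
qed

lemma full_prefix_mem:
  "full_prefix u \<Longrightarrow> a \<in> set u \<Longrightarrow> 1 \<le> d \<Longrightarrow> d \<le> a \<Longrightarrow> d \<in> set u"
  by (auto simp: full_prefix_def)

lemma has_3142_remove:
  assumes "has_3142 (u @ v)"
  shows "has_3142 (u @ m # v)"
proof -
  have "subseq (u @ v) (u @ m # v)"
    by (simp add: subseq_append' list_emb_Cons)
  then show ?thesis
    using assms unfolding has_3142_def by (meson subseq_order.trans)
qed

text \<open>The new maximum could only play the 4. Then the 3 lies in the prefix u and the 2 behind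
  it, but a full prefix contains with the 3 every smaller positive value.\<close>

lemma has_3142_insert_max:
  assumes "distinct (u @ m # v)" "\<And>x. x \<in> set (u @ v) \<Longrightarrow> 0 < x \<and> x < m" "full_prefix u"
  shows "has_3142 (u @ m # v) \<longleftrightarrow> has_3142 (u @ v)"
proof
  assume "has_3142 (u @ v)"
  then show "has_3142 (u @ m # v)"
    by (rule has_3142_remove)
next
  assume "has_3142 (u @ m # v)"
  then obtain a b c d where s: "subseq [a, b, c, d] (u @ m # v)" and lt: "b < d" "d < a" "a < c"
    by (auto simp: has_3142_def)
  have in_set: "x \<in> set (u @ m # v)" if "x \<in> {a, b, c, d}" for x
    using set_subseq[OF s] that by auto
  have le: "x \<le> m" if "x \<in> {a, b, c, d}" for x
    using in_set[OF that] assms(2)[of x] by auto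
  have "c \<noteq> m"
  proof
    assume "c = m"
    then obtain us vs where "u @ m # v = us @ vs" "subseq [a, b] us" "subseq [m, d] vs"
      using s list_emb_appendD[of "(=)" "[a, b]" "[c, d]" "u @ m # v"] by auto
    moreover from this obtain p q where "vs = p @ m # q" "subseq [d] q"
      using list_emb_ConsD[of "(=)" m "[d]" vs] by blast
    ultimately have "(us @ p) @ m # q = u @ m # v"
      by simp
    moreover have "m \<notin> set u" "m \<notin> set v"
      using assms(1) by auto
    ultimately have "us @ p = u" "q = v"
      using append_Cons_eq_iff[of m u v "us @ p" q] by metis+
    then have "a \<in> set u" "d \<in> set v"
      using \<open>subseq [a, b] us\<close> \<open>subseq [d] q\<close> by (auto dest: set_subseq simp: subseq_singleton_left)
    then have "d \<in> set u"
      using full_prefix_mem[OF assms(3)] assms(2)[of d] lt by force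
    then show False
      using assms(1) \<open>d \<in> set v\<close> by auto
  qed
  then have "a \<noteq> m" "b \<noteq> m" "c \<noteq> m" "d \<noteq> m"
    using lt le[of c] by auto
  then have "filter (\<lambda>x. x \<noteq> m) [a, b, c, d] = [a, b, c, d]"
    by simp
  moreover have "filter (\<lambda>x. x \<noteq> m) u = u" "filter (\<lambda>x. x \<noteq> m) v = v"
    using assms(1) by (auto intro!: filter_True)
  then have "filter (\<lambda>x. x \<noteq> m) (u @ m # v) = u @ v"
    by simp
  ultimately have "subseq [a, b, c, d] (u @ v)"
    using subseq_filter[OF s, of "\<lambda>x. x \<noteq> m"] by simp
  then show "has_3142 (u @ v)"
    using lt by (auto simp: has_3142_def)
qed

text \<open>An occurrence survives the insertion: if m separates a from b, it takes the place of
  b.\<close>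

lemma has_fishburn_remove:
  assumes "has_fishburn (u @ v)" "\<And>x. x \<in> set (u @ v) \<Longrightarrow> x < m"
  shows "has_fishburn (u @ m # v)"
proof -
  obtain u' a b v' where d: "u @ v = u' @ a # b # v'" and ab: "a < b" "0 < a" "a - 1 \<in> set v'"
    using assms(1) by (auto simp: has_fishburn_def)
  then consider k where "u' = u @ k" "v = k @ a # b # v'" | "u = u' @ [a]" "v = b # v'"
    | k where "u = u' @ a # b # k" "v' = k @ v"
    by (auto simp: append_eq_append_conv2 append_eq_Cons_conv Cons_eq_append_conv)
  then show ?thesis
  proof cases
    case 1
    then have "u @ m # v = (u @ m # k) @ a # b # v'"
      by simp
    then show ?thesis
      using ab unfolding has_fishburn_def by blast
  next
    case 2
    then have "u @ m # v = u' @ a # m # b # v'"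
      by simp
    moreover have "a < m"
      using 2 assms(2) by simp
    ultimately show ?thesis
      using ab unfolding has_fishburn_def by (metis list.set_intros(2))
  next
    case 3
    then have "u @ m # v = u' @ a # b # (k @ m # v)"
      by simp
    moreover have "a - 1 \<in> set (k @ m # v)"
      using 3 ab by auto
    ultimately show ?thesis
      using ab unfolding has_fishburn_def by blast
  qed
qed

text \<open>In an occurrence that uses the maximum, m is the b. Then a is the last entry of the full
  prefix u, which therefore contains a - 1 as well, so that a - 1 cannot occur behind m.\<close>

lemma has_fishburn_insert_max:
  assumes "distinct (u @ m # v)" "\<And>x. x \<in> set (u @ v) \<Longrightarrow> 0 < x \<and> x < m" "full_prefix u"
    and "has_fishburn (u @ m # v)"
  shows "has_fishburn (u @ v)"
proof -
  obtain u' a b v' where d: "u @ m # v = u' @ a # b # v'" and ab: "a < b" "0 < a" "a - 1 \<in> set v'"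
    using assms(4) by (auto simp: has_fishburn_def)
  have m: "m \<notin> set u" "m \<notin> set v"
    using assms(1) by auto
  have "set (u' @ a # b # v') \<subseteq> {..m}"
    unfolding d[symmetric] using assms(2) by (auto simp: less_imp_le)
  then have le: "a \<le> m" "b \<le> m"
    by auto
  have "m \<in> set (u' @ a # b # v')"
    unfolding d[symmetric] by simp
  then consider "m \<in> set u'" | "m = b" | "m \<in> set v'"
    using ab le by auto
  then show ?thesis
  proof cases
    case 1
    then obtain p q where "u' = p @ m # q"
      by (auto simp: in_set_conv_decomp)
    then have "u @ m # v = p @ m # (q @ a # b # v')"
      using d by simp
    then have "u = p" "v = q @ a # b # v'"
      using append_Cons_eq_iff[OF m] by blast+
    then have "u @ v = (u @ q) @ a # b # v'"
      by simp
    then show ?thesis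
      using ab unfolding has_fishburn_def by blast
  next
    case 2
    then have "u @ m # v = (u' @ [a]) @ m # v'"
      using d by simp
    then have uv: "u = u' @ [a]" "v = v'"
      using append_Cons_eq_iff[OF m] by blast+
    have "0 < a - 1"
      using assms(2)[of "a - 1"] uv ab by simp
    then have "a - 1 \<in> set u"
      using full_prefix_mem[OF assms(3), of a "a - 1"] uv by simp
    then show ?thesis
      using assms(1) ab uv by auto
  next
    case 3
    then obtain p q where v': "v' = p @ m # q"
      by (auto simp: in_set_conv_decomp)
    then have "u @ m # v = (u' @ a # b # p) @ m # q"
      using d by simp
    then have "u = u' @ a # b # p" "v = q"
      using append_Cons_eq_iff[OF m] by blast+
    then have "u @ v = u' @ a # b # (p @ q)"
      by simp
    moreover have "a - 1 \<in> set (p @ q)"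
      using ab v' le by auto
    ultimately show ?thesis
      using ab unfolding has_fishburn_def by blast
  qed
qed

section \<open>Left-to-right maxima and initial descending runs\<close>

lemma lmax_snoc: "lmax (p @ [x]) = lmax p + (if \<forall>y\<in>set p. y < x then 1 else 0)"
proof -
  have "{i. i < length (p @ [x]) \<and> (\<forall>j<i. (p @ [x]) ! i > (p @ [x]) ! j)}
      = {i. i < length p \<and> (\<forall>j<i. p ! i > p ! j)} \<union> (if \<forall>y\<in>set p. y < x then {length p} else {})"
    by (auto simp: nth_append less_Suc_eq all_set_conv_all_nth)
  then show ?thesis
    by (simp add: lmax_def)
qed

lemma lmax_Nil [simp]: "lmax [] = 0"
  by (simp add: lmax_def)

lemma lmax_append_ge: "lmax u \<le> lmax (u @ v)"
  by (induction v rule: rev_induct) (auto simp: lmax_snoc simp flip: append_assoc)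

lemma lmax_insert_max:
  "(\<And>x. x \<in> set (u @ v) \<Longrightarrow> x < m) \<Longrightarrow> lmax (u @ m # v) = Suc (lmax u)"
proof (induction v rule: rev_induct)
  case Nil
  then show ?case by (simp add: lmax_snoc)
next
  case (snoc x v)
  have "lmax ((u @ m # v) @ [x]) = lmax (u @ m # v)"
    using snoc.prems[of x] by (subst lmax_snoc) auto
  then show ?case
    using snoc by simp
qed

text \<open>Finds the place of the child with label k + 1: the longest prefix with k left-to-right
  maxima, which ends where the next such maximum stands or at the end of the list.\<close>

lemma prefix_with_lmax_ex:
  "k \<le> lmax p \<Longrightarrow> \<exists>u v. p = u @ v \<and> lmax u = k \<and> (v = [] \<or> (\<forall>y\<in>set u. y < hd v))"
proof (induction p rule: rev_induct)
  case Nil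
  then show ?case by simp
next
  case (snoc x p)
  show ?case
  proof (cases "k \<le> lmax p")
    case False
    then have "k = lmax (p @ [x])"
      using snoc.prems by (simp add: lmax_snoc split: if_splits)
    then show ?thesis
      by blast
  next
    case True
    then obtain u v where uv: "p = u @ v" "lmax u = k" "v = [] \<or> (\<forall>y\<in>set u. y < hd v)"
      using snoc.IH by blast
    show ?thesis
    proof (cases "v = [] \<and> \<not> (\<forall>y\<in>set p. y < x)")
      case True
      then show ?thesis
        using uv by (intro exI[of _ "p @ [x]", OF exI[of _ "[]"]]) (auto simp: lmax_snoc)
    next
      case False
      then show ?thesis
        using uv by (intro exI[of _ u, OF exI[of _ "v @ [x]"]]) (cases v; auto)
    qed
  qed
qed

lemma idr_Nil [simp]: "idr [] = 0"
  by (simp add: idr_def)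

lemma idr_Cons: "idr (x # p) = (if p = [] \<or> hd p < x then Suc (idr p) else 1)"
proof -
  let ?J = "\<lambda>p::nat list. {j. j \<le> length p \<and> sorted_wrt (>) (take j p)}"
  have fin: "finite (?J p)" for p
    by (rule finite_subset[of _ "{..length p}"]) auto
  have J: "?J (x # p) = insert 0 (Suc ` {j \<in> ?J p. \<forall>y\<in>set (take j p). y < x})"
  proof (intro equalityI subsetI)
    fix j assume "j \<in> ?J (x # p)"
    then show "j \<in> insert 0 (Suc ` {j \<in> ?J p. \<forall>y\<in>set (take j p). y < x})"
      by (cases j) auto
  qed auto
  show ?thesis
  proof (cases "p = [] \<or> hd p < x")
    case True
    have "\<forall>y\<in>set (take j p). y < x" if "sorted_wrt (>) (take j p)" for j
      using True that by (cases p; cases j) (auto dest: order.strict_trans)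
    then have "?J (x # p) = insert 0 (Suc ` ?J p)"
      unfolding J by auto
    moreover have "?J p \<noteq> {}"
      by (auto intro!: exI[of _ 0])
    ultimately have "idr (x # p) = Max (Suc ` ?J p)"
      unfolding idr_def using fin by simp
    also have "\<dots> = Suc (idr p)"
      unfolding idr_def using \<open>?J p \<noteq> {}\<close> fin by (intro mono_Max_commute[symmetric] monoI) auto
    finally show ?thesis
      using True by simp
  next
    case False
    then have "{j \<in> ?J p. \<forall>y\<in>set (take j p). y < x} = {0}"
      by (cases p) (auto simp: take_Cons' split: if_splits)
    then show ?thesis
      using False J by (simp add: idr_def)
  qed
qed

lemma idr_append: "u \<noteq> [] \<Longrightarrow> v = [] \<or> last u \<le> hd v \<Longrightarrow> idr (u @ v) = idr u"
proof (induction u)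
  case (Cons x u)
  then show ?case
    by (cases "u = []"; cases v) (auto simp: idr_Cons hd_append)
qed simp

text \<open>The maximum of a permutation of \<open>{1..n}\<close> is its length, so the parent
  deletes the maximum. The entry after a full prefix exceeds all of that prefix, hence a longer full
  prefix has more left-to-right maxima, and this number plus one labels the child. Label 1 is
  insertion at the front, the only one that lengthens the initial descending run.\<close>

lemma generating_tree_fishburn:
  "generating_tree fishburn_perms_3142 idr lmax (\<lambda>w. remove1 (length w) w) []"
proof unfold_locales
  let ?p = "\<lambda>w. remove1 (length w) w :: nat list"
  have insertion: "u @ v \<in> fishburn_perms_3142 n \<and> full_prefix u \<longleftrightarrow> u @ Suc n # v \<in> fishburn_perms_3142 (Suc n)"
    for u v n
  proof
    assume a: "u @ v \<in> fishburn_perms_3142 n \<and> full_prefix u"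
    then have b: "set (u @ v) = {1..n}" "distinct (u @ v)" "\<not> has_fishburn (u @ v)" "\<not> has_3142 (u @ v)"
      by (auto simp: fishburn_perms_3142_iff)
    then have c: "0 < x \<and> x < Suc n" if "x \<in> set (u @ v)" for x
      using that by simp
    then have d: "distinct (u @ Suc n # v)"
      using b(2) by auto
    show "u @ Suc n # v \<in> fishburn_perms_3142 (Suc n)"
      unfolding fishburn_perms_3142_iff
      using b a d has_3142_insert_max[OF d c] has_fishburn_insert_max[OF d c] by (auto simp: atLeastAtMostSuc_conv)
  next
    assume a: "u @ Suc n # v \<in> fishburn_perms_3142 (Suc n)"
    then have b: "set (u @ Suc n # v) = {1..Suc n}" "distinct (u @ Suc n # v)"
        "\<not> has_fishburn (u @ Suc n # v)" "\<not> has_3142 (u @ Suc n # v)"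
      by (auto simp: fishburn_perms_3142_iff)
    have "set (u @ v) = set (u @ Suc n # v) - {Suc n}"
      using b(2) by auto
    also have "\<dots> = {1..Suc n} - {Suc n}"
      by (simp only: b(1))
    also have "\<dots> = {1..n}"
      by auto
    finally have s: "set (u @ v) = {1..n}" .
    then have c: "x < Suc n" if "x \<in> set (u @ v)" for x
      using that by simp
    then have "full_prefix u"
      using full_prefix_if_ascent[OF b(2,1,3,4)] by simp
    moreover have "\<not> has_fishburn (u @ v)" "\<not> has_3142 (u @ v)"
      using has_fishburn_remove[OF _ c] has_3142_remove b by blast+
    ultimately show "u @ v \<in> fishburn_perms_3142 n \<and> full_prefix u"
      unfolding fishburn_perms_3142_iff using s b(2) by simp
  qed
  have decomp: "\<exists>u v. w = u @ Suc n # v \<and> ?p w = u @ v \<and> u @ v \<in> fishburn_perms_3142 n \<and> full_prefix u"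
    if w: "w \<in> fishburn_perms_3142 (Suc n)" for w n
  proof -
    have "Suc n \<in> set w" "distinct w" "length w = Suc n"
      using w distinct_card[of w] by (auto simp: fishburn_perms_3142_iff)
    moreover from this obtain u v where "w = u @ Suc n # v"
      by (auto simp: in_set_conv_decomp)
    ultimately have "?p w = u @ v"
      by (simp add: remove1_append)
    then show ?thesis
      using insertion[of u v n] w \<open>w = u @ Suc n # v\<close> by blast
  qed
  have elems: "y < Suc n \<and> 0 < y" if "p \<in> fishburn_perms_3142 n" "y \<in> set p" for p y n
    using that by (auto simp: fishburn_perms_3142_iff)
  {
    fix n x assume x: "x \<in> fishburn_perms_3142 n"
    let ?W = "{w \<in> fishburn_perms_3142 (Suc n). ?p w = x}"
    have W: "w \<in> ?W \<longleftrightarrow> (\<exists>u v. w = u @ Suc n # v \<and> x = u @ v \<and> full_prefix u)" for w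
    proof
      assume "w \<in> ?W"
      then show "\<exists>u v. w = u @ Suc n # v \<and> x = u @ v \<and> full_prefix u"
        using decomp[of w n] by auto
    next
      assume "\<exists>u v. w = u @ Suc n # v \<and> x = u @ v \<and> full_prefix u"
      then obtain u v where "w = u @ Suc n # v" "x = u @ v" "full_prefix u"
        by blast
      moreover have "length x = n" "Suc n \<notin> set x"
        using x distinct_card[of x] by (auto simp: fishburn_perms_3142_iff)
      ultimately show "w \<in> ?W"
        using insertion[of u v n] x by (auto simp: remove1_append)
    qed
    have lmax: "lmax (u @ Suc n # v) = Suc (lmax u)" if "x = u @ v" for u v
      using lmax_insert_max[of u v "Suc n"] elems[OF x] that by simp
    have "lmax u < lmax u'" if "x = u @ v" "x = u' @ v'" "full_prefix u" "length u < length u'" for u v u' v'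
    proof -
      have "prefix u u'"
        using that by (metis less_imp_le prefixI prefix_length_prefix)
      moreover have "u \<noteq> u'"
        using that by auto
      ultimately obtain c w where u': "u' = u @ c # w"
        by (metis append_Nil2 list.exhaust prefixE)
      have "c \<notin> set u" "0 < c"
        using x that u' by (auto simp: fishburn_perms_3142_iff)
      then have "y < c" if "y \<in> set u" for y
        using full_prefix_mem[OF \<open>full_prefix u\<close> that, of c] by (metis One_nat_def Suc_leI not_le)
      then have "lmax (u @ [c]) = Suc (lmax u)"
        by (simp add: lmax_snoc)
      then show ?thesis
        using lmax_append_ge[of "u @ [c]" w] u' by simp
    qed
    note lmax_less = this
    have "inj_on lmax ?W"
    proof (rule inj_onI)
      fix w w' assume "w \<in> ?W" "w' \<in> ?W" and eq: "lmax w = lmax w'"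
      then obtain u v u' v' where uv: "w = u @ Suc n # v" "x = u @ v" "full_prefix u"
          and uv': "w' = u' @ Suc n # v'" "x = u' @ v'" "full_prefix u'"
        unfolding W by blast
      have "lmax u = lmax u'"
        using eq lmax[OF uv(2)] lmax[OF uv'(2)] uv(1) uv'(1) by simp
      then have "length u = length u'"
        using lmax_less[OF uv(2) uv'(2) uv(3)] lmax_less[OF uv'(2) uv(2) uv'(3)]
        by (cases "length u" "length u'" rule: linorder_cases) simp_all
      then show "w = w'"
        using uv uv' by simp
    qed
    moreover have "lmax w \<in> {1..Suc (lmax x)}" if "w \<in> ?W" for w
      using that unfolding W using lmax lmax_append_ge by auto
    moreover have "k \<in> lmax ` ?W" if k: "k \<in> {1..Suc (lmax x)}" for k
    proof -
      obtain u v where uv: "x = u @ v" "lmax u = k - 1" "v = [] \<or> (\<forall>y\<in>set u. y < hd v)"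
        using prefix_with_lmax_ex[of "k - 1" x] k by (metis atLeastAtMost_iff le_diff_conv Suc_eq_plus1)
      have "full_prefix u"
      proof (cases v)
        case Nil
        then show ?thesis
          using x uv distinct_card[of x] by (simp add: full_prefix_def fishburn_perms_3142_iff)
      next
        case (Cons m v')
        then show ?thesis
          using full_prefix_if_ascent[of u m v' n] x uv by (simp add: fishburn_perms_3142_iff)
      qed
      then have "u @ Suc n # v \<in> ?W"
        using W uv(1) by blast
      moreover have "lmax (u @ Suc n # v) = k"
        using lmax[OF uv(1)] uv(2) k by simp
      ultimately show ?thesis
        by blast
    qed
    ultimately show "bij_betw lmax ?W {1..Suc (lmax x)}"
      unfolding bij_betw_def by blast
  }
  {
    fix n w assume w: "w \<in> fishburn_perms_3142 (Suc n)"
    then obtain u v where uv: "w = u @ Suc n # v" "?p w = u @ v" "u @ v \<in> fishburn_perms_3142 n" "full_prefix u"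
      using decomp by blast
    note el = elems[OF uv(3)]
    have lmax: "lmax w = Suc (lmax u)"
      using lmax_insert_max[of u v "Suc n"] el uv(1) by simp
    show "idr w = (if lmax w = 1 then Suc (idr (?p w)) else idr (?p w))"
    proof (cases "u = []")
      case True
      then show ?thesis
        using uv el lmax by (cases v) (auto simp: idr_Cons)
    next
      case False
      then obtain c u' where "u = [c] @ u'"
        by (cases u) auto
      then have "0 < lmax u"
        using lmax_append_ge[of "[c]" u'] lmax_snoc[of "[]" c] by simp
      moreover have "last u \<in> set u"
        using False by simp
      then have "last u \<le> Suc n"
        using el[of "last u"] by simp
      \<comment> \<open>With the maximum as well as without it, the nonempty full prefix u is
        followed by an entry at least as large as its last one, if by any; so the initial descending
        run ends within u.\<close>
      then have "idr w = idr u"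
        using idr_append[of u "Suc n # v"] uv(1) False by simp
      moreover have "idr (u @ v) = idr u"
      proof (cases v)
        case (Cons c v')
        then have "c \<notin> set u" "0 < c"
          using uv(3) el[of c] Cons by (fastforce simp: fishburn_perms_3142_iff, simp)
        then have "last u \<le> c"
          using full_prefix_mem[OF uv(4) \<open>last u \<in> set u\<close>, of c] by (metis One_nat_def Suc_leI nle_le)
        then show ?thesis
          using idr_append[of u v] False Cons by simp
      qed simp
      ultimately show ?thesis
        using uv lmax by simp
    qed
    show "?p w \<in> fishburn_perms_3142 n"
      using uv by simp
  }
qed (auto simp: fishburn_perms_3142_iff has_fishburn_def has_3142_def)

section \<open>Posets up to isomorphism\<close>

lemma Field_partial_order_on: "partial_order_on A r \<Longrightarrow> Field r = A"
  unfolding partial_order_on_def preorder_on_def refl_on_def Field_def by blast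

lemma Partial_order_if_partial_order_on: "partial_order_on A r \<Longrightarrow> Partial_order r"
  using Field_partial_order_on by metis

lemma Partial_order_iff:
  "Partial_order r \<longleftrightarrow> (\<forall>x\<in>Field r. (x, x) \<in> r) \<and> trans r \<and> antisym r"
  by (auto simp: partial_order_on_def preorder_on_def refl_on_def intro: FieldI1 FieldI2)

text \<open>Isomorphic copies are images of the relation under an injection; this is how copies on
  \<open>{1..n}\<close> and on addresses of tree nodes are produced.\<close>

lemma poset_iso_iff_image:
  "poset_iso r s \<longleftrightarrow> (\<exists>f. inj_on f (Field r) \<and> s = map_prod f f ` r)"
proof
  assume "poset_iso r s"
  then obtain f where f: "bij_betw f (Field r) (Field s)"
    "\<And>x y. x \<in> Field r \<Longrightarrow> y \<in> Field r \<Longrightarrow> (x, y) \<in> r \<longleftrightarrow> (f x, f y) \<in> s"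
    unfolding poset_iso_def by blast
  have sub: "p \<in> map_prod f f ` r" if p: "p \<in> s" for p
  proof -
    obtain u v where "p = (u, v)"
      by (cases p)
    then have uv: "p = (u, v)" "u \<in> Field s" "v \<in> Field s"
      using p by (simp_all add: FieldI1 FieldI2)
    have "Field s = f ` Field r"
      using f(1) by (simp add: bij_betw_def)
    then obtain x y where "x \<in> Field r" "y \<in> Field r" "f x = u" "f y = v"
      using uv(2,3) by (elim equalityE) blast
    then show ?thesis
      using f(2)[of x y] p uv(1) by force
  qed
  have sup: "map_prod f f p \<in> s" if p: "p \<in> r" for p
  proof -
    obtain x y where "p = (x, y)"
      by (cases p)
    then show ?thesis
      using p f(2)[of x y] by (simp add: FieldI1 FieldI2)
  qed
  have "s = map_prod f f ` r"
    by (intro equalityI subsetI image_subsetI sub sup)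
  then show "\<exists>f. inj_on f (Field r) \<and> s = map_prod f f ` r"
    using f(1) by (auto simp: bij_betw_def)
next
  assume "\<exists>f. inj_on f (Field r) \<and> s = map_prod f f ` r"
  then obtain f where f: "inj_on f (Field r)" "s = map_prod f f ` r"
    by blast
  have "Field s = f ` Field r"
    unfolding f(2) Field_def by force
  moreover have "(x, y) \<in> r \<longleftrightarrow> (f x, f y) \<in> s" if "x \<in> Field r" "y \<in> Field r" for x y
  proof
    assume "(f x, f y) \<in> s"
    then obtain a b where ab: "(a, b) \<in> r" "f x = f a" "f y = f b"
      unfolding f(2) by auto
    then have "x = a" "y = b"
      using that f(1) by (auto simp: inj_on_eq_iff FieldI1 FieldI2)
    then show "(x, y) \<in> r"
      using ab by simp
  next
    assume "(x, y) \<in> r"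
    then show "(f x, f y) \<in> s"
      unfolding f(2) by force
  qed
  ultimately show "poset_iso r s"
    using f(1) unfolding poset_iso_def bij_betw_def by blast
qed

lemma poset_isoE:
  assumes "poset_iso r s"
  obtains f where "inj_on f (Field r)" "Field s = f ` Field r"
    "\<And>x y. x \<in> Field r \<Longrightarrow> y \<in> Field r \<Longrightarrow> (f x, f y) \<in> s \<longleftrightarrow> (x, y) \<in> r"
  using assms unfolding poset_iso_def bij_betw_def by metis

lemma poset_isoI:
  assumes "inj_on f (Field r)" "Field s = f ` Field r"
    "\<And>x y. x \<in> Field r \<Longrightarrow> y \<in> Field r \<Longrightarrow> (f x, f y) \<in> s \<longleftrightarrow> (x, y) \<in> r"
  shows "poset_iso r s"
  using assms unfolding poset_iso_def bij_betw_def by metis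

lemma poset_iso_sym:
  assumes "poset_iso r s"
  shows "poset_iso s r"
proof -
  obtain f where f: "bij_betw f (Field r) (Field s)"
    "\<And>x y. x \<in> Field r \<Longrightarrow> y \<in> Field r \<Longrightarrow> (x, y) \<in> r \<longleftrightarrow> (f x, f y) \<in> s"
    using assms unfolding poset_iso_def by blast
  let ?g = "inv_into (Field r) f"
  have "bij_betw ?g (Field s) (Field r)"
    using f(1) by (rule bij_betw_inv_into)
  moreover from this have "(x, y) \<in> s \<longleftrightarrow> (?g x, ?g y) \<in> r" if "x \<in> Field s" "y \<in> Field s" for x y
    using that f(2)[of "?g x" "?g y"] bij_betw_inv_into_right[OF f(1)] by (auto dest: bij_betwE)
  ultimately show ?thesis
    unfolding poset_iso_def by blast
qed

lemma poset_iso_trans: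
  assumes "poset_iso r s" "poset_iso s t"
  shows "poset_iso r t"
proof -
  obtain f where f: "inj_on f (Field r)" "Field s = f ` Field r"
    "\<And>x y. x \<in> Field r \<Longrightarrow> y \<in> Field r \<Longrightarrow> (f x, f y) \<in> s \<longleftrightarrow> (x, y) \<in> r"
    using poset_isoE[OF assms(1)] by blast
  obtain g where g: "inj_on g (Field s)" "Field t = g ` Field s"
    "\<And>x y. x \<in> Field s \<Longrightarrow> y \<in> Field s \<Longrightarrow> (g x, g y) \<in> t \<longleftrightarrow> (x, y) \<in> s"
    using poset_isoE[OF assms(2)] by blast
  show ?thesis
    by (rule poset_isoI[of "g \<circ> f"]) (use f g in \<open>auto intro: comp_inj_on\<close>)
qed

lemma poset_iso_Partial_order:
  assumes "poset_iso r s" "Partial_order r"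
  shows "Partial_order s"
proof -
  obtain f where f: "inj_on f (Field r)" "Field s = f ` Field r"
    "\<And>x y. x \<in> Field r \<Longrightarrow> y \<in> Field r \<Longrightarrow> (f x, f y) \<in> s \<longleftrightarrow> (x, y) \<in> r"
    using poset_isoE[OF assms(1)] by blast
  have pre: "\<exists>a\<in>Field r. x = f a" if "x \<in> Field s" for x
    using that f(2) by blast
  have "trans s"
  proof (rule transI)
    fix x y z assume xyz: "(x, y) \<in> s" "(y, z) \<in> s"
    then obtain a b c where abc: "a \<in> Field r" "b \<in> Field r" "c \<in> Field r" "x = f a" "y = f b" "z = f c"
      using pre by (meson FieldI1 FieldI2)
    then have "(a, b) \<in> r" "(b, c) \<in> r"
      using xyz f(3) by simp_all
    then have "(a, c) \<in> r"
      using assms(2) unfolding Partial_order_iff by (meson transD)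
    then show "(x, z) \<in> s"
      using abc f(3) by simp
  qed
  moreover have "antisym s"
  proof (rule antisymI)
    fix x y assume xy: "(x, y) \<in> s" "(y, x) \<in> s"
    then obtain a b where ab: "a \<in> Field r" "b \<in> Field r" "x = f a" "y = f b"
      using pre by (meson FieldI1 FieldI2)
    then have "(a, b) \<in> r" "(b, a) \<in> r"
      using xy f(3) by simp_all
    then have "a = b"
      using assms(2) unfolding Partial_order_iff antisym_def by blast
    then show "x = y"
      using ab by simp
  qed
  moreover have "\<forall>x\<in>Field s. (x, x) \<in> s"
    unfolding f(2) using f(3) assms(2) by (simp add: Partial_order_iff)
  ultimately show ?thesis
    unfolding Partial_order_iff by simp
qed

lemma poset_iso_card_Field: "poset_iso r s \<Longrightarrow> card (Field r) = card (Field s)"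
  unfolding poset_iso_def using bij_betw_same_card by blast

lemma poset_iso_interval_ex:
  assumes "Partial_order r" "finite (Field r)" "card (Field r) = n"
  shows "\<exists>s. partial_order_on {1..n} s \<and> poset_iso r s"
proof -
  obtain f where f: "bij_betw f (Field r) {1..n}"
    using assms(2,3) finite_same_card_bij[of "Field r" "{1..n}"] by auto
  let ?s = "map_prod f f ` r"
  have "poset_iso r ?s"
    using f unfolding poset_iso_iff_image bij_betw_def by blast
  moreover have "Field ?s = f ` Field r"
    unfolding Field_def by force
  then have "Field ?s = {1..n}"
    using f by (simp add: bij_betw_def)
  moreover have "Partial_order ?s"
    using poset_iso_Partial_order[OF \<open>poset_iso r ?s\<close> assms(1)] .
  ultimately show ?thesis
    by metis
qed

text \<open>The models \<open>\<rho> l\<close> may live on a type of their own, such as tree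
  addresses or arcs, so that no labelling by \<open>{1..n}\<close> has to be chosen for them; an
  index is matched with the class of all labelled copies of its model.\<close>

lemma unlabelled_bij_betw:
  fixes A :: "'b rel set" and \<rho> :: "'l \<Rightarrow> 'a rel"
  assumes "\<And>l. l \<in> L \<Longrightarrow> \<exists>r\<in>A. poset_iso (\<rho> l) r"
    and "\<And>r. r \<in> A \<Longrightarrow> \<exists>l\<in>L. poset_iso (\<rho> l) r"
    and "\<And>l l'. l \<in> L \<Longrightarrow> l' \<in> L \<Longrightarrow> poset_iso (\<rho> l) (\<rho> l') \<Longrightarrow> l = l'"
  shows "bij_betw (\<lambda>l. {r \<in> A. poset_iso (\<rho> l) r}) L (unlabelled A)"
proof -
  let ?E = "{(r, s). r \<in> A \<and> s \<in> A \<and> poset_iso r s}"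
  have cls: "{r \<in> A. poset_iso (\<rho> l) r} = ?E `` {r}" if "r \<in> A" "poset_iso (\<rho> l) r" for l r
    using that(1) by (auto intro: poset_iso_trans[OF that(2)] poset_iso_trans[OF poset_iso_sym[OF that(2)]])
  have "{r \<in> A. poset_iso (\<rho> l) r} \<in> unlabelled A" if l: "l \<in> L" for l
  proof -
    obtain r where r: "r \<in> A" "poset_iso (\<rho> l) r"
      using assms(1) l by blast
    then show ?thesis
      unfolding unlabelled_def cls[OF r] by (intro quotientI)
  qed
  moreover have "c \<in> (\<lambda>l. {r \<in> A. poset_iso (\<rho> l) r}) ` L" if c: "c \<in> unlabelled A" for c
  proof -
    obtain r where r: "r \<in> A" "c = ?E `` {r}"
      using c unfolding unlabelled_def by (auto elim!: quotientE)
    then obtain l where "l \<in> L" "poset_iso (\<rho> l) r"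
      using assms(2) by blast
    then show ?thesis
      unfolding r(2) using cls[OF r(1)] by (intro image_eqI[of _ _ l]) simp_all
  qed
  moreover have "inj_on (\<lambda>l. {r \<in> A. poset_iso (\<rho> l) r}) L"
  proof (rule inj_onI)
    fix l l' assume l: "l \<in> L" "l' \<in> L" and eq: "{r \<in> A. poset_iso (\<rho> l) r} = {r \<in> A. poset_iso (\<rho> l') r}"
    obtain r where "r \<in> A" "poset_iso (\<rho> l) r"
      using assms(1) l by blast
    then have r: "poset_iso (\<rho> l) r" "poset_iso (\<rho> l') r"
      using eq by blast+
    show "l = l'"
      using assms(3)[OF l poset_iso_trans[OF r(1) poset_iso_sym[OF r(2)]]] .
  qed
  ultimately show ?thesis
    unfolding bij_betw_def by blast
qed

text \<open>\<open>the_elem\<close> has a meaning only on singletons, so the class must be inhabited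
  and the statistic constant on it.\<close>

lemma class_stat_eq:
  assumes "\<exists>r\<in>A. poset_iso q r" "\<And>r. r \<in> A \<Longrightarrow> poset_iso q r \<Longrightarrow> f r = k"
  shows "class_stat f {r \<in> A. poset_iso q r} = k"
proof -
  have "f ` {r \<in> A. poset_iso q r} = {k}"
    using assms by auto
  then show ?thesis
    by (simp add: class_stat_def)
qed

section \<open>Forbidden subposets\<close>

lemma Field_Restr: "Partial_order r \<Longrightarrow> A \<subseteq> Field r \<Longrightarrow> Field (Restr r A) = A"
proof -
  assume "Partial_order r" and A: "A \<subseteq> Field r"
  then have "\<And>x. x \<in> A \<Longrightarrow> (x, x) \<in> Restr r A"
    by (auto simp: Partial_order_iff)
  then have "A \<subseteq> Field (Restr r A)"
    by (meson FieldI1 subsetI)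
  moreover have "Field (Restr r A) \<subseteq> A"
    by (auto simp: Field_def)
  ultimately show "Field (Restr r A) = A"
    by simp
qed

text \<open>A map that preserves and reflects the order is injective, because r is reflexive and q
  antisymmetric; so an embedding needs no separate condition for injectivity and the subset A is its
  image.\<close>

lemma poset_contains_iff:
  assumes "Partial_order r" "antisym q"
  shows "poset_contains r q \<longleftrightarrow>
    (\<exists>h. h ` Field q \<subseteq> Field r \<and> (\<forall>x\<in>Field q. \<forall>y\<in>Field q. (h x, h y) \<in> r \<longleftrightarrow> (x, y) \<in> q))"
proof
  assume "poset_contains r q"
  then obtain A where A: "A \<subseteq> Field r" "poset_iso q (Restr r A)"
    unfolding poset_contains_def using poset_iso_sym by blast
  then show "\<exists>h. h ` Field q \<subseteq> Field r \<and> (\<forall>x\<in>Field q. \<forall>y\<in>Field q. (h x, h y) \<in> r \<longleftrightarrow> (x, y) \<in> q)"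
  proof -
    obtain h where h: "Field (Restr r A) = h ` Field q"
      "\<And>x y. x \<in> Field q \<Longrightarrow> y \<in> Field q \<Longrightarrow> (h x, h y) \<in> Restr r A \<longleftrightarrow> (x, y) \<in> q"
      using poset_isoE[OF A(2)] by metis
    then have hA: "h ` Field q = A"
      using Field_Restr[OF assms(1) A(1)] by simp
    then have "(h x, h y) \<in> r \<longleftrightarrow> (x, y) \<in> q" if "x \<in> Field q" "y \<in> Field q" for x y
      using h(2)[OF that] that by blast
    then show ?thesis
      using hA A(1) by blast
  qed
next
  assume "\<exists>h. h ` Field q \<subseteq> Field r \<and> (\<forall>x\<in>Field q. \<forall>y\<in>Field q. (h x, h y) \<in> r \<longleftrightarrow> (x, y) \<in> q)"
  then obtain h where h: "h ` Field q \<subseteq> Field r" "\<And>x y. x \<in> Field q \<Longrightarrow> y \<in> Field q \<Longrightarrow> (h x, h y) \<in> r \<longleftrightarrow> (x, y) \<in> q"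
    by blast
  have "inj_on h (Field q)"
  proof (rule inj_onI)
    fix x y assume xy: "x \<in> Field q" "y \<in> Field q" "h x = h y"
    then have "(h x, h y) \<in> r" "(h y, h x) \<in> r"
      using h(1) assms(1) unfolding Partial_order_iff by auto
    then show "x = y"
      using h(2) xy assms(2) unfolding antisym_def by blast
  qed
  then have "poset_iso q (Restr r (h ` Field q))"
    using h by (intro poset_isoI[of h]) (simp_all add: Field_Restr[OF assms(1)])
  then show "poset_contains r q"
    unfolding poset_contains_def using h(1) poset_iso_sym by blast
qed

definition strict :: "'a rel \<Rightarrow> 'a rel" where
  "strict r = r - Id"

lemma strict_iff: "(x, y) \<in> strict r \<longleftrightarrow> (x, y) \<in> r \<and> x \<noteq> y"
  by (auto simp: strict_def)

text \<open>In this and the next two definitions only those relations and non-relations are listed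
  from which the others follow in a partial order by transitivity and antisymmetry; so does the
  distinctness of the four points.\<close>

definition has_2_plus_2 :: "'a rel \<Rightarrow> bool" where
  "has_2_plus_2 r \<longleftrightarrow> (\<exists>a b c d. (a, b) \<in> strict r \<and> (c, d) \<in> strict r \<and> (a, d) \<notin> r \<and> (c, b) \<notin> r)"

definition has_3_plus_1 :: "'a rel \<Rightarrow> bool" where
  "has_3_plus_1 r \<longleftrightarrow>
     (\<exists>a b c d. d \<in> Field r \<and> (a, b) \<in> strict r \<and> (b, c) \<in> strict r \<and> (a, d) \<notin> r \<and> (d, c) \<notin> r)"

definition has_N :: "'a rel \<Rightarrow> bool" where
  "has_N r \<longleftrightarrow> (\<exists>a b c d. (a, c) \<in> strict r \<and> (a, d) \<in> strict r \<and> (b, d) \<in> strict r \<and>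
     (b, c) \<notin> r \<and> (c, d) \<notin> r \<and> (a, b) \<notin> r)"

lemma interval_1_4: "{1..4} = {1, 2, 3, 4::nat}"
  by auto

lemma four_point_map:
  "(\<exists>h::nat \<Rightarrow> 'a. P (h 1) (h 2) (h 3) (h 4)) \<longleftrightarrow> (\<exists>a b c d. P a b c d)"
proof
  assume "\<exists>a b c d. P a b c d"
  then obtain a b c d where "P a b c d"
    by blast
  then show "\<exists>h::nat \<Rightarrow> 'a. P (h 1) (h 2) (h 3) (h 4)"
    by (intro exI[of _ "\<lambda>i. if i = 1 then a else if i = 2 then b else if i = 3 then c else d"]) simp
qed blast


lemma Partial_orderD:
  assumes "Partial_order r"
  shows "(x, y) \<in> r \<Longrightarrow> (y, z) \<in> r \<Longrightarrow> (x, z) \<in> r"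
    and "(x, y) \<in> r \<Longrightarrow> (y, x) \<in> r \<Longrightarrow> x = y"
    and "x \<in> Field r \<Longrightarrow> (x, x) \<in> r"
  using assms unfolding Partial_order_iff by (auto dest: transD antisymD)

text \<open>Of the sixteen pairs of pattern points the four diagonal ones agree by reflexivity,
  which leaves the twelve ordered pairs of different points.\<close>

lemma poset_contains_iff_four_points:
  fixes q :: "nat rel"
  assumes "Partial_order r" "antisym q" "Field q = {1, 2, 3, 4}" "\<forall>x\<in>Field q. (x, x) \<in> q"
  shows "poset_contains r q \<longleftrightarrow> (\<exists>a b c d. {a, b, c, d} \<subseteq> Field r \<and>
    ((a, b) \<in> r \<longleftrightarrow> (1, 2) \<in> q) \<and> ((b, a) \<in> r \<longleftrightarrow> (2, 1) \<in> q) \<and>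
    ((a, c) \<in> r \<longleftrightarrow> (1, 3) \<in> q) \<and> ((c, a) \<in> r \<longleftrightarrow> (3, 1) \<in> q) \<and>
    ((a, d) \<in> r \<longleftrightarrow> (1, 4) \<in> q) \<and> ((d, a) \<in> r \<longleftrightarrow> (4, 1) \<in> q) \<and>
    ((b, c) \<in> r \<longleftrightarrow> (2, 3) \<in> q) \<and> ((c, b) \<in> r \<longleftrightarrow> (3, 2) \<in> q) \<and>
    ((b, d) \<in> r \<longleftrightarrow> (2, 4) \<in> q) \<and> ((d, b) \<in> r \<longleftrightarrow> (4, 2) \<in> q) \<and>
    ((c, d) \<in> r \<longleftrightarrow> (3, 4) \<in> q) \<and> ((d, c) \<in> r \<longleftrightarrow> (4, 3) \<in> q))"
    (is "_ \<longleftrightarrow> ?rhs")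
proof -
  have "poset_contains r q \<longleftrightarrow>
    (\<exists>h. h ` Field q \<subseteq> Field r \<and> (\<forall>x\<in>Field q. \<forall>y\<in>Field q. (h x, h y) \<in> r \<longleftrightarrow> (x, y) \<in> q))"
    using poset_contains_iff[OF assms(1,2)] .
  also have "\<dots> \<longleftrightarrow> (\<exists>h::nat \<Rightarrow> 'a. {h 1, h 2, h 3, h 4} \<subseteq> Field r \<and>
    ((h 1, h 2) \<in> r \<longleftrightarrow> (1, 2) \<in> q) \<and> ((h 2, h 1) \<in> r \<longleftrightarrow> (2, 1) \<in> q) \<and>
    ((h 1, h 3) \<in> r \<longleftrightarrow> (1, 3) \<in> q) \<and> ((h 3, h 1) \<in> r \<longleftrightarrow> (3, 1) \<in> q) \<and>
    ((h 1, h 4) \<in> r \<longleftrightarrow> (1, 4) \<in> q) \<and> ((h 4, h 1) \<in> r \<longleftrightarrow> (4, 1) \<in> q) \<and>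
    ((h 2, h 3) \<in> r \<longleftrightarrow> (2, 3) \<in> q) \<and> ((h 3, h 2) \<in> r \<longleftrightarrow> (3, 2) \<in> q) \<and>
    ((h 2, h 4) \<in> r \<longleftrightarrow> (2, 4) \<in> q) \<and> ((h 4, h 2) \<in> r \<longleftrightarrow> (4, 2) \<in> q) \<and>
    ((h 3, h 4) \<in> r \<longleftrightarrow> (3, 4) \<in> q) \<and> ((h 4, h 3) \<in> r \<longleftrightarrow> (4, 3) \<in> q))"
  proof (rule ex_cong1)
    fix h :: "nat \<Rightarrow> 'a"
    have diag: "((h x, h x) \<in> r \<longleftrightarrow> (x, x) \<in> q) = True" if "h ` Field q \<subseteq> Field r" "x \<in> Field q" for x
      using that assms(4) Partial_orderD(3)[OF assms(1), of "h x"] by auto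
    show "h ` Field q \<subseteq> Field r \<and> (\<forall>x\<in>Field q. \<forall>y\<in>Field q. (h x, h y) \<in> r \<longleftrightarrow> (x, y) \<in> q) \<longleftrightarrow>
      {h 1, h 2, h 3, h 4} \<subseteq> Field r \<and>
      ((h 1, h 2) \<in> r \<longleftrightarrow> (1, 2) \<in> q) \<and> ((h 2, h 1) \<in> r \<longleftrightarrow> (2, 1) \<in> q) \<and>
      ((h 1, h 3) \<in> r \<longleftrightarrow> (1, 3) \<in> q) \<and> ((h 3, h 1) \<in> r \<longleftrightarrow> (3, 1) \<in> q) \<and>
      ((h 1, h 4) \<in> r \<longleftrightarrow> (1, 4) \<in> q) \<and> ((h 4, h 1) \<in> r \<longleftrightarrow> (4, 1) \<in> q) \<and>
      ((h 2, h 3) \<in> r \<longleftrightarrow> (2, 3) \<in> q) \<and> ((h 3, h 2) \<in> r \<longleftrightarrow> (3, 2) \<in> q) \<and>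
      ((h 2, h 4) \<in> r \<longleftrightarrow> (2, 4) \<in> q) \<and> ((h 4, h 2) \<in> r \<longleftrightarrow> (4, 2) \<in> q) \<and>
      ((h 3, h 4) \<in> r \<longleftrightarrow> (3, 4) \<in> q) \<and> ((h 4, h 3) \<in> r \<longleftrightarrow> (4, 3) \<in> q)"
    proof (cases "{h 1, h 2, h 3, h 4} \<subseteq> Field r")
      case True
      then have sub: "h ` Field q \<subseteq> Field r"
        by (simp add: assms(3))
      have "(\<forall>x\<in>Field q. \<forall>y\<in>Field q. (h x, h y) \<in> r \<longleftrightarrow> (x, y) \<in> q) \<longleftrightarrow>
        (\<forall>x\<in>Field q. \<forall>y\<in>Field q - {x}. (h x, h y) \<in> r \<longleftrightarrow> (x, y) \<in> q)"
      proof (rule ball_cong[OF refl])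
        fix x assume "x \<in> Field q"
        then show "(\<forall>y\<in>Field q. (h x, h y) \<in> r \<longleftrightarrow> (x, y) \<in> q) \<longleftrightarrow>
            (\<forall>y\<in>Field q - {x}. (h x, h y) \<in> r \<longleftrightarrow> (x, y) \<in> q)"
          using diag[OF sub] by (metis Diff_iff singletonD)
      qed
      moreover have "{1, 2, 3, 4} - {1} = {2, 3, 4::nat}" "{1, 2, 3, 4} - {2} = {1, 3, 4::nat}"
        "{1, 2, 3, 4} - {3} = {1, 2, 4::nat}" "{1, 2, 3, 4} - {4} = {1, 2, 3::nat}"
        by auto
      ultimately show ?thesis
        unfolding assms(3) image_insert image_empty
        by (simp only: True ball_simps simp_thms) (rule iffI; elim conjE; intro conjI; assumption)
    next
      case False
      then show ?thesis
        unfolding assms(3) image_insert image_empty by (simp only: simp_thms)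
    qed
  qed
  also have "\<dots> \<longleftrightarrow> ?rhs"
    by (rule four_point_map)
  finally show ?thesis .
qed

lemma pattern_Field:
  "Field poset_2_plus_2 = {1, 2, 3, 4}" "Field poset_3_plus_1 = {1, 2, 3, 4}" "Field poset_N = {1, 2, 3, 4}"
  unfolding poset_2_plus_2_def poset_3_plus_1_def poset_N_def interval_1_4 Field_def by auto

lemma has_2_plus_2_iff:
  assumes "Partial_order r"
  shows "poset_contains r poset_2_plus_2 \<longleftrightarrow> has_2_plus_2 r"
proof -
  note po = Partial_orderD[OF assms]
  have "poset_contains r poset_2_plus_2 \<longleftrightarrow> (\<exists>a b c d. {a, b, c, d} \<subseteq> Field r \<and>
      (a, b) \<in> r \<and> (b, a) \<notin> r \<and> (a, c) \<notin> r \<and> (c, a) \<notin> r \<and> (a, d) \<notin> r \<and> (d, a) \<notin> r \<and>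
      (b, c) \<notin> r \<and> (c, b) \<notin> r \<and> (b, d) \<notin> r \<and> (d, b) \<notin> r \<and> (c, d) \<in> r \<and> (d, c) \<notin> r)"
  proof -
    have "antisym poset_2_plus_2" "\<forall>x\<in>Field poset_2_plus_2. (x, x) \<in> poset_2_plus_2"
      unfolding pattern_Field by (auto simp: poset_2_plus_2_def antisym_def)
    note iff = poset_contains_iff_four_points[OF assms this(1) pattern_Field(1) this(2)]
    show ?thesis
      unfolding iff by (simp add: poset_2_plus_2_def Id_on_iff)
  qed
  also have "\<dots> \<longleftrightarrow> has_2_plus_2 r"
  proof
    assume "has_2_plus_2 r"
    then obtain a b c d where h: "(a, b) \<in> r" "a \<noteq> b" "(c, d) \<in> r" "c \<noteq> d" "(a, d) \<notin> r" "(c, b) \<notin> r"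
      unfolding has_2_plus_2_def strict_iff by blast
    then have F: "{a, b, c, d} \<subseteq> Field r"
      by (auto intro: FieldI1 FieldI2)
    show "\<exists>a b c d. {a, b, c, d} \<subseteq> Field r \<and>
      (a, b) \<in> r \<and> (b, a) \<notin> r \<and> (a, c) \<notin> r \<and> (c, a) \<notin> r \<and> (a, d) \<notin> r \<and> (d, a) \<notin> r \<and>
      (b, c) \<notin> r \<and> (c, b) \<notin> r \<and> (b, d) \<notin> r \<and> (d, b) \<notin> r \<and> (c, d) \<in> r \<and> (d, c) \<notin> r"
      by (insert h F, rule exI[of _ a], rule exI[of _ b], rule exI[of _ c], rule exI[of _ d], intro conjI)
          (assumption | (rule notI, metis po(1) po(2)) | metis po(1))+
  next
    show "has_2_plus_2 r" if "\<exists>a b c d. {a, b, c, d} \<subseteq> Field r \<and>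
      (a, b) \<in> r \<and> (b, a) \<notin> r \<and> (a, c) \<notin> r \<and> (c, a) \<notin> r \<and> (a, d) \<notin> r \<and> (d, a) \<notin> r \<and>
      (b, c) \<notin> r \<and> (c, b) \<notin> r \<and> (b, d) \<notin> r \<and> (d, b) \<notin> r \<and> (c, d) \<in> r \<and> (d, c) \<notin> r"
      using that unfolding has_2_plus_2_def strict_iff by metis
  qed
  finally show ?thesis .
qed

lemma has_3_plus_1_iff:
  assumes "Partial_order r"
  shows "poset_contains r poset_3_plus_1 \<longleftrightarrow> has_3_plus_1 r"
proof -
  note po = Partial_orderD[OF assms]
  have "poset_contains r poset_3_plus_1 \<longleftrightarrow> (\<exists>a b c d. {a, b, c, d} \<subseteq> Field r \<and>
      (a, b) \<in> r \<and> (b, a) \<notin> r \<and> (a, c) \<in> r \<and> (c, a) \<notin> r \<and> (a, d) \<notin> r \<and> (d, a) \<notin> r \<and>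
      (b, c) \<in> r \<and> (c, b) \<notin> r \<and> (b, d) \<notin> r \<and> (d, b) \<notin> r \<and> (c, d) \<notin> r \<and> (d, c) \<notin> r)"
  proof -
    have "antisym poset_3_plus_1" "\<forall>x\<in>Field poset_3_plus_1. (x, x) \<in> poset_3_plus_1"
      unfolding pattern_Field by (auto simp: poset_3_plus_1_def antisym_def)
    note iff = poset_contains_iff_four_points[OF assms this(1) pattern_Field(2) this(2)]
    show ?thesis
      unfolding iff by (simp add: poset_3_plus_1_def Id_on_iff)
  qed
  also have "\<dots> \<longleftrightarrow> has_3_plus_1 r"
  proof
    assume "has_3_plus_1 r"
    then obtain a b c d where h: "d \<in> Field r" "(a, b) \<in> r" "a \<noteq> b" "(b, c) \<in> r" "b \<noteq> c" "(a, d) \<notin> r" "(d, c) \<notin> r"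
      unfolding has_3_plus_1_def strict_iff by blast
    then have F: "{a, b, c, d} \<subseteq> Field r"
      by (auto intro: FieldI1 FieldI2)
    show "\<exists>a b c d. {a, b, c, d} \<subseteq> Field r \<and>
      (a, b) \<in> r \<and> (b, a) \<notin> r \<and> (a, c) \<in> r \<and> (c, a) \<notin> r \<and> (a, d) \<notin> r \<and> (d, a) \<notin> r \<and>
      (b, c) \<in> r \<and> (c, b) \<notin> r \<and> (b, d) \<notin> r \<and> (d, b) \<notin> r \<and> (c, d) \<notin> r \<and> (d, c) \<notin> r"
      by (insert h F, rule exI[of _ a], rule exI[of _ b], rule exI[of _ c], rule exI[of _ d], intro conjI)
          (assumption | (rule notI, metis po(1) po(2)) | metis po(1))+
  next
    show "has_3_plus_1 r" if "\<exists>a b c d. {a, b, c, d} \<subseteq> Field r \<and>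
      (a, b) \<in> r \<and> (b, a) \<notin> r \<and> (a, c) \<in> r \<and> (c, a) \<notin> r \<and> (a, d) \<notin> r \<and> (d, a) \<notin> r \<and>
      (b, c) \<in> r \<and> (c, b) \<notin> r \<and> (b, d) \<notin> r \<and> (d, b) \<notin> r \<and> (c, d) \<notin> r \<and> (d, c) \<notin> r"
      using that unfolding has_3_plus_1_def strict_iff by (metis insert_subset)
  qed
  finally show ?thesis .
qed

lemma has_N_iff:
  assumes "Partial_order r"
  shows "poset_contains r poset_N \<longleftrightarrow> has_N r"
proof -
  note po = Partial_orderD[OF assms]
  have "poset_contains r poset_N \<longleftrightarrow> (\<exists>a b c d. {a, b, c, d} \<subseteq> Field r \<and>
      (a, b) \<notin> r \<and> (b, a) \<notin> r \<and> (a, c) \<in> r \<and> (c, a) \<notin> r \<and> (a, d) \<in> r \<and> (d, a) \<notin> r \<and>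
      (b, c) \<notin> r \<and> (c, b) \<notin> r \<and> (b, d) \<in> r \<and> (d, b) \<notin> r \<and> (c, d) \<notin> r \<and> (d, c) \<notin> r)"
  proof -
    have "antisym poset_N" "\<forall>x\<in>Field poset_N. (x, x) \<in> poset_N"
      unfolding pattern_Field by (auto simp: poset_N_def antisym_def)
    note iff = poset_contains_iff_four_points[OF assms this(1) pattern_Field(3) this(2)]
    show ?thesis
      unfolding iff by (simp add: poset_N_def Id_on_iff)
  qed
  also have "\<dots> \<longleftrightarrow> has_N r"
  proof
    assume "has_N r"
    then obtain a b c d where h: "(a, c) \<in> r" "a \<noteq> c" "(a, d) \<in> r" "a \<noteq> d" "(b, d) \<in> r" "b \<noteq> d"
        "(b, c) \<notin> r" "(c, d) \<notin> r" "(a, b) \<notin> r"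
      unfolding has_N_def strict_iff by blast
    then have F: "{a, b, c, d} \<subseteq> Field r"
      by (auto intro: FieldI1 FieldI2)
    show "\<exists>a b c d. {a, b, c, d} \<subseteq> Field r \<and>
      (a, b) \<notin> r \<and> (b, a) \<notin> r \<and> (a, c) \<in> r \<and> (c, a) \<notin> r \<and> (a, d) \<in> r \<and> (d, a) \<notin> r \<and>
      (b, c) \<notin> r \<and> (c, b) \<notin> r \<and> (b, d) \<in> r \<and> (d, b) \<notin> r \<and> (c, d) \<notin> r \<and> (d, c) \<notin> r"
      by (insert h F, rule exI[of _ a], rule exI[of _ b], rule exI[of _ c], rule exI[of _ d], intro conjI)
          (assumption | (rule notI, metis po(1) po(2)) | metis po(1))+
  next
    show "has_N r" if "\<exists>a b c d. {a, b, c, d} \<subseteq> Field r \<and>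
      (a, b) \<notin> r \<and> (b, a) \<notin> r \<and> (a, c) \<in> r \<and> (c, a) \<notin> r \<and> (a, d) \<in> r \<and> (d, a) \<notin> r \<and>
      (b, c) \<notin> r \<and> (c, b) \<notin> r \<and> (b, d) \<in> r \<and> (d, b) \<notin> r \<and> (c, d) \<notin> r \<and> (d, c) \<notin> r"
      using that unfolding has_N_def strict_iff by metis
  qed
  finally show ?thesis .
qed

lemma poset_iso_has_2_plus_2:
  assumes "poset_iso r s" "has_2_plus_2 r"
  shows "has_2_plus_2 s"
proof -
  obtain f where f: "inj_on f (Field r)" "Field s = f ` Field r"
      "\<And>x y. x \<in> Field r \<Longrightarrow> y \<in> Field r \<Longrightarrow> (f x, f y) \<in> s \<longleftrightarrow> (x, y) \<in> r"
    using poset_isoE[OF assms(1)] by blast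
  obtain a b c d where h: "(a, b) \<in> r" "a \<noteq> b" "(c, d) \<in> r" "c \<noteq> d" "(a, d) \<notin> r" "(c, b) \<notin> r"
    using assms(2) unfolding has_2_plus_2_def strict_iff by blast
  then have F: "a \<in> Field r" "b \<in> Field r" "c \<in> Field r" "d \<in> Field r"
    by (auto intro: FieldI1 FieldI2)
  show ?thesis
    unfolding has_2_plus_2_def strict_iff 
    by (rule exI[of _ "f a"], rule exI[of _ "f b"], rule exI[of _ "f c"], rule exI[of _ "f d"])
      (use h f(1,3) F in \<open>simp add: inj_on_eq_iff\<close>)
qed

lemma poset_iso_has_3_plus_1:
  assumes "poset_iso r s" "has_3_plus_1 r"
  shows "has_3_plus_1 s"
proof -
  obtain f where f: "inj_on f (Field r)" "Field s = f ` Field r"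
      "\<And>x y. x \<in> Field r \<Longrightarrow> y \<in> Field r \<Longrightarrow> (f x, f y) \<in> s \<longleftrightarrow> (x, y) \<in> r"
    using poset_isoE[OF assms(1)] by blast
  obtain a b c d where h: "d \<in> Field r" "(a, b) \<in> r" "a \<noteq> b" "(b, c) \<in> r" "b \<noteq> c" "(a, d) \<notin> r" "(d, c) \<notin> r"
    using assms(2) unfolding has_3_plus_1_def strict_iff by blast
  then have F: "a \<in> Field r" "b \<in> Field r" "c \<in> Field r" "d \<in> Field r"
    by (auto intro: FieldI1 FieldI2)
  show ?thesis
    unfolding has_3_plus_1_def strict_iff 
    by (rule exI[of _ "f a"], rule exI[of _ "f b"], rule exI[of _ "f c"], rule exI[of _ "f d"])
      (use h f F in \<open>simp add: inj_on_eq_iff\<close>)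
qed

lemma poset_iso_has_N:
  assumes "poset_iso r s" "has_N r"
  shows "has_N s"
proof -
  obtain f where f: "inj_on f (Field r)" "Field s = f ` Field r"
      "\<And>x y. x \<in> Field r \<Longrightarrow> y \<in> Field r \<Longrightarrow> (f x, f y) \<in> s \<longleftrightarrow> (x, y) \<in> r"
    using poset_isoE[OF assms(1)] by blast
  obtain a b c d where h: "(a, c) \<in> r" "a \<noteq> c" "(a, d) \<in> r" "a \<noteq> d" "(b, d) \<in> r" "b \<noteq> d"
        "(b, c) \<notin> r" "(c, d) \<notin> r" "(a, b) \<notin> r"
    using assms(2) unfolding has_N_def strict_iff by blast
  then have F: "a \<in> Field r" "b \<in> Field r" "c \<in> Field r" "d \<in> Field r"
    by (auto intro: FieldI1 FieldI2)
  show ?thesis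
    unfolding has_N_def strict_iff 
    by (rule exI[of _ "f a"], rule exI[of _ "f b"], rule exI[of _ "f c"], rule exI[of _ "f d"])
      (use h f(1,3) F in \<open>simp add: inj_on_eq_iff\<close>)
qed

section \<open>Statistics of posets\<close>

lemma poset_iso_min_count:
  assumes "poset_iso r s"
  shows "min_count r = min_count s"
proof -
  obtain f where f: "inj_on f (Field r)" "Field s = f ` Field r"
      "\<And>x y. x \<in> Field r \<Longrightarrow> y \<in> Field r \<Longrightarrow> (f x, f y) \<in> s \<longleftrightarrow> (x, y) \<in> r"
    using poset_isoE[OF assms] by blast
  have "(\<forall>y. (y, f x) \<in> s \<longrightarrow> y = f x) \<longleftrightarrow> (\<forall>y. (y, x) \<in> r \<longrightarrow> y = x)" if x: "x \<in> Field r" for x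
  proof -
    have "(\<forall>y. (y, f x) \<in> s \<longrightarrow> y = f x) \<longleftrightarrow> (\<forall>y\<in>Field s. (y, f x) \<in> s \<longrightarrow> y = f x)"
      by (auto intro: FieldI1)
    also have "\<dots> \<longleftrightarrow> (\<forall>y\<in>Field r. (y, x) \<in> r \<longrightarrow> y = x)"
      unfolding f(2) using f(1,3) x by (auto simp: inj_on_eq_iff)
    also have "\<dots> \<longleftrightarrow> (\<forall>y. (y, x) \<in> r \<longrightarrow> y = x)"
      by (auto intro: FieldI1)
    finally show ?thesis .
  qed
  then have "{x \<in> Field s. \<forall>y. (y, x) \<in> s \<longrightarrow> y = x} = f ` {x \<in> Field r. \<forall>y. (y, x) \<in> r \<longrightarrow> y = x}"
    unfolding f(2) by auto
  moreover have "inj_on f {x \<in> Field r. \<forall>y. (y, x) \<in> r \<longrightarrow> y = x}"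
    using f(1) by (rule inj_on_subset) auto
  ultimately show ?thesis
    by (simp add: min_count_def card_image)
qed

definition maximal_chains :: "'a rel \<Rightarrow> 'a set set" where
  "maximal_chains r = {C \<in> Chains r. \<forall>D\<in>Chains r. C \<subseteq> D \<longrightarrow> D = C}"

lemma smc_alt: "smc r = Min (card ` maximal_chains r)"
  by (simp add: smc_def maximal_chains_def)

lemma Chains_subset_Field: "C \<in> Chains r \<Longrightarrow> C \<subseteq> Field r"
  by (auto simp: Chains_def intro: FieldI1)

lemma poset_iso_smc:
  assumes "poset_iso r s"
  shows "smc r = smc s"
proof -
  obtain f where f: "inj_on f (Field r)" "Field s = f ` Field r"
      "\<And>x y. x \<in> Field r \<Longrightarrow> y \<in> Field r \<Longrightarrow> (f x, f y) \<in> s \<longleftrightarrow> (x, y) \<in> r"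
    using poset_isoE[OF assms] by blast
  have chain: "f ` C \<in> Chains s \<longleftrightarrow> C \<in> Chains r" if "C \<subseteq> Field r" for C
  proof -
    have "((f a, f b) \<in> s \<or> (f b, f a) \<in> s) \<longleftrightarrow> (a, b) \<in> r \<or> (b, a) \<in> r" if "a \<in> C" "b \<in> C" for a b
      using f(3) that \<open>C \<subseteq> Field r\<close> by auto
    then show ?thesis
      unfolding Chains_def by auto
  qed
  have Chains_s: "Chains s = image f ` Chains r"
  proof (intro equalityI subsetI)
    fix D assume D: "D \<in> Chains s"
    then obtain C where "C \<subseteq> Field r" "D = f ` C"
      using Chains_subset_Field[OF D] f(2) by (auto simp: subset_image_iff)
    then show "D \<in> image f ` Chains r"
      using chain D by auto
  next
    fix D assume "D \<in> image f ` Chains r"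
    then show "D \<in> Chains s"
      using chain Chains_subset_Field by auto
  qed
  have "maximal_chains s = image f ` maximal_chains r"
  proof -
    have "(\<forall>D\<in>Chains s. f ` C \<subseteq> D \<longrightarrow> D = f ` C) \<longleftrightarrow> (\<forall>D\<in>Chains r. C \<subseteq> D \<longrightarrow> D = C)" if C: "C \<in> Chains r" for C
    proof -
      have "f ` C \<subseteq> f ` D \<longleftrightarrow> C \<subseteq> D" "f ` D = f ` C \<longleftrightarrow> D = C" if "D \<in> Chains r" for D
        using inj_on_image_mem_iff[OF f(1)] inj_on_image_eq_iff[OF f(1)] Chains_subset_Field[OF C] Chains_subset_Field[OF that]
        by blast+
      then show ?thesis
        unfolding Chains_s by auto
    qed
    then show ?thesis
      unfolding maximal_chains_def by (subst (1) Chains_s) auto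
  qed
  moreover have "card (f ` C) = card C" if "C \<in> maximal_chains r" for C
    using that Chains_subset_Field f(1) by (intro card_image inj_on_subset[OF f(1)]) (auto simp: maximal_chains_def)
  ultimately have "card ` maximal_chains s = card ` maximal_chains r"
    by (auto simp: image_iff)
  then show ?thesis
    by (simp add: smc_alt)
qed

text \<open>
  The empty lower part is counted, so the number of cuts is the number of irreducible summands.
\<close>

definition cuts :: "'a rel \<Rightarrow> 'a set set" where
  "cuts r = {A. A \<subset> Field r \<and> A \<times> (Field r - A) \<subseteq> r}"

lemma finite_cuts: "finite (Field r) \<Longrightarrow> finite (cuts r)"
  by (rule finite_subset[of _ "Pow (Field r)"]) (auto simp: cuts_def)

lemma poset_iso_cuts:
  assumes "poset_iso r s"
  shows "card (cuts r) = card (cuts s)"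
proof -
  obtain f where f: "inj_on f (Field r)" "Field s = f ` Field r"
      "\<And>x y. x \<in> Field r \<Longrightarrow> y \<in> Field r \<Longrightarrow> (f x, f y) \<in> s \<longleftrightarrow> (x, y) \<in> r"
    using poset_isoE[OF assms] by blast
  have cut: "f ` A \<in> cuts s \<longleftrightarrow> A \<in> cuts r" if A: "A \<subseteq> Field r" for A
  proof -
    have e0: "f ` A \<subseteq> Field s \<longleftrightarrow> A \<subseteq> Field r"
      using A unfolding f(2) by blast
    have e1: "f ` A = Field s \<longleftrightarrow> A = Field r"
      unfolding f(2) using inj_on_image_eq_iff[OF f(1) A] by blast
    have e2: "Field s - f ` A = f ` (Field r - A)"
      unfolding f(2) using inj_on_image_set_diff[OF f(1) _ A] by blast
    have e3: "f ` A \<times> f ` (Field r - A) \<subseteq> s \<longleftrightarrow> A \<times> (Field r - A) \<subseteq> r"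
    proof -
      have "(f a, f b) \<in> s \<longleftrightarrow> (a, b) \<in> r" if "a \<in> A" "b \<in> Field r - A" for a b
        using f(3) A that by blast
      then show ?thesis
        by blast
    qed
    show ?thesis
      unfolding cuts_def mem_Collect_eq psubset_eq e0 e1 e2 e3 ..
  qed
  have "cuts s = image f ` cuts r"
  proof (intro equalityI subsetI)
    fix B assume B: "B \<in> cuts s"
    then have "B \<subseteq> f ` Field r"
      unfolding cuts_def f(2)[symmetric] by blast
    then obtain A where "A \<subseteq> Field r" "B = f ` A"
      by (auto simp: subset_image_iff)
    then show "B \<in> image f ` cuts r"
      using cut B by blast
  next
    fix B assume "B \<in> image f ` cuts r"
    then obtain A where A: "A \<in> cuts r" "B = f ` A"
      by blast
    moreover from A(1) have "A \<subseteq> Field r"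
      unfolding cuts_def by blast
    ultimately show "B \<in> cuts s"
      using cut by blast
  qed
  moreover have "inj_on (image f) (cuts r)"
    using inj_on_image_Pow[OF f(1)] by (rule inj_on_subset) (auto simp: cuts_def)
  ultimately show ?thesis
    by (simp add: card_image)
qed

section \<open>Ordinal sums and their cuts\<close>

lemma Field_ordinal_sum: "Field (ordinal_sum p q) = Field p \<union> Field q"
  unfolding ordinal_sum_def Field_def by auto

lemma ordinal_sum_empty [simp]: "ordinal_sum p {} = p" "ordinal_sum {} p = p"
  by (auto simp: ordinal_sum_def)

lemma ordinal_sum_assoc: "ordinal_sum (ordinal_sum p q) r = ordinal_sum p (ordinal_sum q r)"
  unfolding ordinal_sum_def[of "ordinal_sum p q"] ordinal_sum_def[of p "ordinal_sum q r"] Field_ordinal_sum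
  by (auto simp: ordinal_sum_def)

lemma ordinal_sum_mem:
  assumes "Field p \<inter> Field q = {}"
  shows "x \<in> Field p \<Longrightarrow> y \<in> Field p \<Longrightarrow> (x, y) \<in> ordinal_sum p q \<longleftrightarrow> (x, y) \<in> p"
    and "x \<in> Field q \<Longrightarrow> y \<in> Field q \<Longrightarrow> (x, y) \<in> ordinal_sum p q \<longleftrightarrow> (x, y) \<in> q"
    and "x \<in> Field p \<Longrightarrow> y \<in> Field q \<Longrightarrow> (x, y) \<in> ordinal_sum p q"
    and "x \<in> Field p \<Longrightarrow> y \<in> Field q \<Longrightarrow> (y, x) \<notin> ordinal_sum p q"
  using assms FieldI1[of x y p] FieldI2[of x y p] FieldI1[of x y q] FieldI2[of x y q]
    FieldI1[of y x p] FieldI2[of y x p] FieldI1[of y x q] FieldI2[of y x q]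
  by (auto simp: ordinal_sum_def)

text \<open>If a cut of the sum misses a point of p, it contains no point of q, since that would
  have to lie below the missing one. The lower part \<open>Field p\<close> itself arises from the
  empty cut of q, which keeps the two families disjoint and makes the numbers of cuts add
  up.\<close>

lemma cuts_ordinal_sum:
  assumes "Field p \<inter> Field q = {}"
  shows "cuts (ordinal_sum p q) = cuts p \<union> (\<union>) (Field p) ` cuts q"
proof (intro equalityI subsetI)
  note mem = ordinal_sum_mem[OF assms]
  fix A assume "A \<in> cuts (ordinal_sum p q)"
  then have A: "A \<subset> Field p \<union> Field q"
      "\<And>x y. x \<in> A \<Longrightarrow> y \<in> Field p \<union> Field q \<Longrightarrow> y \<notin> A \<Longrightarrow> (x, y) \<in> ordinal_sum p q"
    by (auto simp: cuts_def Field_ordinal_sum)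
  show "A \<in> cuts p \<union> (\<union>) (Field p) ` cuts q"
  proof (cases "Field p \<subseteq> A")
    case True
    have "A \<inter> Field q \<subset> Field q"
      using True A(1) by blast
    moreover have "(x, y) \<in> q" if "x \<in> A \<inter> Field q" "y \<in> Field q - (A \<inter> Field q)" for x y
      using A(2)[of x y] mem(2)[of x y] that by blast
    ultimately have "A \<inter> Field q \<in> cuts q"
      by (auto simp: cuts_def)
    moreover have "A = Field p \<union> (A \<inter> Field q)"
      using True A(1) by blast
    ultimately show ?thesis
      by blast
  next
    case False
    then obtain x where x: "x \<in> Field p" "x \<notin> A"
      by blast
    have "a \<in> Field p" if "a \<in> A" for a
      using A(1) A(2)[OF that _ x(2)] x(1) mem(4)[of x a] that by blast
    then have "A \<subset> Field p"
      using x by blast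
    moreover have "(a, b) \<in> p" if "a \<in> A" "b \<in> Field p - A" for a b
      using A(2)[of a b] mem(1)[of a b] that \<open>A \<subset> Field p\<close> by blast
    ultimately show ?thesis
      by (auto simp: cuts_def)
  qed
next
  note mem = ordinal_sum_mem[OF assms]
  fix A assume "A \<in> cuts p \<union> (\<union>) (Field p) ` cuts q"
  then show "A \<in> cuts (ordinal_sum p q)"
  proof
    assume A: "A \<in> cuts p"
    then have "(a, b) \<in> ordinal_sum p q" if "a \<in> A" "b \<in> Field p \<union> Field q - A" for a b
      using that mem(1)[of a b] mem(3)[of a b] unfolding cuts_def by blast
    then show ?thesis
      using A unfolding cuts_def Field_ordinal_sum by blast
  next
    assume "A \<in> (\<union>) (Field p) ` cuts q"
    then obtain B where B: "A = Field p \<union> B" "B \<in> cuts q"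
      by blast
    then have "(a, b) \<in> ordinal_sum p q" if "a \<in> A" "b \<in> Field p \<union> Field q - A" for a b
      using that mem(2)[of a b] mem(3)[of a b] unfolding cuts_def by blast
    moreover have "A \<subset> Field p \<union> Field q"
      using B assms unfolding cuts_def by blast
    ultimately show ?thesis
      unfolding cuts_def Field_ordinal_sum by blast
  qed
qed

lemma card_cuts_ordinal_sum:
  assumes "Field p \<inter> Field q = {}" "finite (Field p)" "finite (Field q)"
  shows "card (cuts (ordinal_sum p q)) = card (cuts p) + card (cuts q)"
proof -
  have "inj_on ((\<union>) (Field p)) (cuts q)"
    using assms(1) by (intro inj_onI) (auto simp: cuts_def)
  moreover have "cuts p \<inter> (\<union>) (Field p) ` cuts q = {}"
    by (auto simp: cuts_def)
  ultimately show ?thesis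
    unfolding cuts_ordinal_sum[OF assms(1)]
    using assms(2,3) by (subst card_Un_disjoint) (auto simp: finite_cuts card_image)
qed

lemma cuts_empty: "cuts {} = {}"
  by (auto simp: cuts_def)

lemma Partial_order_Restr: "Partial_order r \<Longrightarrow> A \<subseteq> Field r \<Longrightarrow> Partial_order (Restr r A)"
  unfolding Partial_order_iff[of "Restr r A"]
  by (auto simp: Field_Restr Partial_orderD(3) trans_def antisym_def
      dest: Partial_orderD(2) intro: Partial_orderD(1))

text \<open>By antisymmetry no point outside a cut lies below a point of the cut, so all relations
  between the two parts go upwards.\<close>

lemma ordinal_sum_cut:
  assumes "Partial_order r" "A \<in> cuts r"
  shows "r = ordinal_sum (Restr r A) (Restr r (Field r - A))"
proof -
  have A: "A \<subseteq> Field r" "\<And>x y. x \<in> A \<Longrightarrow> y \<in> Field r \<Longrightarrow> y \<notin> A \<Longrightarrow> (x, y) \<in> r"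
    using assms(2) by (auto simp: cuts_def)
  have "x \<in> A" if "(x, y) \<in> r" "y \<in> A" for x y
  proof (rule ccontr)
    assume "x \<notin> A"
    then have "(y, x) \<in> r"
      using A(2) that FieldI1[OF that(1)] by blast
    then show False
      using Partial_orderD(2)[OF assms(1)] that \<open>x \<notin> A\<close> by blast
  qed
  moreover have "Field (Restr r A) = A" "Field (Restr r (Field r - A)) = Field r - A"
    using Field_Restr[OF assms(1)] A(1) by blast+
  ultimately show ?thesis
    unfolding ordinal_sum_def using A by (auto intro: FieldI1 FieldI2)
qed

lemma cuts_irreducible:
  assumes "irreducible_poset p"
  shows "cuts p = {{}}"
proof -
  have p: "Partial_order p" "p \<noteq> {}"
    using assms unfolding irreducible_poset_def by auto
  then have "Field p \<noteq> {}"
    by (auto simp: Field_def)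
  then have "{} \<in> cuts p"
    by (auto simp: cuts_def)
  moreover have "A = {}" if A: "A \<in> cuts p" for A
  proof (rule ccontr)
    assume "A \<noteq> {}"
    have sub: "A \<subseteq> Field p" "Field p - A \<subseteq> Field p" "Field p - A \<noteq> {}"
      using A by (auto simp: cuts_def)
    let ?q = "Restr p A" and ?s = "Restr p (Field p - A)"
    have "Field ?q = A" "Field ?s = Field p - A"
      using Field_Restr[OF p(1)] sub by blast+
    moreover from this have "?q \<noteq> {}" "?s \<noteq> {}"
      using \<open>A \<noteq> {}\<close> sub(3) by (metis Field_empty)+
    moreover have "Partial_order ?q" "Partial_order ?s"
      using Partial_order_Restr[OF p(1)] sub by blast+
    moreover have "p = ordinal_sum ?q ?s"
      using ordinal_sum_cut[OF p(1) A] .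
    ultimately show False
      using assms unfolding irreducible_poset_def by (metis Diff_disjoint)
  qed
  ultimately show ?thesis
    by blast
qed

definition irreducible_decomposition :: "'a rel list \<Rightarrow> bool" where
  "irreducible_decomposition rs \<longleftrightarrow> (\<forall>p\<in>set rs. irreducible_poset p) \<and>
     sorted_wrt (\<lambda>p q. Field p \<inter> Field q = {}) rs"

lemma Field_foldr_ordinal_sum: "Field (foldr ordinal_sum rs {}) = (\<Union>p\<in>set rs. Field p)"
  by (induction rs) (auto simp: Field_ordinal_sum)

text \<open>Every irreducible summand contributes exactly one cut, so all decompositions have the
  same length. This gives the definite description in \<open>ssd\<close> its value and makes it
  invariant under isomorphism.\<close>

lemma length_irreducible_decomposition:
  "irreducible_decomposition rs \<Longrightarrow> finite (Field (foldr ordinal_sum rs {})) \<Longrightarrow>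
     length rs = card (cuts (foldr ordinal_sum rs {}))"
proof (induction rs)
  case Nil
  then show ?case by (simp add: cuts_empty)
next
  case (Cons p rs)
  have "Field p \<inter> Field (foldr ordinal_sum rs {}) = {}"
    using Cons.prems(1) by (auto simp: irreducible_decomposition_def Field_foldr_ordinal_sum)
  moreover have "finite (Field p)" "finite (Field (foldr ordinal_sum rs {}))"
    using Cons.prems(2) by (auto simp: Field_ordinal_sum)
  ultimately show ?case
    using Cons cuts_irreducible[of p] by (simp add: irreducible_decomposition_def card_cuts_ordinal_sum)
qed

lemma foldr_ordinal_sum_append:
  "foldr ordinal_sum (ps @ qs) {} = ordinal_sum (foldr ordinal_sum ps {}) (foldr ordinal_sum qs {})"
  by (induction ps) (auto simp: ordinal_sum_assoc)

lemma irreducible_decomposition_ex: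
  assumes "Partial_order r" "finite (Field r)"
  shows "\<exists>rs. irreducible_decomposition rs \<and> foldr ordinal_sum rs {} = r"
  using assms
proof (induction "card (Field r)" arbitrary: r rule: less_induct)
  case less
  consider "r = {}" | "irreducible_poset r"
    | p q where "Partial_order p" "Partial_order q" "p \<noteq> {}" "q \<noteq> {}" "Field p \<inter> Field q = {}" "r = ordinal_sum p q"
    using less.prems unfolding irreducible_poset_def by blast
  then show ?case
  proof cases
    case 1
    then show ?thesis
      by (intro exI[of _ "[]"]) (simp add: irreducible_decomposition_def)
  next
    case 2
    then show ?thesis
      by (intro exI[of _ "[r]"]) (simp add: irreducible_decomposition_def)
  next
    case 3
    have F: "Field r = Field p \<union> Field q"
      by (simp add: 3 Field_ordinal_sum)
    have "Field p \<noteq> {}" "Field q \<noteq> {}"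
      using 3 by (auto simp: Field_def)
    then have "Field p \<subset> Field r" "Field q \<subset> Field r"
      using F 3(5) by blast+
    then have "card (Field p) < card (Field r)" "card (Field q) < card (Field r)" "finite (Field p)" "finite (Field q)"
      using less.prems(2) F by (auto intro: psubset_card_mono)
    then obtain ps qs where ps: "irreducible_decomposition ps" "foldr ordinal_sum ps {} = p"
      and qs: "irreducible_decomposition qs" "foldr ordinal_sum qs {} = q"
      using less.hyps 3(1,2) by meson
    have "Field a \<inter> Field b = {}" if "a \<in> set ps" "b \<in> set qs" for a b
      using 3(5) that unfolding ps(2)[symmetric] qs(2)[symmetric] Field_foldr_ordinal_sum by blast
    then have "irreducible_decomposition (ps @ qs)"
      using ps(1) qs(1) unfolding irreducible_decomposition_def by (auto simp: sorted_wrt_append)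
    moreover have "foldr ordinal_sum (ps @ qs) {} = r"
      unfolding foldr_ordinal_sum_append ps(2) qs(2) 3(6) ..
    ultimately show ?thesis
      by blast
  qed
qed

lemma ssd_eq_card_cuts:
  assumes "Partial_order r" "finite (Field r)"
  shows "ssd r = card (cuts r)"
proof -
  obtain rs where rs: "irreducible_decomposition rs" "foldr ordinal_sum rs {} = r"
    using irreducible_decomposition_ex[OF assms] by blast
  have "k = card (cuts r)" if "length qs = k" "irreducible_decomposition qs" "foldr ordinal_sum qs {} = r" for k qs
    using length_irreducible_decomposition[OF that(2)] that assms(2) by simp
  then show ?thesis
    unfolding ssd_def irreducible_decomposition_def[symmetric] conj_assoc[symmetric]
    using rs by (intro the_equality) (auto simp: irreducible_decomposition_def)
qed

lemma poset_iso_ssd: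
  assumes "poset_iso r s" "Partial_order r" "finite (Field r)"
  shows "ssd r = ssd s"
proof -
  have "finite (Field s)"
    using assms(1,3) unfolding poset_iso_def using bij_betw_finite by blast
  then show ?thesis
    using ssd_eq_card_cuts poset_iso_cuts[OF assms(1)] poset_iso_Partial_order[OF assms(1,2)] assms(2,3) by metis
qed

lemma poset_iso_not_contains:
  assumes "poset_iso q r" "Partial_order q"
  shows "\<not> has_3_plus_1 q \<Longrightarrow> \<not> poset_contains r poset_3_plus_1"
    and "\<not> has_N q \<Longrightarrow> \<not> poset_contains r poset_N"
  using poset_iso_has_3_plus_1[OF poset_iso_sym[OF assms(1)]] poset_iso_has_N[OF poset_iso_sym[OF assms(1)]]
    has_3_plus_1_iff[OF poset_iso_Partial_order[OF assms]] has_N_iff[OF poset_iso_Partial_order[OF assms]]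
  by blast+

text \<open>The common frame for semiorders, tree posets and arc posets. Avoidance of X and the
  values of the statistics are demanded of every copy r of a model, because the classes consist of
  such copies.\<close>

lemma equidist_posets_avoiding:
  fixes \<rho> :: "'l \<Rightarrow> 'a rel" and f g :: "nat rel \<Rightarrow> nat"
  assumes po: "\<And>l. l \<in> L \<Longrightarrow> Partial_order (\<rho> l) \<and> finite (Field (\<rho> l)) \<and> card (Field (\<rho> l)) = n"
    and free: "\<And>l. l \<in> L \<Longrightarrow> \<not> has_2_plus_2 (\<rho> l)"
      "\<And>l (r :: nat rel). l \<in> L \<Longrightarrow> poset_iso (\<rho> l) r \<Longrightarrow> \<not> poset_contains r X"
    and surj: "\<And>r. partial_order_on {1..n} r \<Longrightarrow> \<not> has_2_plus_2 r \<Longrightarrow> \<not> poset_contains r X \<Longrightarrow>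
      \<exists>l\<in>L. poset_iso (\<rho> l) r"
    and inj: "\<And>l l'. l \<in> L \<Longrightarrow> l' \<in> L \<Longrightarrow> poset_iso (\<rho> l) (\<rho> l') \<Longrightarrow> l = l'"
    and stat: "\<And>l r. l \<in> L \<Longrightarrow> poset_iso (\<rho> l) r \<Longrightarrow> f r = f' l \<and> g r = g' l"
  shows "equidist L f' g' (posets_avoiding X n) (class_stat f) (class_stat g)"
proof -
  let ?A = "{r. partial_order_on {1..n} r \<and> \<not> poset_contains r poset_2_plus_2 \<and> \<not> poset_contains r X}"
  have ex: "\<exists>r\<in>?A. poset_iso (\<rho> l) r" if l: "l \<in> L" for l
  proof -
    obtain r where r: "partial_order_on {1..n} r" "poset_iso (\<rho> l) r"
      using poset_iso_interval_ex[of "\<rho> l" n] po[OF l] by blast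
    have "\<not> has_2_plus_2 r"
      using free(1)[OF l] poset_iso_has_2_plus_2[OF poset_iso_sym[OF r(2)]] by blast
    then have "\<not> poset_contains r poset_2_plus_2"
      using has_2_plus_2_iff[OF Partial_order_if_partial_order_on[OF r(1)]] by simp
    then show ?thesis
      using r free(2)[OF l r(2)] by blast
  qed
  have "bij_betw (\<lambda>l. {r \<in> ?A. poset_iso (\<rho> l) r}) L (unlabelled ?A)"
  proof (rule unlabelled_bij_betw)
    fix r assume r: "r \<in> ?A"
    then have "\<not> has_2_plus_2 r"
      using has_2_plus_2_iff[OF Partial_order_if_partial_order_on[of "{1..n}" r]] by simp
    then show "\<exists>l\<in>L. poset_iso (\<rho> l) r"
      using surj r by simp
  qed (use ex inj in simp_all)
  then have "bij_betw (\<lambda>l. {r \<in> ?A. poset_iso (\<rho> l) r}) L (posets_avoiding X n)"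
    by (simp only: posets_avoiding_def)
  then show ?thesis
    by (rule equidistI) (use class_stat_eq[OF ex] stat in blast)+
qed

section \<open>Semiorders\<close>

text \<open>
  A semiorder is represented by the sorted list of the sizes of the strict down-sets of its elements:
  listing the elements so that down-sets grow and up-sets shrink, every down-set becomes an initial
  segment.
\<close>

definition semiorder_codes :: "nat \<Rightarrow> nat list set" where
  "semiorder_codes n = {d. length d = n \<and> sorted d \<and> (\<forall>i<n. d ! i \<le> i)}"

definition semiorder :: "nat list \<Rightarrow> nat rel" where
  "semiorder d = {(i, j). i < length d \<and> j < length d \<and> (i = j \<or> i < d ! j)}"

definition zeros :: "nat list \<Rightarrow> nat" where
  "zeros d = card {j. j < length d \<and> d ! j = 0}"

text \<open>\<open>d ! j = j\<close> says that the first j elements lie below the element j and, d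
  being sorted, below all later ones: the fixed points are the cuts of the semiorder.\<close>

definition fixed_points :: "nat list \<Rightarrow> nat" where
  "fixed_points d = card {j. j < length d \<and> d ! j = j}"

lemma initial_segment_eq:
  fixes I :: "nat set"
  assumes "finite I" "\<And>i j. i \<in> I \<Longrightarrow> j < i \<Longrightarrow> j \<in> I"
  shows "I = {..<card I}"
proof (cases "I = {}")
  case False
  have "x \<in> I \<longleftrightarrow> x \<le> Max I" for x
    using assms(2)[OF Max_in[OF assms(1) False], of x] Max_in[OF assms(1) False] Max_ge[OF assms(1), of x]
    by (auto simp: le_less)
  then have "I = {..Max I}"
    by blast
  then have "I = {..<Suc (Max I)}"
    by (simp only: lessThan_Suc_atMost)
  then show ?thesis
    by (metis card_lessThan)
qed simp

lemma zero_iff_less_zeros: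
  assumes "sorted d" "j < length d"
  shows "d ! j = 0 \<longleftrightarrow> j < zeros d"
proof -
  let ?I = "{j. j < length d \<and> d ! j = 0}"
  have "?I = {..<card ?I}"
  proof (rule initial_segment_eq)
    fix i j assume i: "i \<in> ?I" "j < i"
    then have "d ! j \<le> d ! i"
      using assms(1) by (intro sorted_nth_mono) auto
    then show "j \<in> ?I"
      using i by simp
  qed simp
  then have "j \<in> ?I \<longleftrightarrow> j < zeros d"
    unfolding zeros_def by blast
  then show ?thesis
    using assms(2) by simp
qed

lemma zeros_le_length: "zeros d \<le> length d"
proof -
  have "zeros d \<le> card {..<length d}"
    unfolding zeros_def by (rule card_mono) auto
  then show ?thesis
    by simp
qed

context
  fixes n :: nat and d :: "nat list"
  assumes d: "d \<in> semiorder_codes n"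
begin

lemma semiorder_codeD: "length d = n" "sorted d" "i < n \<Longrightarrow> d ! i \<le> i" "i \<le> j \<Longrightarrow> j < n \<Longrightarrow> d ! i \<le> d ! j"
  using d sorted_nth_mono[of d i j] by (auto simp: semiorder_codes_def)

lemma semiorder_mem: "(i, j) \<in> semiorder d \<longleftrightarrow> i < n \<and> j < n \<and> (i = j \<or> i < d ! j)"
  by (simp add: semiorder_def semiorder_codeD)

lemma semiorder_strict: "(i, j) \<in> strict (semiorder d) \<longleftrightarrow> j < n \<and> i < d ! j"
  using semiorder_codeD(3)[of j] by (auto simp: strict_iff semiorder_mem)

lemma Field_semiorder: "Field (semiorder d) = {..<n}"
  by (auto simp: Field_def semiorder_mem)

lemma Partial_order_semiorder: "Partial_order (semiorder d)"
  unfolding Partial_order_iff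
proof (intro conjI)
  show "trans (semiorder d)"
  proof (rule transI)
    fix i j k assume ij: "(i, j) \<in> semiorder d" and jk: "(j, k) \<in> semiorder d"
    show "(i, k) \<in> semiorder d"
    proof (cases "i = j \<or> j = k")
      case False
      then have "i < d ! j" "j < d ! k" "k < n"
        using ij jk by (auto simp: semiorder_mem)
      moreover from this have "j < k"
        using semiorder_codeD(3)[of k] by simp
      ultimately show ?thesis
        using ij jk semiorder_codeD(4)[of j k] by (auto simp: semiorder_mem)
    qed (use ij jk in auto)
  qed
  show "antisym (semiorder d)"
  proof (rule antisymI)
    fix i j assume ij: "(i, j) \<in> semiorder d" and ji: "(j, i) \<in> semiorder d"
    then show "i = j"
      using semiorder_codeD(3)[of i] semiorder_codeD(3)[of j] by (auto simp: semiorder_mem)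
  qed
qed (simp add: Field_semiorder semiorder_mem)

text \<open>The down-sets are initial segments that grow with the index, so two of them cannot each
  have a point outside the other. In a 3+1 with chain a, b, c, the fourth point e is not below c,
  hence b < e as positions; but a lies in the down-set of b and not in that of e.\<close>

lemma semiorder_free: "\<not> has_2_plus_2 (semiorder d)" "\<not> has_3_plus_1 (semiorder d)"
proof -
  show "\<not> has_2_plus_2 (semiorder d)"
  proof
    assume "has_2_plus_2 (semiorder d)"
    then obtain a b c e where h: "b < n" "a < d ! b" "e < n" "c < d ! e" "(a, e) \<notin> semiorder d" "(c, b) \<notin> semiorder d"
      unfolding has_2_plus_2_def semiorder_strict by blast
    moreover have "a < n" "c < n"
      using h semiorder_codeD(3)[of b] semiorder_codeD(3)[of e] by simp_all
    ultimately have "\<not> a < d ! e" "\<not> c < d ! b"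
      by (auto simp: semiorder_mem)
    then show False
      using h(1-4) semiorder_codeD(4)[of b e] semiorder_codeD(4)[of e b] by linarith
  qed
  show "\<not> has_3_plus_1 (semiorder d)"
  proof
    assume "has_3_plus_1 (semiorder d)"
    then obtain a b c e where h: "e < n" "b < n" "a < d ! b" "c < n" "b < d ! c" "(a, e) \<notin> semiorder d" "(e, c) \<notin> semiorder d"
      unfolding has_3_plus_1_def semiorder_strict Field_semiorder by blast
    moreover have "a < n"
      using h semiorder_codeD(3)[of b] by simp
    ultimately have "\<not> a < d ! e" "\<not> e < d ! c"
      by (auto simp: semiorder_mem)
    then show False
      using h(1-5) semiorder_codeD(4)[of b e] by linarith
  qed
qed

lemma min_count_semiorder: "min_count (semiorder d) = zeros d"
proof -
  have "(\<forall>y. (y, x) \<in> semiorder d \<longrightarrow> y = x) \<longleftrightarrow> d ! x = 0" if "x < n" for x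
  proof
    assume min: "\<forall>y. (y, x) \<in> semiorder d \<longrightarrow> y = x"
    show "d ! x = 0"
    proof (rule ccontr)
      assume "d ! x \<noteq> 0"
      then have "(0, x) \<in> semiorder d" "0 < x"
        using that semiorder_codeD(3)[of x] by (auto simp: semiorder_mem)
      then show False
        using min by auto
    qed
  qed (auto simp: semiorder_mem)
  then have "{x \<in> Field (semiorder d). \<forall>y. (y, x) \<in> semiorder d \<longrightarrow> y = x} = {j. j < length d \<and> d ! j = 0}"
    by (auto simp: Field_semiorder semiorder_codeD)
  then show ?thesis
    by (simp add: min_count_def zeros_def)
qed

lemma ssd_semiorder: "ssd (semiorder d) = fixed_points d"
proof -
  have "cuts (semiorder d) = lessThan ` {k. k < n \<and> d ! k = k}"
  proof (intro equalityI subsetI)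
    fix A assume "A \<in> cuts (semiorder d)"
    then have A: "A \<subset> {..<n}" "\<And>a b. a \<in> A \<Longrightarrow> b < n \<Longrightarrow> b \<notin> A \<Longrightarrow> a < d ! b"
      by (auto simp: cuts_def Field_semiorder semiorder_mem subset_iff)
    have "finite A"
      using A(1) finite_subset by blast
    then have seg: "A = {..<card A}"
    proof (rule initial_segment_eq)
      \<comment> \<open>A position j < i outside A would have i in its down-set, although that
        down-set has only positions below j.\<close>
      fix i j assume ij: "i \<in> A" "j < i"
      show "j \<in> A"
      proof (rule ccontr)
        assume "j \<notin> A"
        moreover have "j < n"
          using ij A(1) by auto
        ultimately show False
          using A(2)[of i j] ij semiorder_codeD(3)[of j] by simp
      qed
    qed
    have "card A < n"
      using psubset_card_mono[OF _ A(1)] by simp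
    moreover have "card A \<notin> A"
      by (subst seg) simp
    then have "a < d ! card A" if "a < card A" for a
      using A(2)[of a "card A"] \<open>card A < n\<close> seg that by blast
    then have "card A \<le> d ! card A"
      by (meson leI less_irrefl)
    ultimately show "A \<in> lessThan ` {k. k < n \<and> d ! k = k}"
      using seg semiorder_codeD(3)[of "card A"] by (intro image_eqI[of _ _ "card A"]) auto
  next
    fix A assume "A \<in> lessThan ` {k. k < n \<and> d ! k = k}"
    then obtain k where k: "A = {..<k}" "k < n" "d ! k = k"
      by blast
    have "(a, b) \<in> semiorder d" if "a < k" "k \<le> b" "b < n" for a b
      using that k semiorder_codeD(4)[of k b] by (auto simp: semiorder_mem)
    then show "A \<in> cuts (semiorder d)"
      unfolding cuts_def Field_semiorder using k by auto
  qed
  moreover have "inj_on lessThan {k. k < n \<and> d ! k = k}"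
    by (auto simp: inj_on_def)
  ultimately have "card (cuts (semiorder d)) = fixed_points d"
    by (simp add: card_image fixed_points_def semiorder_codeD)
  then show ?thesis
    using ssd_eq_card_cuts[OF Partial_order_semiorder] by (simp add: Field_semiorder)
qed

end

section \<open>Down-sets and up-sets in interval orders\<close>

definition down :: "'a rel \<Rightarrow> 'a \<Rightarrow> 'a set" where
  "down r x = {y. (y, x) \<in> strict r}"

definition up :: "'a rel \<Rightarrow> 'a \<Rightarrow> 'a set" where
  "up r x = {y. (x, y) \<in> strict r}"

lemma down_subset_Field: "down r x \<subseteq> Field r" and up_subset_Field: "up r x \<subseteq> Field r"
  by (auto simp: down_def up_def strict_iff intro: FieldI1 FieldI2)

lemma iso_down:
  assumes "inj_on f (Field r)" "Field s = f ` Field r"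
    "\<And>x y. x \<in> Field r \<Longrightarrow> y \<in> Field r \<Longrightarrow> (f x, f y) \<in> s \<longleftrightarrow> (x, y) \<in> r"
    and x: "x \<in> Field r"
  shows "card (down s (f x)) = card (down r x)" "card (up s (f x)) = card (up r x)"
proof -
  have st: "(f y, f z) \<in> strict s \<longleftrightarrow> (y, z) \<in> strict r" if "y \<in> Field r" "z \<in> Field r" for y z
    using assms(1,3) that by (simp add: strict_iff inj_on_eq_iff)
  have "down s (f x) = f ` down r x"
    using st[OF _ x] down_subset_Field[of s "f x"] down_subset_Field[of r x] assms(2) by (auto simp: down_def)
  then show "card (down s (f x)) = card (down r x)"
    using card_image inj_on_subset[OF assms(1) down_subset_Field] by metis
  have "up s (f x) = f ` up r x"
    using st[OF x] up_subset_Field[of s "f x"] up_subset_Field[of r x] assms(2) by (auto simp: up_def)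
  then show "card (up s (f x)) = card (up r x)"
    using card_image inj_on_subset[OF assms(1) up_subset_Field] by metis
qed

lemma card_down_semiorder:
  assumes "d \<in> semiorder_codes n" "j < n"
  shows "card (down (semiorder d) j) = d ! j"
proof -
  have "down (semiorder d) j = {..<d ! j}"
    using assms by (auto simp: down_def semiorder_strict[OF assms(1)])
  then show ?thesis
    by simp
qed

text \<open>An isomorphism preserves the sizes of down-sets, so the two codes agree as multisets;
  being sorted, they are equal.\<close>

lemma semiorder_inj:
  assumes d: "d \<in> semiorder_codes n" and e: "e \<in> semiorder_codes n" and iso: "poset_iso (semiorder d) (semiorder e)"
  shows "d = e"
proof -
  obtain f where f: "inj_on f (Field (semiorder d))" "Field (semiorder e) = f ` Field (semiorder d)"
      "\<And>x y. x \<in> Field (semiorder d) \<Longrightarrow> y \<in> Field (semiorder d) \<Longrightarrow> (f x, f y) \<in> semiorder e \<longleftrightarrow> (x, y) \<in> semiorder d"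
    using poset_isoE[OF iso] by blast
  have im: "inj_on f {..<n}" "{..<n} = f ` {..<n}"
    using f(1,2) unfolding Field_semiorder[OF d] Field_semiorder[OF e] by simp_all
  have nth: "e ! f j = d ! j" if "j < n" for j
  proof -
    have "f j < n"
      using im(2) that by blast
    then show ?thesis
      using iso_down(1)[OF f, of j] that card_down_semiorder[OF d] card_down_semiorder[OF e]
      by (simp add: Field_semiorder[OF d])
  qed
  have mset: "mset xs = image_mset ((!) xs) (mset_set {..<length xs})" for xs :: "nat list"
    by (metis atLeast0LessThan map_nth mset_map mset_upt)
  have "mset e = image_mset ((!) e) (mset_set (f ` {..<n}))"
    using mset[of e] im(2) semiorder_codeD(1)[OF e] by simp
  also have "\<dots> = image_mset ((!) e \<circ> f) (mset_set {..<n})"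
    using image_mset_mset_set[OF im(1)] by (simp flip: multiset.map_comp)
  also have "\<dots> = image_mset ((!) d) (mset_set {..<n})"
    using nth by (intro image_mset_cong) auto
  also have "\<dots> = mset d"
    using mset[of d] semiorder_codeD(1)[OF d] by simp
  finally have "sort d = e"
    using semiorder_codeD(2)[OF e] by (rule properties_for_sort)
  moreover have "sort d = d"
    using refl semiorder_codeD(2)[OF d] by (rule properties_for_sort)
  ultimately show ?thesis
    by simp
qed

text \<open>If neither down-set contains the other, the witnesses a below x and c below y form a 2+2
  together with x and y. The dual holds for up-sets.\<close>

lemma interval_order_down_chain:
  assumes "Partial_order r" "\<not> has_2_plus_2 r"
  shows "down r x \<subseteq> down r y \<or> down r y \<subseteq> down r x"
proof (rule ccontr)
  assume "\<not> ?thesis"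
  then obtain a c where ac: "(a, x) \<in> strict r" "(a, y) \<notin> strict r" "(c, y) \<in> strict r" "(c, x) \<notin> strict r"
    unfolding down_def by blast
  \<comment> \<open>Failing to be strictly below may also mean equality; a = y would put c below x,
    and c = x would put a below y.\<close>
  then have "a \<noteq> y" "c \<noteq> x"
    using Partial_orderD(1,2)[OF assms(1)] unfolding strict_iff by metis+
  then have "(a, y) \<notin> r" "(c, x) \<notin> r"
    using ac unfolding strict_iff by blast+
  then show False
    using assms(2) ac unfolding has_2_plus_2_def by blast
qed

lemma interval_order_up_chain:
  assumes "Partial_order r" "\<not> has_2_plus_2 r"
  shows "up r x \<subseteq> up r y \<or> up r y \<subseteq> up r x"
proof (rule ccontr)
  assume "\<not> ?thesis"
  then obtain a c where ac: "(x, a) \<in> strict r" "(y, a) \<notin> strict r" "(y, c) \<in> strict r" "(x, c) \<notin> strict r"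
    unfolding up_def by blast
  then have "a \<noteq> y" "c \<noteq> x"
    using Partial_orderD(1,2)[OF assms(1)] unfolding strict_iff by metis+
  then have "(y, a) \<notin> r" "(x, c) \<notin> r"
    using ac unfolding strict_iff by blast+
  then show False
    using assms(2) ac unfolding has_2_plus_2_def by blast
qed

lemma strict_trans:
  assumes "Partial_order r" "(x, y) \<in> strict r" "(y, z) \<in> strict r"
  shows "(x, z) \<in> strict r"
  using Partial_orderD(1)[OF assms(1), of x y z] Partial_orderD(2)[OF assms(1), of x y] assms(2,3)
  unfolding strict_iff by auto

text \<open>Otherwise the chain a, y, c and the point x form a 3+1. Consequently, if the down-set of
  y is not contained in that of x, then the up-set of y is contained in that of x: ordering by
  down-sets and by up-sets never conflicts.\<close>

lemma semiorder_down_up: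
  assumes "Partial_order r" "\<not> has_3_plus_1 r" "x \<in> Field r"
    and "(a, y) \<in> strict r" "(a, x) \<notin> strict r" "(y, c) \<in> strict r"
  shows "(x, c) \<in> strict r"
proof (rule ccontr)
  assume xc: "(x, c) \<notin> strict r"
  have "a \<noteq> x" "c \<noteq> x"
    using strict_trans[OF assms(1)] assms xc by metis+
  then have "(a, x) \<notin> r" "(x, c) \<notin> r"
    using assms xc unfolding strict_iff by blast+
  then show False
    using assms(2,3,4,6) unfolding has_3_plus_1_def by blast
qed

text \<open>The key \<open>h\<close> grows with the down-set and shrinks with the up-set. Since the
  two never conflict, \<open>h x \<le> h y\<close> forces both inclusions; sorted by
  \<open>h\<close>, the points have initial segments as down-sets, and the sizes of these form the
  code.\<close>

lemma semiorder_code_ex: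
  fixes r :: "nat rel"
  assumes po: "Partial_order r" and fin: "finite (Field r)" and n: "card (Field r) = n"
    and free: "\<not> has_2_plus_2 r" "\<not> has_3_plus_1 r"
  shows "\<exists>d\<in>semiorder_codes n. poset_iso (semiorder d) r"
proof -
  define h where "h x = card (down r x) + (n - card (up r x))" for x
  have fin_du: "finite (down r x)" "finite (up r x)" "card (up r x) \<le> n" for x
    using finite_subset[OF down_subset_Field fin] finite_subset[OF up_subset_Field fin]
      card_mono[OF fin up_subset_Field] n by auto
  have down_up: "down r x \<subseteq> down r y \<and> up r y \<subseteq> up r x" if xy: "x \<in> Field r" "y \<in> Field r" "h x \<le> h y" for x y
  proof (rule ccontr)
    assume "\<not> ?thesis"
    then consider "\<not> down r x \<subseteq> down r y" | "\<not> up r y \<subseteq> up r x"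
      by blast
    then have "down r y \<subseteq> down r x \<and> up r x \<subseteq> up r y \<and> (down r y \<subset> down r x \<or> up r x \<subset> up r y)"
    proof cases
      case 1
      then obtain a where a: "(a, x) \<in> strict r" "(a, y) \<notin> strict r"
        by (auto simp: down_def)
      then have "up r x \<subseteq> up r y"
        using semiorder_down_up[OF po free(2) xy(2) a] by (auto simp: up_def)
      then show ?thesis
        using 1 interval_order_down_chain[OF po free(1), of x y] by blast
    next
      case 2
      then obtain c where c: "(y, c) \<in> strict r" "(x, c) \<notin> strict r"
        by (auto simp: up_def)
      then have "down r y \<subseteq> down r x"
        using semiorder_down_up[OF po free(2) xy(1) _ _ c(1)] by (auto simp: down_def)
      then show ?thesis
        using 2 interval_order_up_chain[OF po free(1), of x y] by blast
    qed
    then have "card (down r y) \<le> card (down r x)" "card (up r x) \<le> card (up r y)"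
        "card (down r y) < card (down r x) \<or> card (up r x) < card (up r y)"
      using fin_du by (auto intro: card_mono psubset_card_mono)
    then show False
      using xy(3) fin_du(3)[of x] fin_du(3)[of y] unfolding h_def by linarith
  qed
  have h_less: "h x < h y" if "(x, y) \<in> strict r" for x y
  proof -
    have "down r x \<subset> down r y" "up r y \<subset> up r x"
      using that strict_trans[OF po] unfolding down_def up_def strict_iff by blast+
    then have "card (down r x) < card (down r y)" "card (up r y) < card (up r x)"
      using fin_du by (auto intro: psubset_card_mono)
    then show ?thesis
      using fin_du(3)[of x] by (simp add: h_def)
  qed
  define xs where "xs = sort_key h (sorted_list_of_set (Field r))"
  have xs: "set xs = Field r" "distinct xs" "sorted (map h xs)"
    using fin by (simp_all add: xs_def)
  then have len: "length xs = n"
    using distinct_card n by fastforce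
  have xs_Field: "xs ! i \<in> Field r" if "i < n" for i
    using that xs(1) len nth_mem by blast
  have h_mono: "h (xs ! i) \<le> h (xs ! j)" if "i \<le> j" "j < n" for i j
    using sorted_nth_mono[OF xs(3), of i j] that len by simp
  define d where "d = map (\<lambda>x. card (down r x)) xs"
  have d_nth: "d ! i = card (down r (xs ! i))" if "i < n" for i
    using that len by (simp add: d_def)
  have seg: "{i. i < n \<and> (xs ! i, xs ! j) \<in> strict r} = {..<d ! j}" if j: "j < n" for j
  proof -
    let ?I = "{i. i < n \<and> (xs ! i, xs ! j) \<in> strict r}"
    have I: "?I = {..<card ?I}"
    proof (rule initial_segment_eq)
      fix i k assume i: "i \<in> ?I" "k < i"
      then have "up r (xs ! i) \<subseteq> up r (xs ! k)"
        using down_up[of "xs ! k" "xs ! i"] xs_Field h_mono[of k i] by simp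
      then show "k \<in> ?I"
        using i by (auto simp: up_def)
    qed simp
    have im: "(!) xs ` ?I = down r (xs ! j)"
    proof (intro equalityI subsetI)
      fix x assume x: "x \<in> down r (xs ! j)"
      have "x \<in> Field r"
        using x by (rule subsetD[OF down_subset_Field])
      then have "x \<in> set xs"
        by (simp only: xs(1))
      then obtain i where "i < n" "x = xs ! i"
        unfolding in_set_conv_nth len by blast
      then show "x \<in> (!) xs ` ?I"
        using x unfolding down_def by blast
    next
      fix x assume "x \<in> (!) xs ` ?I"
      then show "x \<in> down r (xs ! j)"
        unfolding down_def by blast
    qed
    have "inj_on ((!) xs) ?I"
      using xs(2) len by (intro inj_onI) (simp add: nth_eq_iff_index_eq)
    then have "card ?I = d ! j"
      unfolding d_nth[OF j] im[symmetric] by (rule card_image[symmetric])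
    then show ?thesis
      using I by (simp only:)
  qed
  have "d \<in> semiorder_codes n"
  proof -
    have "d ! i \<le> i" if "i < n" for i
    proof -
      have "j < i" if "j < d ! i" for j
      proof (rule ccontr)
        assume "\<not> j < i"
        moreover have "j < n" "(xs ! j, xs ! i) \<in> strict r"
          using that seg[OF \<open>i < n\<close>] by blast+
        ultimately show False
          using h_less h_mono[of i j] by fastforce
      qed
      then show ?thesis
        by (meson leI less_irrefl)
    qed
    moreover have "sorted d"
    proof (rule sorted_wrt_iff_nth_less[THEN iffD2], intro allI impI)
      fix i j assume "i < j" "j < length d"
      then have ij: "i < n" "j < n" "i \<le> j"
        by (simp_all add: d_def len)
      then have "down r (xs ! i) \<subseteq> down r (xs ! j)"
        using down_up xs_Field h_mono by blast
      then show "d ! i \<le> d ! j"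
        using ij d_nth fin_du(1) by (simp add: card_mono)
    qed
    ultimately show ?thesis
      by (simp add: semiorder_codes_def d_def len)
  qed
  moreover have "poset_iso (semiorder d) r"
  proof (rule poset_isoI[of "(!) xs"])
    note F = Field_semiorder[OF \<open>d \<in> semiorder_codes n\<close>]
    show "inj_on ((!) xs) (Field (semiorder d))"
      unfolding F using xs(2) len by (intro inj_onI) (simp add: nth_eq_iff_index_eq)
    show "Field r = (!) xs ` Field (semiorder d)"
      unfolding F using xs(1) len by (auto simp: set_conv_nth)
    fix i j assume "i \<in> Field (semiorder d)" "j \<in> Field (semiorder d)"
    then have ij: "i < n" "j < n"
      by (simp_all add: F)
    have "(xs ! i, xs ! j) \<in> r \<longleftrightarrow> i = j \<or> (xs ! i, xs ! j) \<in> strict r"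
      using Partial_orderD(3)[OF po xs_Field[OF ij(1)]] ij xs(2) len by (auto simp: strict_iff nth_eq_iff_index_eq)
    also have "(xs ! i, xs ! j) \<in> strict r \<longleftrightarrow> i < d ! j"
      using seg[OF ij(2)] ij(1) by blast
    also have "i = j \<or> i < d ! j \<longleftrightarrow> (i, j) \<in> semiorder d"
      using ij by (simp add: semiorder_mem[OF \<open>d \<in> semiorder_codes n\<close>])
    finally show "(xs ! i, xs ! j) \<in> r \<longleftrightarrow> (i, j) \<in> semiorder d" .
  qed
  ultimately show ?thesis
    by blast
qed

section \<open>Growth of semiorder codes\<close>

lemma semiorder_codes_Suc_iff:
  "w \<in> semiorder_codes (Suc n) \<longleftrightarrow> (\<exists>v. w = 0 # v \<and> length v = n \<and> sorted v \<and> (\<forall>j<n. v ! j \<le> Suc j))"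
  by (cases w) (auto simp: semiorder_codes_def All_less_Suc2)

lemma card_shift_positions:
  "card {j. j < Suc n \<and> P j} = (if P 0 then 1 else 0) + card {j. j < n \<and> P (Suc j)}"
proof -
  have "{j. j < Suc n \<and> P j} = (if P 0 then {0} else {}) \<union> Suc ` {j. j < n \<and> P (Suc j)}"
    by (auto simp: less_Suc_eq_0_disj)
  moreover have "card (Suc ` {j. j < n \<and> P (Suc j)}) = card {j. j < n \<and> P (Suc j)}"
    by (rule card_image) simp
  ultimately show ?thesis
    by (simp add: card_insert_if image_iff)
qed

lemma zeros_Cons: "zeros (0 # v) = Suc (zeros v)"
  using card_shift_positions[of "length v" "\<lambda>j. (0 # v) ! j = 0"] by (simp add: zeros_def)

text \<open>The parent deletes the first element, which is minimal, and so lowers the sizes of the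
  other nonempty down-sets by one; truncated subtraction leaves the entry 0 alone. Hence a code is
  recovered from its parent once it is known how many of the parent's zeros were zeros before. If
  none were, the deleted element takes its fixed point with it; otherwise the entry that moves to
  position 0 is a fixed point in its place.\<close>

lemma generating_tree_semiorder_codes:
  "generating_tree semiorder_codes fixed_points zeros (\<lambda>w. map (\<lambda>x. x - 1) (tl w)) []"
proof unfold_locales
  fix n p assume p: "p \<in> semiorder_codes n"
  let ?W = "{w \<in> semiorder_codes (Suc n). map (\<lambda>x. x - 1) (tl w) = p}"
  have W: "\<exists>v. w = 0 # v \<and> length v = n \<and> sorted v \<and> (\<forall>j<n. v ! j \<le> Suc j) \<and> map (\<lambda>x. x - 1) v = p"
    if "w \<in> ?W" for w
    using that semiorder_codes_Suc_iff[of w n] by auto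
  have p_nth: "p ! j = v ! j - 1" if "map (\<lambda>x. x - 1) v = p" "j < n" for v j
    using that semiorder_codeD(1)[OF p] by (metis length_map nth_map)
  have "inj_on zeros ?W"
  proof (rule inj_onI)
    fix w w' assume ww': "w \<in> ?W" "w' \<in> ?W" "zeros w = zeros w'"
    obtain v where v: "w = 0 # v" "length v = n" "sorted v" "map (\<lambda>x. x - 1) v = p"
      using W[OF ww'(1)] by blast
    obtain v' where v': "w' = 0 # v'" "length v' = n" "sorted v'" "map (\<lambda>x. x - 1) v' = p"
      using W[OF ww'(2)] by blast
    have "v ! j = v' ! j" if j: "j < n" for j
    proof -
      have "v ! j = 0 \<longleftrightarrow> v' ! j = 0"
        using zero_iff_less_zeros[OF v(3), of j] zero_iff_less_zeros[OF v'(3), of j] j v(2) v'(2) ww'(3)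
        by (simp add: v(1) v'(1) zeros_Cons)
      then show ?thesis
        using p_nth[OF v(4) j] p_nth[OF v'(4) j] by linarith
    qed
    then have "v = v'"
      using v(2) v'(2) by (simp add: list_eq_iff_nth_eq)
    then show "w = w'"
      using v(1) v'(1) by simp
  qed
  moreover have "zeros w \<in> {1..Suc (zeros p)}" if w: "w \<in> ?W" for w
  proof -
    obtain v where v: "w = 0 # v" "length v = n" "map (\<lambda>x. x - 1) v = p"
      using W[OF w] by blast
    have "zeros v \<le> zeros p"
      unfolding zeros_def using v(2) semiorder_codeD(1)[OF p] p_nth[OF v(3)] by (intro card_mono) auto
    then show ?thesis
      by (simp add: v(1) zeros_Cons)
  qed
  moreover have "k \<in> zeros ` ?W" if k: "k \<in> {1..Suc (zeros p)}" for k
  proof -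
    define h where "h = k - 1"
    have h: "h \<le> zeros p" "k = Suc h" "h \<le> n"
      using k zeros_le_length[of p] semiorder_codeD(1)[OF p] by (auto simp: h_def)
    \<comment> \<open>The first h entries of p are zeros and stay so; all others are raised back by
      one.\<close>
    define v where "v = replicate h 0 @ map Suc (drop h p)"
    have len: "length v = n"
      using h semiorder_codeD(1)[OF p] by (simp add: v_def)
    have v_nth: "v ! j = (if j < h then 0 else Suc (p ! j))" if "j < n" for j
      using that h semiorder_codeD(1)[OF p] by (simp add: v_def nth_append)
    have p_zero: "p ! j = 0" if "j < h" for j
      using zero_iff_less_zeros[OF semiorder_codeD(2)[OF p], of j] that h semiorder_codeD(1)[OF p] by simp
    have "sorted v"
      unfolding v_def using semiorder_codeD(2)[OF p]
      by (auto simp: sorted_append sorted_map sorted_wrt_drop)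
    moreover have "v ! j \<le> Suc j" if "j < n" for j
      using v_nth[OF that] semiorder_codeD(3)[OF p that] by simp
    moreover have "map (\<lambda>x. x - 1) v = p"
      using len semiorder_codeD(1)[OF p] by (intro nth_equalityI) (auto simp: v_nth p_zero)
    ultimately have "0 # v \<in> ?W"
      using len by (simp add: semiorder_codes_Suc_iff)
    moreover have "{j. j < length v \<and> v ! j = 0} = {..<h}"
      using v_nth len h(3) by (auto split: if_splits)
    then have "zeros (0 # v) = k"
      by (simp add: zeros_Cons h(2)) (simp add: zeros_def)
    ultimately show ?thesis
      by blast
  qed
  ultimately show "bij_betw zeros ?W {1..Suc (zeros p)}"
    unfolding bij_betw_def by blast
next
  fix n w assume "w \<in> semiorder_codes (Suc n)"
  then obtain v where v: "w = 0 # v" "length v = n" "sorted v" "\<forall>j<n. v ! j \<le> Suc j"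
    by (auto simp: semiorder_codes_Suc_iff)
  let ?p = "map (\<lambda>x. x - 1) v"
  have "sorted ?p"
    using v(3) by (auto simp: sorted_map intro: sorted_wrt_mono_rel[of v "(\<le>)"])
  then show "map (\<lambda>x. x - 1) (tl w) \<in> semiorder_codes n"
    using v by (auto simp: semiorder_codes_def le_diff_conv)
  have w: "fixed_points w = Suc (card {j. j < n \<and> v ! j = Suc j})"
    using card_shift_positions[of n "\<lambda>j. w ! j = j"] by (simp add: fixed_points_def v)
  have zw: "zeros w = Suc (zeros v)" "tl w = v"
    by (simp_all add: v(1) zeros_Cons)
  show "fixed_points w = (if zeros w = 1 then Suc (fixed_points (map (\<lambda>x. x - 1) (tl w))) else fixed_points (map (\<lambda>x. x - 1) (tl w)))"
  proof (cases "zeros v = 0")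
    case True
    then have nz: "v ! j \<noteq> 0" if "j < n" for j
      using zero_iff_less_zeros[OF v(3)] that v(2) by simp
    have "?p ! j = j \<longleftrightarrow> v ! j = Suc j" if "j < n" for j
      using nz[OF that] that v(2) by (cases "v ! j") auto
    then have "{j. j < length ?p \<and> ?p ! j = j} = {j. j < n \<and> v ! j = Suc j}"
      using v(2) by auto
    then have "fixed_points ?p = card {j. j < n \<and> v ! j = Suc j}"
      by (simp only: fixed_points_def)
    then show ?thesis
      using True w by (simp only: zw) simp
  next
    case False
    then have n: "0 < n"
      using zeros_le_length[of v] v(2) by simp
    have "v ! 0 = 0"
      using zero_iff_less_zeros[OF v(3), of 0] False v(2) n by simp
    have "{j. j < length ?p \<and> ?p ! j = j} = insert 0 {j. j < n \<and> v ! j = Suc j}"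
    proof -
      have "?p ! j = j \<longleftrightarrow> j = 0 \<or> v ! j = Suc j" if "j < n" for j
        using that v(2) \<open>v ! 0 = 0\<close> by (cases "j = 0") auto
      then show ?thesis
        using v(2) n \<open>v ! 0 = 0\<close> by auto
    qed
    moreover have "0 \<notin> {j. j < n \<and> v ! j = Suc j}"
      using \<open>v ! 0 = 0\<close> by simp
    ultimately have "fixed_points ?p = fixed_points w"
      by (simp only: w) (simp add: fixed_points_def)
    then show ?thesis
      using False by (simp only: zw) simp
  qed
qed (auto simp: semiorder_codes_def fixed_points_def zeros_def)

lemma equidist_posets_3_plus_1:
  "equidist (trees n) left_spine right_spine (posets_avoiding poset_3_plus_1 n) (class_stat min_count) (class_stat ssd)"
proof (rule equidist_trans)
  show "equidist (trees n) left_spine right_spine (semiorder_codes n) zeros fixed_points"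
    using generating_tree_equidist_swap[OF generating_tree_semiorder_codes] .
  show "equidist (semiorder_codes n) zeros fixed_points (posets_avoiding poset_3_plus_1 n) (class_stat min_count) (class_stat ssd)"
  proof (rule equidist_posets_avoiding[of _ semiorder])
    fix d assume d: "d \<in> semiorder_codes n"
    show "Partial_order (semiorder d) \<and> finite (Field (semiorder d)) \<and> card (Field (semiorder d)) = n"
      using Partial_order_semiorder[OF d] by (simp add: Field_semiorder[OF d])
    show "\<not> has_2_plus_2 (semiorder d)"
      using semiorder_free(1)[OF d] .
    fix r :: "nat rel" assume iso: "poset_iso (semiorder d) r"
    show "\<not> poset_contains r poset_3_plus_1"
      using poset_iso_not_contains(1)[OF iso Partial_order_semiorder[OF d] semiorder_free(2)[OF d]] .
    show "min_count r = zeros d \<and> ssd r = fixed_points d"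
      using poset_iso_min_count[OF iso] poset_iso_ssd[OF iso Partial_order_semiorder[OF d]]
        min_count_semiorder[OF d] ssd_semiorder[OF d] Field_semiorder[OF d] by simp
  next
    fix r assume r: "partial_order_on {1..n} r" "\<not> has_2_plus_2 r" "\<not> poset_contains r poset_3_plus_1"
    have "Field r = {1..n}" "Partial_order r"
      using Field_partial_order_on[OF r(1)] Partial_order_if_partial_order_on[OF r(1)] by simp_all
    then show "\<exists>d\<in>semiorder_codes n. poset_iso (semiorder d) r"
      using semiorder_code_ex[of r n] r(2,3) has_3_plus_1_iff[of r] by simp
  qed (rule semiorder_inj)
qed

section \<open>Interval orders without N\<close>

lemma Chains_subset_Pow: "Chains r \<subseteq> Pow (Field r)"
  by (rule subsetI, rule PowI, rule Chains_subset_Field)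

lemma maximal_chains_subset: "maximal_chains r \<subseteq> Chains r"
  by (simp add: maximal_chains_def)

definition isolated_sum :: "'a \<Rightarrow> 'a rel \<Rightarrow> 'a rel \<Rightarrow> 'a rel" where
  "isolated_sum x p q = ordinal_sum (insert (x, x) p) q"

lemma Field_insert_refl: "Field (insert (x, x) p) = insert x (Field p)"
  by (auto simp: Field_def)

lemma isolated_sum_iff:
  "(u, v) \<in> isolated_sum x p q \<longleftrightarrow>
     u = x \<and> v = x \<or> (u, v) \<in> p \<or> (u, v) \<in> q \<or> u \<in> insert x (Field p) \<and> v \<in> Field q"
  by (auto simp: isolated_sum_def ordinal_sum_def Field_insert_refl)

lemma Field_isolated_sum: "Field (isolated_sum x p q) = insert x (Field p) \<union> Field q"
  by (simp add: isolated_sum_def Field_ordinal_sum Field_insert_refl)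

locale isolated_summands =
  fixes x :: 'a and p q :: "'a rel"
  assumes x_p: "x \<notin> Field p" and x_q: "x \<notin> Field q" and p_q: "Field p \<inter> Field q = {}"
begin

lemma x_mem: "(x, u) \<notin> p" "(u, x) \<notin> p" "(x, u) \<notin> q" "(u, x) \<notin> q"
  using x_p x_q FieldI1 FieldI2 by metis+

lemma mem_p: "u \<in> Field p \<Longrightarrow> v \<in> Field p \<Longrightarrow> (u, v) \<in> isolated_sum x p q \<longleftrightarrow> (u, v) \<in> p"
  using x_p p_q FieldI1[of u v q] by (auto simp: isolated_sum_iff)

lemma mem_q: "u \<in> Field q \<Longrightarrow> v \<in> Field q \<Longrightarrow> (u, v) \<in> isolated_sum x p q \<longleftrightarrow> (u, v) \<in> q"
  using x_q p_q FieldI1[of u v p] by (auto simp: isolated_sum_iff)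

lemma mem_up: "u \<in> insert x (Field p) \<Longrightarrow> v \<in> Field q \<Longrightarrow> (u, v) \<in> isolated_sum x p q"
  by (simp add: isolated_sum_iff)

lemma mem_down: "u \<in> Field q \<Longrightarrow> v \<in> insert x (Field p) \<Longrightarrow> (u, v) \<notin> isolated_sum x p q"
  using x_p x_q p_q x_mem[of u] FieldI1[of u v p] FieldI2[of u v q] by (auto simp: isolated_sum_iff)

lemma x_isolated: "u \<in> insert x (Field p) \<Longrightarrow> (x, u) \<in> isolated_sum x p q \<longleftrightarrow> u = x"
    "u \<in> insert x (Field p) \<Longrightarrow> (u, x) \<in> isolated_sum x p q \<longleftrightarrow> u = x"
  using x_q p_q x_mem by (auto simp: isolated_sum_iff)

lemma Partial_order_isolated_sum:
  assumes "Partial_order p" "Partial_order q"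
  shows "Partial_order (isolated_sum x p q)"
proof -
  note po = Partial_orderD(1,2)[OF assms(1)] Partial_orderD(1,2)[OF assms(2)]
  have "(u, w) \<in> isolated_sum x p q" if uv: "(u, v) \<in> isolated_sum x p q" "(v, w) \<in> isolated_sum x p q" for u v w
  proof -
    have "u \<in> Field (isolated_sum x p q)" "v \<in> Field (isolated_sum x p q)" "w \<in> Field (isolated_sum x p q)"
      using uv by (auto intro: FieldI1 FieldI2)
    then consider "w \<in> Field q" "u \<in> insert x (Field p)"
      | "w \<in> insert x (Field p)" "v \<in> insert x (Field p)" "u \<in> insert x (Field p)"
      | "w \<in> Field q" "v \<in> Field q" "u \<in> Field q"
      using uv mem_down unfolding Field_isolated_sum by blast
    then show ?thesis
    proof cases
      case 2
      then show ?thesis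
        using uv x_isolated mem_p po(1) x_p by (metis insert_iff)
    next
      case 3
      then show ?thesis
        using uv mem_q po(3) by metis
    qed (rule mem_up)
  qed
  moreover have "u = v" if uv: "(u, v) \<in> isolated_sum x p q" "(v, u) \<in> isolated_sum x p q" for u v
  proof -
    have "u \<in> Field (isolated_sum x p q)" "v \<in> Field (isolated_sum x p q)"
      using uv by (auto intro: FieldI1 FieldI2)
    then consider "v \<in> insert x (Field p)" "u \<in> insert x (Field p)" | "v \<in> Field q" "u \<in> Field q"
      using uv mem_down unfolding Field_isolated_sum by blast
    then show ?thesis
    proof cases
      case 1
      then show ?thesis
        using uv x_isolated mem_p po(2) by (metis insert_iff)
    next
      case 2
      then show ?thesis
        using uv mem_q po(4) by metis
    qed
  qed
  moreover have "(u, u) \<in> isolated_sum x p q" if "u \<in> Field (isolated_sum x p q)" for u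
    using that Partial_orderD(3)[OF assms(1), of u] Partial_orderD(3)[OF assms(2), of u]
    unfolding Field_isolated_sum isolated_sum_iff by blast
  ultimately show ?thesis
    unfolding Partial_order_iff trans_def antisym_def by blast
qed

text \<open>The incomparability graphs of 2+2 and N are connected, so these patterns lie within one summand.\<close>

lemma isolated_sum_free:
  "\<not> has_2_plus_2 p \<Longrightarrow> \<not> has_2_plus_2 q \<Longrightarrow> \<not> has_2_plus_2 (isolated_sum x p q)"
  "\<not> has_N p \<Longrightarrow> \<not> has_N q \<Longrightarrow> \<not> has_N (isolated_sum x p q)"
proof -
  let ?r = "isolated_sum x p q" and ?A = "insert x (Field p)"
  have inF: "u \<in> ?A \<or> u \<in> Field q" "v \<in> ?A \<or> v \<in> Field q" if "(u, v) \<in> strict ?r" for u v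
    using that FieldI1[of u v ?r] FieldI2[of u v ?r] unfolding strict_iff Field_isolated_sum by auto
  have up_closed: "v \<in> Field q" if "(u, v) \<in> strict ?r" "u \<in> Field q" for u v
    using that inF(2)[OF that(1)] mem_down[of u v] unfolding strict_iff by blast
  have not_below: "u \<in> Field q" if "(u, v) \<notin> ?r" "u \<in> ?A \<or> u \<in> Field q" "v \<in> Field q" for u v
    using that mem_up by blast
  have strict_p: "(u, v) \<in> strict p \<and> u \<in> Field p \<and> v \<in> Field p" if "(u, v) \<in> strict ?r" "v \<notin> Field q" for u v
  proof -
    have "u \<in> ?A" "v \<in> ?A" "(u, v) \<in> ?r" "u \<noteq> v"
      using that up_closed[OF that(1)] inF[OF that(1)] unfolding strict_iff by blast+
    moreover from this have "u \<noteq> x" "v \<noteq> x"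
      using x_isolated by blast+
    ultimately show ?thesis
      using mem_p[of u v] unfolding strict_iff by blast
  qed
  have strict_q: "(u, v) \<in> strict q" if "(u, v) \<in> strict ?r" "u \<in> Field q" for u v
    using that up_closed[OF that] mem_q[of u v] unfolding strict_iff by blast
  have notin: "(u, v) \<notin> p" "(u, v) \<notin> q" if "(u, v) \<notin> ?r" for u v
    using that unfolding isolated_sum_iff by blast+
  show "\<not> has_2_plus_2 ?r" if free: "\<not> has_2_plus_2 p" "\<not> has_2_plus_2 q"
  proof
    assume "has_2_plus_2 ?r"
    then obtain a b c d where h: "(a, b) \<in> strict ?r" "(c, d) \<in> strict ?r" "(a, d) \<notin> ?r" "(c, b) \<notin> ?r"
      unfolding has_2_plus_2_def by blast
    show False
    proof (cases "a \<in> Field q")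
      case True
      then have "c \<in> Field q"
        using up_closed[OF h(1)] not_below[OF h(4) inF(1)[OF h(2)]] by blast
      then show False
        using free(2) strict_q[OF h(1) True] strict_q[OF h(2)] notin(2)[OF h(3)] notin(2)[OF h(4)]
        unfolding has_2_plus_2_def by blast
    next
      case False
      then have d: "d \<notin> Field q"
        using not_below[OF h(3) inF(1)[OF h(1)]] by blast
      then have "c \<notin> Field q"
        using up_closed[OF h(2)] by blast
      then have "b \<notin> Field q"
        using not_below[OF h(4) inF(1)[OF h(2)]] by blast
      then show False
        using free(1) strict_p[OF h(1)] strict_p[OF h(2) d] notin(1)[OF h(3)] notin(1)[OF h(4)]
        unfolding has_2_plus_2_def by blast
    qed
  qed
  show "\<not> has_N ?r" if free: "\<not> has_N p" "\<not> has_N q"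
  proof
    assume "has_N ?r"
    then obtain a b c d where h: "(a, c) \<in> strict ?r" "(a, d) \<in> strict ?r" "(b, d) \<in> strict ?r"
        "(b, c) \<notin> ?r" "(c, d) \<notin> ?r" "(a, b) \<notin> ?r"
      unfolding has_N_def by blast
    show False
    proof (cases "a \<in> Field q")
      case True
      then have "b \<in> Field q"
        using up_closed[OF h(1)] not_below[OF h(4) inF(1)[OF h(3)]] by blast
      then have "(a, c) \<in> strict q" "(a, d) \<in> strict q" "(b, d) \<in> strict q" "(b, c) \<notin> q" "(c, d) \<notin> q" "(a, b) \<notin> q"
        using True strict_q h notin(2) by blast+
      then show False
        using free(2) unfolding has_N_def by blast
    next
      case False
      then have "b \<notin> Field q"
        using not_below[OF h(6) inF(1)[OF h(1)]] by blast
      then have c: "c \<notin> Field q"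
        using not_below[OF h(4) inF(1)[OF h(3)]] by blast
      then have d: "d \<notin> Field q"
        using not_below[OF h(5) inF(2)[OF h(1)]] by blast
      have "(a, c) \<in> strict p" "(a, d) \<in> strict p" "(b, d) \<in> strict p" "(b, c) \<notin> p" "(c, d) \<notin> p" "(a, b) \<notin> p"
        using strict_p[OF h(1) c] strict_p[OF h(2) d] strict_p[OF h(3) d] h notin(1) by blast+
      then show False
        using free(1) unfolding has_N_def by blast
    qed
  qed
qed

lemma min_count_isolated_sum:
  assumes "finite (Field p)"
  shows "min_count (isolated_sum x p q) = Suc (min_count p)"
proof -
  let ?r = "isolated_sum x p q"
  have "(\<forall>v. (v, u) \<in> ?r \<longrightarrow> v = u) \<longleftrightarrow> (\<forall>v. (v, u) \<in> p \<longrightarrow> v = u)" if u: "u \<in> Field p" for u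
  proof -
    have "(v, u) \<in> ?r \<longleftrightarrow> (v, u) \<in> p" for v
      using u x_p p_q FieldI2[of v u q] unfolding isolated_sum_iff by blast
    then show ?thesis
      by simp
  qed
  moreover have "v = x" if "(v, x) \<in> ?r" for v
    using that x_mem x_q unfolding isolated_sum_iff by blast
  moreover have "\<not> (\<forall>v. (v, u) \<in> ?r \<longrightarrow> v = u)" if "u \<in> Field q" for u
    using mem_up[of x u] x_q that by blast
  ultimately have "{u \<in> Field ?r. \<forall>v. (v, u) \<in> ?r \<longrightarrow> v = u} = insert x {u \<in> Field p. \<forall>v. (v, u) \<in> p \<longrightarrow> v = u}"
    unfolding Field_isolated_sum by blast
  then show ?thesis
    using assms x_p by (simp add: min_count_def)
qed

text \<open>The lower summand admits only the empty cut: with any other, x would be comparable to a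
  point on the other side of the cut.\<close>

lemma card_cuts_isolated_sum:
  assumes "finite (Field p)" "finite (Field q)"
  shows "card (cuts (isolated_sum x p q)) = Suc (card (cuts q))"
proof -
  let ?p = "insert (x, x) p"
  have "A = {}" if A: "A \<in> cuts ?p" for A
  proof (rule ccontr)
    assume "A \<noteq> {}"
    then obtain a b where ab: "a \<in> A" "b \<in> insert x (Field p)" "b \<notin> A"
      using A unfolding cuts_def Field_insert_refl by blast
    have cut: "(u, v) \<in> ?p" if "u \<in> A" "v \<in> insert x (Field p)" "v \<notin> A" for u v
      using A that unfolding cuts_def Field_insert_refl by blast
    show False
    proof (cases "x \<in> A")
      case True
      then show False
        using cut[OF True ab(2,3)] ab(3) x_mem by blast
    next
      case False
      then show False
        using cut[OF ab(1) _ False] ab(1) x_mem by blast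
    qed
  qed
  moreover have "{} \<in> cuts ?p"
    by (auto simp: cuts_def Field_insert_refl)
  ultimately have "cuts ?p = {{}}"
    by blast
  then show ?thesis
    unfolding isolated_sum_def using assms x_q p_q
    by (subst card_cuts_ordinal_sum) (simp_all add: Field_insert_refl)
qed

text \<open>In the lower summand the point x alone is a maximal chain. So a shortest maximal chain
  of q extends by the single point x; conversely a maximal chain of the sum restricts to a maximal
  chain of q and has at least one point below q.\<close>

lemma smc_isolated_sum:
  assumes fin: "finite (Field p)" "finite (Field q)"
  shows "smc (isolated_sum x p q) = Suc (smc q)"
proof -
  let ?r = "isolated_sum x p q"
  have fin_r: "finite (Field ?r)"
    using fin by (simp add: Field_isolated_sum)
  have fin_mc: "finite (maximal_chains s)" if "finite (Field s)" for s :: "'a rel"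
    by (rule finite_subset[OF subset_trans[OF maximal_chains_subset Chains_subset_Pow]]) (simp add: that)
  have ne: "maximal_chains s \<noteq> {}" if "finite (Field s)" for s :: "'a rel"
  proof -
    have "finite (Chains s)"
      by (rule finite_subset[OF Chains_subset_Pow]) (simp add: that)
    moreover have "{} \<in> Chains s"
      by (simp add: Chains_def)
    ultimately obtain C where "C \<in> Chains s" "\<forall>D\<in>Chains s. C \<subseteq> D \<longrightarrow> C = D"
      using finite_has_maximal[of "Chains s"] by blast
    then have "C \<in> maximal_chains s"
      unfolding maximal_chains_def by blast
    then show ?thesis
      by blast
  qed
  have chain_q: "C \<inter> Field q \<in> Chains q" if "C \<in> Chains ?r" for C
    using that mem_q unfolding Chains_def by blast
  have chain_x: "insert x D \<in> Chains ?r" if D: "D \<in> Chains q" for D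
  proof -
    have "D \<subseteq> Field q"
      using Chains_subset_Field[OF D] .
    then show ?thesis
      using D mem_up[of x] x_isolated(1)[of x] unfolding Chains_def isolated_sum_iff by blast
  qed
  have ext: "insert x D \<in> maximal_chains ?r" if D: "D \<in> maximal_chains q" for D
  proof -
    have Dc: "D \<in> Chains q" and Dm: "\<And>E. E \<in> Chains q \<Longrightarrow> D \<subseteq> E \<Longrightarrow> E = D"
      using D unfolding maximal_chains_def by blast+
    have "E = insert x D" if E: "E \<in> Chains ?r" "insert x D \<subseteq> E" for E
    proof -
      have "E \<inter> Field q = D"
        using Dm[OF chain_q[OF E(1)]] E(2) Chains_subset_Field[OF Dc] by blast
      moreover have "e = x" if "e \<in> E" "e \<in> insert x (Field p)" for e
      proof -
        have "(x, e) \<in> ?r \<or> (e, x) \<in> ?r"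
          using E that(1) unfolding Chains_def by blast
        then show ?thesis
          using x_isolated that(2) by blast
      qed
      moreover have "E \<subseteq> insert x (Field p) \<union> Field q"
        using Chains_subset_Field[OF E(1)] unfolding Field_isolated_sum .
      ultimately show ?thesis
        using E(2) by blast
    qed
    then show ?thesis
      unfolding maximal_chains_def using chain_x[OF Dc] by blast
  qed
  have res: "C \<inter> Field q \<in> maximal_chains q" "Suc (card (C \<inter> Field q)) \<le> card C" if C: "C \<in> maximal_chains ?r" for C
  proof -
    have Cc: "C \<in> Chains ?r" and Cm: "\<And>E. E \<in> Chains ?r \<Longrightarrow> C \<subseteq> E \<Longrightarrow> E = C"
      using C unfolding maximal_chains_def by blast+
    have CF: "C \<subseteq> insert x (Field p) \<union> Field q"
      using Chains_subset_Field[OF Cc] unfolding Field_isolated_sum .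
    have "D = C \<inter> Field q" if D: "D \<in> Chains q" "C \<inter> Field q \<subseteq> D" for D
    proof -
      have DF: "D \<subseteq> Field q"
        using Chains_subset_Field[OF D(1)] .
      have "(a, b) \<in> ?r \<or> (b, a) \<in> ?r" if ab: "a \<in> C \<union> D" "b \<in> C \<union> D" for a b
      proof -
        consider "a \<in> C" "b \<in> C" | "a \<in> D" "b \<in> D" | "a \<in> insert x (Field p)" "b \<in> Field q"
          | "b \<in> insert x (Field p)" "a \<in> Field q"
          using ab CF D(2) DF by blast
        then show ?thesis
        proof cases
          case 1
          then show ?thesis
            using Cc unfolding Chains_def by blast
        next
          case 2
          then have "(a, b) \<in> q \<or> (b, a) \<in> q"
            using D(1) unfolding Chains_def by blast
          then show ?thesis
            unfolding isolated_sum_iff by blast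
        qed (use mem_up in blast)+
      qed
      then have "C \<union> D \<in> Chains ?r"
        unfolding Chains_def by blast
      then have "C \<union> D = C"
        using Cm by blast
      then show ?thesis
        using D(2) DF by blast
    qed
    then show "C \<inter> Field q \<in> maximal_chains q"
      unfolding maximal_chains_def using chain_q[OF Cc] by blast
    \<comment> \<open>A chain inside q could still be extended by x.\<close>
    have "\<not> C \<subseteq> Field q"
    proof
      assume sub: "C \<subseteq> Field q"
      then have "C \<in> Chains q"
        using chain_q[OF Cc] by (simp add: Int_absorb2)
      then have "insert x C = C"
        using Cm[OF chain_x] by blast
      then show False
        using sub x_q by blast
    qed
    then have "C \<inter> Field q \<subset> C"
      by blast
    moreover have "finite C"
      using finite_subset[OF Chains_subset_Field[OF Cc] fin_r] .
    ultimately show "Suc (card (C \<inter> Field q)) \<le> card C"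
      using psubset_card_mono by (metis Suc_leI)
  qed
  show ?thesis
  proof (rule antisym)
    have "smc q \<in> card ` maximal_chains q"
      unfolding smc_alt using fin_mc[OF fin(2)] ne[OF fin(2)] by (intro Min_in) auto
    then obtain D where D: "D \<in> maximal_chains q" "card D = smc q"
      by auto
    have "D \<subseteq> Field q"
      using subsetD[OF maximal_chains_subset D(1)] by (rule Chains_subset_Field)
    then have "card (insert x D) = Suc (smc q)"
      using x_q finite_subset[OF _ fin(2)] D(2) by (subst card_insert_disjoint) auto
    moreover have "smc ?r \<le> card (insert x D)"
      unfolding smc_alt using fin_mc[OF fin_r] ext[OF D(1)] by (intro Min_le) auto
    ultimately show "smc ?r \<le> Suc (smc q)"
      by simp
    have "smc ?r \<in> card ` maximal_chains ?r"
      unfolding smc_alt using fin_mc[OF fin_r] ne[OF fin_r] by (intro Min_in) auto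
    then obtain C where C: "C \<in> maximal_chains ?r" "card C = smc ?r"
      by auto
    have "smc q \<le> card (C \<inter> Field q)"
      unfolding smc_alt using fin_mc[OF fin(2)] res(1)[OF C(1)] by (intro Min_le) auto
    then show "Suc (smc q) \<le> smc ?r"
      using res(2)[OF C(1)] C(2) by simp
  qed
qed

end

lemma isolated_sum_iso:
  assumes "isolated_summands x p q" "isolated_summands x' p' q'" "poset_iso p p'" "poset_iso q q'"
  shows "poset_iso (isolated_sum x p q) (isolated_sum x' p' q')"
proof -
  interpret A: isolated_summands x p q by fact
  interpret B: isolated_summands x' p' q' by fact
  obtain f where f: "inj_on f (Field p)" "Field p' = f ` Field p"
      "\<And>u v. u \<in> Field p \<Longrightarrow> v \<in> Field p \<Longrightarrow> (f u, f v) \<in> p' \<longleftrightarrow> (u, v) \<in> p"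
    using poset_isoE[OF assms(3)] by blast
  obtain g where g: "inj_on g (Field q)" "Field q' = g ` Field q"
      "\<And>u v. u \<in> Field q \<Longrightarrow> v \<in> Field q \<Longrightarrow> (g u, g v) \<in> q' \<longleftrightarrow> (u, v) \<in> q"
    using poset_isoE[OF assms(4)] by blast
  define h where "h u = (if u = x then x' else if u \<in> Field p then f u else g u)" for u
  have hx: "h x = x'"
    by (simp add: h_def)
  have hp: "h u = f u" "h u \<in> Field p'" if "u \<in> Field p" for u
    using that A.x_p f(2) by (auto simp: h_def)
  have hq: "h u = g u" "h u \<in> Field q'" if "u \<in> Field q" for u
    using that A.x_q A.p_q g(2) by (auto simp: h_def)
  have Fim: "h ` Field p = Field p'" "h ` Field q = Field q'"
    using hp hq f(2) g(2) by auto
  show ?thesis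
  proof (rule poset_isoI[of h])
    show "Field (isolated_sum x' p' q') = h ` Field (isolated_sum x p q)"
      unfolding Field_isolated_sum by (simp add: image_Un hx Fim)
    show "inj_on h (Field (isolated_sum x p q))"
    proof (rule inj_onI)
      fix u v assume uv: "u \<in> Field (isolated_sum x p q)" "v \<in> Field (isolated_sum x p q)" "h u = h v"
      then show "u = v"
        using f(1) g(1) B.x_p B.x_q B.p_q hx hp[of u] hp[of v] hq[of u] hq[of v]
        unfolding Field_isolated_sum by (elim UnE insertE) (auto simp: inj_on_eq_iff)
    qed
    fix u v assume "u \<in> Field (isolated_sum x p q)" "v \<in> Field (isolated_sum x p q)"
    then consider "u \<in> Field p" "v \<in> Field p" | "u \<in> Field q" "v \<in> Field q"
      | "u \<in> insert x (Field p)" "v \<in> Field q" | "u \<in> Field q" "v \<in> insert x (Field p)"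
      | "u = x" "v \<in> insert x (Field p)" | "v = x" "u \<in> insert x (Field p)"
      unfolding Field_isolated_sum by blast
    then show "(h u, h v) \<in> isolated_sum x' p' q' \<longleftrightarrow> (u, v) \<in> isolated_sum x p q"
    proof cases
      case 1
      then show ?thesis
        using A.mem_p B.mem_p hp f(3) by simp
    next
      case 2
      then show ?thesis
        using A.mem_q B.mem_q hq g(3) by simp
    next
      case 3
      then have "h u \<in> insert x' (Field p')" "h v \<in> Field q'"
        using hx hp hq by auto
      then show ?thesis
        using 3 A.mem_up B.mem_up by blast
    next
      case 4
      then have "h v \<in> insert x' (Field p')" "h u \<in> Field q'"
        using hx hp hq by auto
      then show ?thesis
        using 4 A.mem_down B.mem_down by blast
    next
      case 5
      then have "h v \<in> insert x' (Field p')" "h v = x' \<longleftrightarrow> v = x"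
        using hx hp[of v] B.x_p by auto
      then show ?thesis
        using 5 A.x_isolated(1)[of v] B.x_isolated(1)[of "h v"] hx by simp
    next
      case 6
      then have "h u \<in> insert x' (Field p')" "h u = x' \<longleftrightarrow> u = x"
        using hx hp[of u] B.x_p by auto
      then show ?thesis
        using 6 A.x_isolated(2)[of u] B.x_isolated(2)[of "h u"] hx by simp
    qed
  qed
qed

text \<open>
  The first summand is recognised inside the sum as its unique nonempty lower part that lies below its
  complement and contains an isolated point.
\<close>

lemma isolated_sum_iso_cancel:
  assumes "isolated_summands x p q" "isolated_summands x' p' q'"
    and po: "Partial_order (isolated_sum x' p' q')"
    and iso: "poset_iso (isolated_sum x p q) (isolated_sum x' p' q')"
  shows "poset_iso p p'" "poset_iso q q'"
proof -
  let ?r = "isolated_sum x p q" and ?s = "isolated_sum x' p' q'"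
  let ?A = "insert x (Field p)" and ?B = "insert x' (Field p')"
  interpret A: isolated_summands x p q by fact
  interpret B: isolated_summands x' p' q' by fact
  obtain f where f: "inj_on f (Field ?r)" "Field ?s = f ` Field ?r"
      "\<And>u v. u \<in> Field ?r \<Longrightarrow> v \<in> Field ?r \<Longrightarrow> (f u, f v) \<in> ?s \<longleftrightarrow> (u, v) \<in> ?r"
    using poset_isoE[OF iso] by blast
  have Fr: "Field ?r = ?A \<union> Field q" and Fs: "Field ?s = ?B \<union> Field q'"
    by (simp_all add: Field_isolated_sum)
  have disj: "?A \<inter> Field q = {}" "?B \<inter> Field q' = {}"
    using A.x_q A.p_q B.x_q B.p_q by auto
  have surj: "\<exists>u\<in>Field ?r. f u = w" if "w \<in> Field ?s" for w
    using that unfolding f(2) by blast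
  have fs: "f u \<in> Field ?s" if "u \<in> Field ?r" for u
    using that f(2) by blast
  have low: "f a \<in> ?B \<longleftrightarrow> a \<in> ?A" if a: "a \<in> Field ?r" for a
  proof (rule ccontr)
    assume ne: "\<not> ?thesis"
    have xr: "x \<in> Field ?r"
      unfolding Fr by blast
    \<comment> \<open>z is the preimage of the isolated point of the target. If some a changed sides
      under f, comparing it with x and z would relate x or x' to another point of its own
      summand.\<close>
    obtain z where z: "z \<in> Field ?r" "f z = x'"
      using surj[of x'] unfolding Fs by blast
    show False
    proof (cases "a \<in> ?A")
      case True
      then have faq: "f a \<in> Field q'"
        using ne fs[OF a] unfolding Fs by blast
      have zA: "z \<in> ?A"
      proof (rule ccontr)
        assume "z \<notin> ?A"
        then have "z \<in> Field q"
          using z(1) unfolding Fr by blast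
        then have "(f a, x') \<in> ?s"
          using A.mem_up[OF True] f(3)[OF a z(1)] z(2) by simp
        then show False
          using B.mem_down[OF faq, of x'] by blast
      qed
      have "f x \<in> ?B"
      proof (rule ccontr)
        assume "f x \<notin> ?B"
        then have "f x \<in> Field q'"
          using fs[OF xr] unfolding Fs by blast
        then have "(z, x) \<in> ?r"
          using B.mem_up[of x' "f x"] f(3)[OF z(1) xr] z(2) by simp
        then have "z = x"
          using A.x_isolated(2)[OF zA] by blast
        then show False
          using z(2) \<open>f x \<notin> ?B\<close> by simp
      qed
      then have "(f x, f a) \<in> ?s"
        using B.mem_up faq by blast
      then have "(x, a) \<in> ?r"
        using f(3)[OF xr a] by simp
      then have "a = x"
        using A.x_isolated(1)[OF True] by simp
      then show False
        using ne True \<open>f x \<in> ?B\<close> by simp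
    next
      case False
      then have aq: "a \<in> Field q" and faB: "f a \<in> ?B"
        using a ne unfolding Fr by blast+
      have "f x \<in> ?B"
      proof (rule ccontr)
        assume "f x \<notin> ?B"
        then have "f x \<in> Field q'"
          using fs[OF xr] unfolding Fs by blast
        then have "(a, x) \<in> ?r"
          using B.mem_up[OF faB] f(3)[OF a xr] by simp
        then show False
          using A.mem_down[OF aq] by blast
      qed
      have "z \<in> ?A"
      proof (rule ccontr)
        assume "z \<notin> ?A"
        then have "z \<in> Field q"
          using z(1) unfolding Fr by blast
        then have "(f x, x') \<in> ?s"
          using A.mem_up[of x z] f(3)[OF xr z(1)] z(2) by simp
        then have "f x = x'"
          using B.x_isolated(2)[OF \<open>f x \<in> ?B\<close>] by simp
        then have "z = x"
          using inj_onD[OF f(1) _ z(1) xr] z(2) by simp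
        then show False
          using \<open>z \<notin> ?A\<close> by simp
      qed
      then have "(x', f a) \<in> ?s"
        using A.mem_up[OF _ aq] f(3)[OF z(1) a] z(2) by simp
      then have "f a = x'"
        using B.x_isolated(1)[OF faB] by simp
      then have "a = z"
        using inj_onD[OF f(1) _ a z(1)] z(2) by simp
      then show False
        using \<open>z \<in> ?A\<close> False by simp
    qed
  qed
  have fA: "f ` ?A = ?B"
  proof (intro equalityI subsetI)
    fix w assume "w \<in> f ` ?A"
    then show "w \<in> ?B"
      using low unfolding Fr by blast
  next
    fix w assume w: "w \<in> ?B"
    then obtain u where u: "u \<in> Field ?r" "f u = w"
      using surj unfolding Fs by blast
    then have "u \<in> ?A"
      using low[OF u(1)] w by blast
    then show "w \<in> f ` ?A"
      using u(2) by blast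
  qed
  have fq: "f ` Field q = Field q'"
  proof (intro equalityI subsetI)
    fix w assume "w \<in> f ` Field q"
    then obtain u where u: "u \<in> Field q" "w = f u"
      by blast
    then have "u \<in> Field ?r" "u \<notin> ?A"
      using disj(1) unfolding Fr by blast+
    then have "f u \<notin> ?B" "f u \<in> Field ?s"
      using low fs by blast+
    then show "w \<in> Field q'"
      using u(2) unfolding Fs by blast
  next
    fix w assume w: "w \<in> Field q'"
    then obtain u where u: "u \<in> Field ?r" "f u = w"
      using surj unfolding Fs by blast
    then have "u \<notin> ?A"
      using low[OF u(1)] w disj(2) by blast
    then show "w \<in> f ` Field q"
      using u unfolding Fr by blast
  qed
  show "poset_iso q q'"
  proof (rule poset_isoI[of f])
    show "inj_on f (Field q)"
      using f(1) by (rule inj_on_subset) (auto simp: Fr)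
    fix u v assume uv: "u \<in> Field q" "v \<in> Field q"
    then have "u \<in> Field ?r" "v \<in> Field ?r" "f u \<in> Field q'" "f v \<in> Field q'"
      using fq unfolding Fr by blast+
    then show "(f u, f v) \<in> q' \<longleftrightarrow> (u, v) \<in> q"
      using f(3)[of u v] A.mem_q[OF uv] B.mem_q[of "f u" "f v"] by simp
  qed (simp add: fq)
  \<comment> \<open>The isomorphism f need not send x to x'. As f x and x' are both isolated in the
    lower summand of the target, exchanging them there turns f into a map from p to p'.\<close>
  define g where "g u = (if f u = x' then f x else f u)" for u
  have pr: "u \<in> Field ?r" if "u \<in> ?A" for u
    using that unfolding Fr by blast
  have f_eq: "f u = f v \<longleftrightarrow> u = v" if "u \<in> ?A" "v \<in> ?A" for u v
    using f(1) pr that by (simp add: inj_on_eq_iff)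
  have fB: "f u \<in> ?B" if "u \<in> ?A" for u
    using fA that by blast
  show "poset_iso p p'"
  proof (rule poset_isoI[of g])
    have x_in: "x \<in> ?A" and p_in: "\<And>u. u \<in> Field p \<Longrightarrow> u \<in> ?A"
      by blast+
    have gB: "g u \<in> Field p'" if u: "u \<in> Field p" for u
    proof -
      have "u \<noteq> x"
        using u A.x_p by blast
      then have "f u \<noteq> f x"
        using f_eq[OF p_in[OF u] x_in] by simp
      then show ?thesis
        using fB[OF p_in[OF u]] fB[OF x_in] unfolding g_def by auto
    qed
    show "inj_on g (Field p)"
    proof (rule inj_onI)
      fix u v assume uv: "u \<in> Field p" "v \<in> Field p" "g u = g v"
      have "u \<noteq> x" "v \<noteq> x"
        using uv A.x_p by blast+
      then show "u = v"
        using uv(3) f_eq[OF p_in[OF uv(1)] p_in[OF uv(2)]] f_eq[OF p_in[OF uv(1)] x_in] f_eq[OF p_in[OF uv(2)] x_in]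
        unfolding g_def by (auto split: if_splits)
    qed
    show "Field p' = g ` Field p"
    proof (intro equalityI subsetI)
      fix w assume w: "w \<in> Field p'"
      have preB: "\<exists>u\<in>?A. f u = v" if "v \<in> ?B" for v
        using that unfolding fA[symmetric] by (auto simp del: image_insert)
      obtain u where u: "u \<in> ?A" "f u = w"
        using preB[of w] w by blast
      show "w \<in> g ` Field p"
      proof (cases "u = x")
        case False
        have "w \<noteq> x'"
          using w B.x_p by blast
        then have "g u = w"
          using u(2) by (simp add: g_def)
        moreover have "u \<in> Field p"
          using u(1) False by simp
        ultimately show ?thesis
          by blast
      next
        case True
        obtain z where z: "z \<in> ?A" "f z = x'"
          using preB[of x'] by blast
        have "w \<noteq> x'"
          using w B.x_p by blast
        then have "z \<noteq> x"
          using z u True by blast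
        moreover have "g z = w"
          using z u True by (simp add: g_def)
        moreover from \<open>z \<noteq> x\<close> have "z \<in> Field p"
          using z(1) by simp
        ultimately show ?thesis
          by blast
      qed
    qed (use gB in blast)
    fix u v assume uv: "u \<in> Field p" "v \<in> Field p"
    have ne: "u \<noteq> x" "v \<noteq> x"
      using uv A.x_p by blast+
    note uA = p_in[OF uv(1)] and vA = p_in[OF uv(2)]
    have "(g u, g v) \<in> ?s \<longleftrightarrow> (u, v) \<in> ?r"
    proof (cases "f u = x' \<or> f v = x'")
      case False
      then show ?thesis
        using f(3)[OF pr[OF uA] pr[OF vA]] by (simp add: g_def)
    next
      case True
      show ?thesis
      proof (cases "u = v")
        case True
        then have "f u = x'"
          using \<open>f u = x' \<or> f v = x'\<close> by simp
        then have "(u, u) \<in> ?r"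
          using f(3)[OF pr[OF uA] pr[OF uA]] B.x_isolated(1)[of x'] by simp
        moreover have "(g u, g u) \<in> ?s"
          using Partial_orderD(3)[OF po] gB[OF uv(1)] unfolding Fs by blast
        ultimately show ?thesis
          using True by simp
      next
        case False
        then have "f u \<noteq> f v"
          using f_eq[OF uA vA] by simp
        have iso_x: "(f x, f w) \<in> ?s \<longleftrightarrow> w = x" "(f w, f x) \<in> ?s \<longleftrightarrow> w = x" if "w \<in> ?A" for w
          using f(3)[OF pr[OF x_in] pr[OF that]] f(3)[OF pr[OF that] pr[OF x_in]] A.x_isolated[OF that] by simp_all
        have iso_x': "(x', f w) \<in> ?s \<longleftrightarrow> f w = x'" "(f w, x') \<in> ?s \<longleftrightarrow> f w = x'" if "w \<in> ?A" for w
          using B.x_isolated[OF fB[OF that]] .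
        have "(f u, f v) \<notin> ?s"
          using True iso_x'(1)[OF vA] iso_x'(2)[OF uA] \<open>f u \<noteq> f v\<close> by auto
        then have "(u, v) \<notin> ?r"
          using f(3)[OF pr[OF uA] pr[OF vA]] by simp
        moreover have "(g u, g v) \<notin> ?s"
          using True \<open>f u \<noteq> f v\<close> iso_x(1)[OF vA] iso_x(2)[OF uA] ne unfolding g_def by auto
        ultimately show ?thesis
          by simp
      qed
    qed
    then show "(g u, g v) \<in> p' \<longleftrightarrow> (u, v) \<in> p"
      using A.mem_p[OF uv] B.mem_p[OF gB[OF uv(1)] gB[OF uv(2)]] by simp
  qed
qed

section \<open>Splitting off an isolated point\<close>

lemma minimal_below_ex:
  assumes "Partial_order r" "finite (Field r)" "a \<in> Field r"
  shows "\<exists>m. (m, a) \<in> r \<and> (\<forall>y. (y, m) \<in> r \<longrightarrow> y = m)"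
proof -
  note po = Partial_orderD[OF assms(1)]
  obtain m where m: "(m, a) \<in> r" "\<And>m'. (m', a) \<in> r \<Longrightarrow> card (down r m) \<le> card (down r m')"
    using ex_has_least_nat[of "\<lambda>m. (m, a) \<in> r" a "\<lambda>m. card (down r m)"] po(3)[OF assms(3)] by blast
  have "y = m" if y: "(y, m) \<in> r" for y
  proof (rule ccontr)
    assume "y \<noteq> m"
    then have "down r y \<subset> down r m"
      using y po(1,2) unfolding down_def strict_iff by blast
    then have "card (down r y) < card (down r m)"
      using finite_subset[OF down_subset_Field assms(2)] by (rule psubset_card_mono[rotated])
    then show False
      using m(2)[OF po(1)[OF y m(1)]] by simp
  qed
  then show ?thesis
    using m(1) by blast
qed

text \<open>Take x minimal with the smallest up-set B; up-sets form a chain, so every minimal point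
  lies below all of B. If some u outside B were not below some y in B, then a minimal m below u
  would give an N: m is below u and y, while x is below y but not below u. The remaining points A
  are incomparable to x, since x is minimal and B contains everything above it.\<close>

lemma isolated_sum_decomposition:
  assumes po: "Partial_order r" and fin: "finite (Field r)" and ne: "Field r \<noteq> {}"
    and free: "\<not> has_2_plus_2 r" "\<not> has_N r"
  obtains x A B where "x \<notin> A" "x \<notin> B" "A \<inter> B = {}" "Field r = insert x A \<union> B"
    "r = isolated_sum x (Restr r A) (Restr r B)"
proof -
  note poD = Partial_orderD[OF po]
  obtain a where "a \<in> Field r"
    using ne by blast
  then obtain m where "\<forall>y. (y, m) \<in> r \<longrightarrow> y = m" "m \<in> Field r"
    using minimal_below_ex[OF po fin] by (metis FieldI1)
  then obtain x where x: "x \<in> Field r" "\<And>y. (y, x) \<in> r \<Longrightarrow> y = x"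
      "\<And>m. m \<in> Field r \<Longrightarrow> \<forall>y. (y, m) \<in> r \<longrightarrow> y = m \<Longrightarrow> card (up r x) \<le> card (up r m)"
    using ex_has_least_nat[of "\<lambda>m. m \<in> Field r \<and> (\<forall>y. (y, m) \<in> r \<longrightarrow> y = m)" m "\<lambda>m. card (up r m)"] by blast
  define B where "B = up r x"
  define A where "A = Field r - B - {x}"
  have xB: "x \<notin> B"
    by (simp add: B_def up_def strict_iff)
  have BF: "B \<subseteq> Field r"
    unfolding B_def by (rule up_subset_Field)
  have up_min: "B \<subseteq> up r m" if m: "m \<in> Field r" "\<forall>y. (y, m) \<in> r \<longrightarrow> y = m" for m
  proof -
    have "finite (up r x)"
      using finite_subset[OF up_subset_Field fin] .
    then show ?thesis
      using interval_order_up_chain[OF po free(1), of x m] x(3)[OF m] card_seteq[of "up r x" "up r m"]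
      unfolding B_def by blast
  qed
  have below: "(u, y) \<in> r" if u: "u \<in> insert x A" and y: "y \<in> B" for u y
  proof (rule ccontr)
    assume uy: "(u, y) \<notin> r"
    have xy: "(x, y) \<in> strict r"
      using y by (simp add: B_def up_def)
    then have "u \<noteq> x"
      using uy by (auto simp: strict_iff)
    then have uF: "u \<in> Field r" "u \<notin> B"
      using u by (auto simp: A_def)
    then have xu: "(x, u) \<notin> r"
      using \<open>u \<noteq> x\<close> by (auto simp: B_def up_def strict_iff)
    obtain m where m: "(m, u) \<in> r" "\<forall>y. (y, m) \<in> r \<longrightarrow> y = m"
      using minimal_below_ex[OF po fin uF(1)] by blast
    have my: "(m, y) \<in> strict r"
      using up_min[OF FieldI1[OF m(1)] m(2)] y by (auto simp: up_def)
    then have "m \<noteq> u"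
      using uy by (auto simp: strict_iff)
    then have mu: "(m, u) \<in> strict r"
      using m(1) by (simp add: strict_iff)
    have "(m, x) \<notin> r"
      using x(2)[of m] m(1) xu by blast
    then have "has_N r"
      using mu my xy xu uy unfolding has_N_def by blast
    then show False
      using free(2) by simp
  qed
  show ?thesis
  proof (rule that[of x A B])
    show F: "Field r = insert x A \<union> B"
      using x(1) BF by (auto simp: A_def)
    show "x \<notin> A" "x \<notin> B" "A \<inter> B = {}"
      using xB by (auto simp: A_def)
    have FA: "Field (Restr r A) = A" "Field (Restr r B) = B"
      using F by (auto intro!: Field_Restr[OF po])
    have "(u, v) \<in> r \<longleftrightarrow> (u, v) \<in> isolated_sum x (Restr r A) (Restr r B)" for u v
    proof
      assume uv: "(u, v) \<in> r"
      have uvF: "u \<in> insert x A \<union> B" "v \<in> insert x A \<union> B"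
        using FieldI1[OF uv] FieldI2[OF uv] F by simp_all
      have "u = x" if "v = x"
        using x(2) uv that by blast
      moreover have "v = x \<or> v \<in> B" if "u = x"
        using uv that by (auto simp: B_def up_def strict_iff)
      moreover have "v \<in> B" if "u \<in> B"
      proof -
        have "(x, v) \<in> strict r"
          using that uv strict_trans[OF po, of x u v] by (cases "u = v") (auto simp: B_def up_def strict_iff)
        then show ?thesis
          by (simp add: B_def up_def)
      qed
      ultimately show "(u, v) \<in> isolated_sum x (Restr r A) (Restr r B)"
        using uv uvF unfolding isolated_sum_iff FA by blast
    next
      assume "(u, v) \<in> isolated_sum x (Restr r A) (Restr r B)"
      then show "(u, v) \<in> r"
        using below poD(3)[OF x(1)] unfolding isolated_sum_iff FA by blast
    qed
    then show "r = isolated_sum x (Restr r A) (Restr r B)"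
      by auto
  qed
qed

lemma has_Restr:
  "has_2_plus_2 (Restr r A) \<Longrightarrow> has_2_plus_2 r" "has_N (Restr r A) \<Longrightarrow> has_N r"
  unfolding has_2_plus_2_def has_N_def strict_iff by blast+

text \<open>The points are the nodes of the tree, addressed by their paths from the root; the first
  step of the path keeps the two subtrees disjoint and the root apart.\<close>

fun tree_poset :: "bintree \<Rightarrow> bool list rel" where
  "tree_poset Leaf = {}"
| "tree_poset (Branch l r) = isolated_sum []
     (map_prod (Cons True) (Cons True) ` tree_poset l) (map_prod (Cons False) (Cons False) ` tree_poset r)"

lemma poset_iso_map_Cons: "poset_iso r (map_prod (Cons b) (Cons b) ` r)"
  unfolding poset_iso_iff_image by (intro exI[of _ "Cons b"]) (simp add: inj_on_def)

lemma Field_map_Cons: "Field (map_prod (Cons b) (Cons b) ` r) = Cons b ` Field r"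
  unfolding Field_def by force

lemma isolated_summands_tree:
  "isolated_summands [] (map_prod (Cons True) (Cons True) ` r) (map_prod (Cons False) (Cons False) ` s)"
  by unfold_locales (auto simp: Field_map_Cons)

lemma tree_poset_props:
  "Partial_order (tree_poset t) \<and> finite (Field (tree_poset t)) \<and> card (Field (tree_poset t)) = nodes t \<and>
   \<not> has_2_plus_2 (tree_poset t) \<and> \<not> has_N (tree_poset t) \<and> min_count (tree_poset t) = left_spine t \<and>
   smc (tree_poset t) = right_spine t \<and> ssd (tree_poset t) = right_spine t"
proof (induction t)
  case Leaf
  \<comment> \<open>The empty poset has exactly one maximal chain, the empty one, so its
    \<open>smc\<close> is 0.\<close>
  have "Chains ({} :: bool list rel) = {{}}"
    by (auto simp: Chains_def)
  then have "smc ({} :: bool list rel) = 0"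
    by (simp add: smc_def)
  moreover have "ssd ({} :: bool list rel) = 0"
    by (subst ssd_eq_card_cuts) (simp_all add: cuts_empty)
  ultimately show ?case
    by (simp add: has_2_plus_2_def has_N_def strict_def min_count_def)
next
  case (Branch l r)
  let ?l = "map_prod (Cons True) (Cons True) ` tree_poset l" and ?r = "map_prod (Cons False) (Cons False) ` tree_poset r"
  interpret isolated_summands "[]" ?l ?r
    by (rule isolated_summands_tree)
  note il = poset_iso_map_Cons[of "tree_poset l" True] and ir = poset_iso_map_Cons[of "tree_poset r" False]
  note IH = Branch.IH(1)[THEN conjunct1] Branch.IH(2)[THEN conjunct1]
  have po: "Partial_order ?l" "Partial_order ?r"
    using poset_iso_Partial_order[OF il IH(1)] poset_iso_Partial_order[OF ir IH(2)] .
  have fin: "finite (Field ?l)" "finite (Field ?r)"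
    using Branch.IH by (simp_all add: Field_map_Cons)
  have free: "\<not> has_2_plus_2 ?l" "\<not> has_2_plus_2 ?r" "\<not> has_N ?l" "\<not> has_N ?r"
    using Branch.IH poset_iso_has_2_plus_2[OF poset_iso_sym[OF il]] poset_iso_has_2_plus_2[OF poset_iso_sym[OF ir]]
      poset_iso_has_N[OF poset_iso_sym[OF il]] poset_iso_has_N[OF poset_iso_sym[OF ir]] by blast+
  let ?t = "isolated_sum [] ?l ?r"
  have po_t: "Partial_order ?t"
    using Partial_order_isolated_sum[OF po] .
  have fin_t: "finite (Field ?t)"
    using fin by (simp add: Field_isolated_sum)
  have "card (Field ?t) = Suc (nodes l + nodes r)"
  proof -
    have "card (Field ?t) = Suc (card (Field ?l \<union> Field ?r))"
      unfolding Field_isolated_sum using fin x_p x_q by simp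
    also have "card (Field ?l \<union> Field ?r) = card (Field ?l) + card (Field ?r)"
      using fin p_q by (rule card_Un_disjoint)
    also have "card (Field ?l) = nodes l"
      using poset_iso_card_Field[OF il] Branch.IH(1) by simp
    also have "card (Field ?r) = nodes r"
      using poset_iso_card_Field[OF ir] Branch.IH(2) by simp
    finally show ?thesis .
  qed
  moreover have "\<not> has_2_plus_2 ?t" "\<not> has_N ?t"
    using isolated_sum_free free by blast+
  moreover have "min_count ?t = Suc (left_spine l)"
    using min_count_isolated_sum[OF fin(1)] poset_iso_min_count[OF il] Branch.IH(1) by simp
  moreover have "smc ?t = Suc (right_spine r)"
    using smc_isolated_sum[OF fin] poset_iso_smc[OF ir] Branch.IH(2) by simp
  moreover have "ssd ?t = Suc (right_spine r)"
    using ssd_eq_card_cuts[OF po_t fin_t] card_cuts_isolated_sum[OF fin] ssd_eq_card_cuts[OF po(2) fin(2)]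
      poset_iso_ssd[OF ir IH(2)] Branch.IH(2) by simp
  ultimately show ?case
    using po_t fin_t by simp
qed

lemma tree_poset_inj: "poset_iso (tree_poset t) (tree_poset u) \<Longrightarrow> t = u"
proof (induction t arbitrary: u)
  case Leaf
  then have "card (Field (tree_poset u)) = 0"
    using poset_iso_card_Field by fastforce
  then show ?case
    using tree_poset_props[of u] by (cases u) auto
next
  case (Branch l r)
  have "nodes u = Suc (nodes l + nodes r)"
    using poset_iso_card_Field[OF Branch.prems] tree_poset_props[of u] tree_poset_props[of "Branch l r"] by simp
  then obtain l' r' where u: "u = Branch l' r'"
    by (cases u) auto
  have po: "Partial_order (tree_poset u)"
    using tree_poset_props by blast
  have "poset_iso (map_prod (Cons True) (Cons True) ` tree_poset l) (map_prod (Cons True) (Cons True) ` tree_poset l')"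
    "poset_iso (map_prod (Cons False) (Cons False) ` tree_poset r) (map_prod (Cons False) (Cons False) ` tree_poset r')"
    using isolated_sum_iso_cancel[OF isolated_summands_tree isolated_summands_tree po[unfolded u tree_poset.simps]
        Branch.prems[unfolded u tree_poset.simps]] .
  then have "poset_iso (tree_poset l) (tree_poset l')" "poset_iso (tree_poset r) (tree_poset r')"
    by (meson poset_iso_map_Cons poset_iso_sym poset_iso_trans)+
  then show ?case
    using Branch.IH u by blast
qed

lemma tree_poset_surj:
  assumes "Partial_order r" "finite (Field r)" "\<not> has_2_plus_2 r" "\<not> has_N r"
  shows "\<exists>t. poset_iso (tree_poset t) r"
  using assms
proof (induction "card (Field r)" arbitrary: r rule: less_induct)
  case less
  show ?case
  proof (cases "Field r = {}")
    case True
    then have "r = {}"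
      by (auto simp: Field_def)
    then have "poset_iso (tree_poset Leaf) r"
      by (simp add: poset_iso_def bij_betw_def)
    then show ?thesis ..
  next
    case False
    obtain x A B where d: "x \<notin> A" "x \<notin> B" "A \<inter> B = {}" "Field r = insert x A \<union> B"
        "r = isolated_sum x (Restr r A) (Restr r B)"
      using isolated_sum_decomposition[OF less.prems(1,2) False less.prems(3,4)] .
    have sub: "A \<subset> Field r" "B \<subset> Field r"
      using d(1,2,4) by blast+
    have F: "Field (Restr r A) = A" "Field (Restr r B) = B"
      using sub by (auto intro!: Field_Restr[OF less.prems(1)])
    have IH: "\<exists>t. poset_iso (tree_poset t) (Restr r C)" if C: "C \<subset> Field r" "Field (Restr r C) = C" for C
    proof (rule less.hyps)
      show "card (Field (Restr r C)) < card (Field r)"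
        unfolding C(2) using less.prems(2) C(1) by (rule psubset_card_mono)
      show "Partial_order (Restr r C)"
        using Partial_order_Restr[OF less.prems(1)] C(1) by blast
      show "finite (Field (Restr r C))"
        unfolding C(2) using C(1) less.prems(2) finite_subset by blast
      show "\<not> has_2_plus_2 (Restr r C)" "\<not> has_N (Restr r C)"
        using has_Restr less.prems(3,4) by blast+
    qed
    obtain t u where t: "poset_iso (tree_poset t) (Restr r A)" and u: "poset_iso (tree_poset u) (Restr r B)"
      using IH[OF sub(1) F(1)] IH[OF sub(2) F(2)] by blast
    have "isolated_summands x (Restr r A) (Restr r B)"
      by unfold_locales (simp_all add: F d(1-3))
    then have "poset_iso (tree_poset (Branch t u)) (isolated_sum x (Restr r A) (Restr r B))"
      unfolding tree_poset.simps
      using isolated_sum_iso[OF isolated_summands_tree _ poset_iso_trans[OF poset_iso_sym[OF poset_iso_map_Cons] t]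
          poset_iso_trans[OF poset_iso_sym[OF poset_iso_map_Cons] u]] by blast
    then show ?thesis
      using d(5) by metis
  qed
qed

lemma equidist_posets_N:
  "equidist (trees n) left_spine right_spine (posets_avoiding poset_N n) (class_stat min_count) (class_stat smc)"
  "equidist (trees n) left_spine right_spine (posets_avoiding poset_N n) (class_stat min_count) (class_stat ssd)"
proof -
  have "equidist (trees n) left_spine right_spine (posets_avoiding poset_N n) (class_stat min_count) (class_stat g)"
    if g: "g = smc \<or> g = ssd" for g
  proof (rule equidist_posets_avoiding[of _ tree_poset])
    fix t assume t: "t \<in> trees n"
    note props = tree_poset_props[of t]
    show "Partial_order (tree_poset t) \<and> finite (Field (tree_poset t)) \<and> card (Field (tree_poset t)) = n"
      "\<not> has_2_plus_2 (tree_poset t)"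
      using props t by (simp_all add: trees_def)
    fix r :: "nat rel" assume iso: "poset_iso (tree_poset t) r"
    show "\<not> poset_contains r poset_N"
      using poset_iso_not_contains(2)[OF iso] props by simp
    show "min_count r = left_spine t \<and> g r = right_spine t"
      using g poset_iso_min_count[OF iso] poset_iso_smc[OF iso] poset_iso_ssd[OF iso] props by auto
  next
    fix r assume r: "partial_order_on {1..n} r" "\<not> has_2_plus_2 r" "\<not> poset_contains r poset_N"
    have F: "Field r = {1..n}" and po: "Partial_order r"
      using Field_partial_order_on[OF r(1)] Partial_order_if_partial_order_on[OF r(1)] by simp_all
    obtain t where t: "poset_iso (tree_poset t) r"
      using tree_poset_surj[OF po _ r(2)] r(3) has_N_iff[OF po] F by auto
    then have "nodes t = n"
      using poset_iso_card_Field[OF t] tree_poset_props[of t] F by simp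
    then show "\<exists>t\<in>trees n. poset_iso (tree_poset t) r"
      using t by (auto simp: trees_def)
  qed (rule tree_poset_inj)
  then show "equidist (trees n) left_spine right_spine (posets_avoiding poset_N n) (class_stat min_count) (class_stat smc)"
    "equidist (trees n) left_spine right_spine (posets_avoiding poset_N n) (class_stat min_count) (class_stat ssd)"
    by blast+
qed

section \<open>Stoimenow matchings\<close>

abbreviation opener :: "nat set \<Rightarrow> nat" where "opener \<equiv> Min"
abbreviation closer :: "nat set \<Rightarrow> nat" where "closer \<equiv> Max"

definition arc_poset :: "nat set set \<Rightarrow> nat set rel" where
  "arc_poset M = {(A, B). A \<in> M \<and> B \<in> M \<and> (A = B \<or> closer A < opener B)}"

lemma arc_poset_iff: "(A, B) \<in> arc_poset M \<longleftrightarrow> A \<in> M \<and> B \<in> M \<and> (A = B \<or> closer A < opener B)"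
  by (simp add: arc_poset_def)

lemma Field_arc_poset: "Field (arc_poset M) = M"
  by (auto simp: Field_def arc_poset_def)

lemma card_less_if_mem: "finite T \<Longrightarrow> S \<subseteq> T \<Longrightarrow> c \<in> T \<Longrightarrow> c \<notin> S \<Longrightarrow> card S < card T"
  by (metis psubset_card_mono psubsetI)

locale perfect_matching =
  fixes n :: nat and M :: "nat set set"
  assumes matching: "matching n M"
begin

lemma arc:
  assumes "A \<in> M"
  shows "A = {opener A, closer A}" "opener A < closer A" "1 \<le> opener A" "closer A \<le> 2 * n"
proof -
  have "card A = 2" "A \<subseteq> {1..2 * n}"
    using assms matching unfolding matching_def partition_on_def by auto
  then obtain a b where ab: "A = {a, b}" "a < b"
    by (metis card_2_iff insert_commute linorder_neqE_nat)
  then have "opener A = a" "closer A = b"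
    by simp_all
  then show "A = {opener A, closer A}" "opener A < closer A" "1 \<le> opener A" "closer A \<le> 2 * n"
    using ab \<open>A \<subseteq> {1..2 * n}\<close> by auto
qed

lemma finite_M: "finite M"
  using matching finite_elements[of "{1..2 * n}" M] by (simp add: matching_def)

lemma disjoint: "A \<in> M \<Longrightarrow> B \<in> M \<Longrightarrow> x \<in> A \<Longrightarrow> x \<in> B \<Longrightarrow> A = B"
  using matching unfolding matching_def partition_on_def disjoint_def by blast

lemma mem_arc: "A \<in> M \<Longrightarrow> opener A \<in> A" "A \<in> M \<Longrightarrow> closer A \<in> A"
  using arc(1) by blast+

lemma endpoint_eq:
  assumes "A \<in> M" "B \<in> M"
  shows "opener A = opener B \<longleftrightarrow> A = B" "closer A = closer B \<longleftrightarrow> A = B" "opener A \<noteq> closer B"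
proof -
  show "opener A = opener B \<longleftrightarrow> A = B" "closer A = closer B \<longleftrightarrow> A = B"
    using disjoint[OF assms] mem_arc[OF assms(1)] mem_arc[OF assms(2)] by metis+
  show "opener A \<noteq> closer B"
  proof
    assume eq: "opener A = closer B"
    then have "A = B"
      using disjoint[OF assms] mem_arc(1)[OF assms(1)] mem_arc(2)[OF assms(2)] by auto
    then show False
      using eq arc(2)[OF assms(1)] by simp
  qed
qed

lemma endpoints: "opener ` M \<union> closer ` M = {1..2 * n}"
proof -
  have "\<Union>M = {1..2 * n}"
    using matching by (simp add: matching_def partition_on_def)
  moreover have "opener ` M \<union> closer ` M = \<Union>M"
  proof (intro equalityI subsetI)
    fix x assume "x \<in> opener ` M \<union> closer ` M"
    then show "x \<in> \<Union>M"
      using mem_arc by blast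
  next
    fix x assume "x \<in> \<Union>M"
    then obtain A where A: "A \<in> M" "x \<in> A"
      by blast
    then have "x \<in> {opener A, closer A}"
      using arc(1) by metis
    then show "x \<in> opener ` M \<union> closer ` M"
      using A(1) by blast
  qed
  ultimately show ?thesis
    by simp
qed

lemma endpoint_cases:
  assumes "1 \<le> i" "i \<le> 2 * n"
  obtains A where "A \<in> M" "opener A = i" | A where "A \<in> M" "closer A = i"
  using endpoints assms by (metis (no_types, lifting) Un_iff atLeastAtMost_iff imageE)

lemma inj_endpoints: "inj_on opener M" "inj_on closer M"
  using endpoint_eq by (auto intro!: inj_onI)

text \<open>Every position is exactly one opener or one closer. This converts positions into numbers
  of arcs and thereby into data of the arc poset.\<close>

lemma count_endpoints:
  assumes "i \<le> 2 * n"
  shows "i = card {A \<in> M. opener A \<le> i} + card {A \<in> M. closer A \<le> i}"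
proof -
  have eq: "{1..i} = opener ` {A \<in> M. opener A \<le> i} \<union> closer ` {A \<in> M. closer A \<le> i}"
  proof (intro equalityI subsetI)
    fix x assume x: "x \<in> {1..i}"
    then have "x \<in> opener ` M \<union> closer ` M"
      unfolding endpoints using assms by simp
    then show "x \<in> opener ` {A \<in> M. opener A \<le> i} \<union> closer ` {A \<in> M. closer A \<le> i}"
      using x by auto
  next
    fix x assume "x \<in> opener ` {A \<in> M. opener A \<le> i} \<union> closer ` {A \<in> M. closer A \<le> i}"
    then have "x \<le> i" "x \<in> opener ` M \<union> closer ` M"
      by auto
    then show "x \<in> {1..i}"
      unfolding endpoints by simp
  qed
  have "i = card {1..i}"
    by simp
  also have "\<dots> = card (opener ` {A \<in> M. opener A \<le> i} \<union> closer ` {A \<in> M. closer A \<le> i})"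
    by (simp only: eq)
  also have "\<dots> = card (opener ` {A \<in> M. opener A \<le> i}) + card (closer ` {A \<in> M. closer A \<le> i})"
    using finite_M endpoint_eq(3) by (intro card_Un_disjoint) auto
  also have "card (opener ` {A \<in> M. opener A \<le> i}) = card {A \<in> M. opener A \<le> i}"
    by (rule card_image[OF inj_on_subset[OF inj_endpoints(1)]]) simp
  also have "card (closer ` {A \<in> M. closer A \<le> i}) = card {A \<in> M. closer A \<le> i}"
    by (rule card_image[OF inj_on_subset[OF inj_endpoints(2)]]) simp
  finally show ?thesis .
qed

lemma card_M: "card M = n"
proof -
  have "{A \<in> M. opener A \<le> 2 * n} = M" "{A \<in> M. closer A \<le> 2 * n} = M"
    using arc by fastforce+
  then show ?thesis
    using count_endpoints[of "2 * n"] by simp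
qed

lemma Partial_order_arcs: "Partial_order (arc_poset M)"
  unfolding Partial_order_iff
proof (intro conjI)
  show "trans (arc_poset M)"
  proof (rule transI)
    fix A B C assume "(A, B) \<in> arc_poset M" "(B, C) \<in> arc_poset M"
    then show "(A, C) \<in> arc_poset M"
      using arc(2)[of B] by (auto simp: arc_poset_def)
  qed
  show "antisym (arc_poset M)"
  proof (rule antisymI)
    fix A B assume "(A, B) \<in> arc_poset M" "(B, A) \<in> arc_poset M"
    then show "A = B"
      using arc(2)[of A] arc(2)[of B] by (auto simp: arc_poset_def)
  qed
qed (simp add: arc_poset_iff Field_arc_poset)

lemma strict_arc: "(A, B) \<in> strict (arc_poset M) \<longleftrightarrow> A \<in> M \<and> B \<in> M \<and> closer A < opener B"
  using arc(2)[of A] by (auto simp: strict_iff arc_poset_def)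

text \<open>Of the two lower arcs, the one that closes first lies to the left of both upper
  arcs.\<close>

lemma no_2_plus_2: "\<not> has_2_plus_2 (arc_poset M)"
proof
  assume "has_2_plus_2 (arc_poset M)"
  then obtain A B C D where "A \<in> M" "B \<in> M" "closer A < opener B" "C \<in> M" "D \<in> M" "closer C < opener D"
      "(A, D) \<notin> arc_poset M" "(C, B) \<notin> arc_poset M"
    unfolding has_2_plus_2_def strict_arc by blast
  then show False
    by (auto simp: arc_poset_def)
qed

abbreviation "dn A \<equiv> card (down (arc_poset M) A)"
abbreviation "un A \<equiv> card (up (arc_poset M) A)"

lemma down_arc: "A \<in> M \<Longrightarrow> down (arc_poset M) A = {B \<in> M. closer B < opener A}"
  by (auto simp: down_def strict_arc)

lemma up_arc: "A \<in> M \<Longrightarrow> up (arc_poset M) A = {B \<in> M. closer A < opener B}"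
  by (auto simp: up_def strict_arc)

text \<open>The closers to the left of the opener of A belong to the arcs below A. Dually in
  \<open>closer_eq\<close>, the openers to the left of the closer of A belong to the arcs that are
  not above A.\<close>

lemma opener_eq:
  assumes A: "A \<in> M"
  shows "opener A = dn A + card {B \<in> M. opener B \<le> opener A}"
proof -
  have "{B \<in> M. closer B \<le> opener A} = down (arc_poset M) A"
    using endpoint_eq(3)[OF A, THEN not_sym] by (auto simp: down_arc[OF A] order.order_iff_strict)
  then show ?thesis
    using count_endpoints[of "opener A"] arc[OF A] by simp
qed

lemma closer_eq:
  assumes A: "A \<in> M"
  shows "closer A = n - un A + card {B \<in> M. closer B \<le> closer A}"
proof -
  have "{B \<in> M. opener B \<le> closer A} = M - up (arc_poset M) A"
    by (auto simp: up_arc[OF A])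
  then have "card {B \<in> M. opener B \<le> closer A} = n - un A"
    using finite_M card_M by (simp add: card_Diff_subset up_arc[OF A])
  then show ?thesis
    using count_endpoints[of "closer A"] arc[OF A] by simp
qed

lemma dn_mono:
  assumes "A \<in> M" "B \<in> M" "opener A \<le> opener B"
  shows "dn A \<le> dn B"
  unfolding down_arc[OF assms(1)] down_arc[OF assms(2)] using finite_M assms(3) by (intro card_mono) auto

lemma un_mono:
  assumes "A \<in> M" "B \<in> M" "closer A \<le> closer B"
  shows "un B \<le> un A"
  unfolding up_arc[OF assms(1)] up_arc[OF assms(2)] using finite_M assms(3) by (intro card_mono) auto

text \<open>A closer between two openers is counted for the right one only; thus equal down-sets
  confine two openers to one run of openers.\<close>

lemma dn_less:
  assumes "A \<in> M" "B \<in> M" "C \<in> M" "opener A < closer C" "closer C < opener B"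
  shows "dn A < dn B"
  unfolding down_arc[OF assms(1)] down_arc[OF assms(2)] using finite_M assms(3-5) by (intro card_less_if_mem[of _ _ C]) auto

lemma un_less:
  assumes "A \<in> M" "B \<in> M" "C \<in> M" "closer A < opener C" "opener C < closer B"
  shows "un B < un A"
  unfolding up_arc[OF assms(1)] up_arc[OF assms(2)] using finite_M assms(3-5) by (intro card_less_if_mem[of _ _ C]) auto

end

text \<open>The two orders refer to each other: openers go by down-sets with ties broken by closers,
  closers by up-sets with ties broken by openers. Inserting one rule into the other leaves undecided
  only arcs for which both sizes agree, and these open and close in the same order.\<close>

lemma rank_arith:
  fixes a a' b b' d d' u u' :: nat
  assumes "a < a' \<longleftrightarrow> d < d' \<or> d = d' \<and> b < b'" "a' < a \<longleftrightarrow> d' < d \<or> d' = d \<and> b' < b"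
    "b < b' \<longleftrightarrow> u' < u \<or> u = u' \<and> a < a'" "b' < b \<longleftrightarrow> u < u' \<or> u' = u \<and> a' < a"
  shows "a' \<le> a \<longleftrightarrow> (d' < d \<or> d' = d \<and> u < u') \<or> (d' = d \<and> u' = u) \<and> a' \<le> a"
    and "b' \<le> b \<longleftrightarrow> (u < u' \<or> u' = u \<and> d' < d) \<or> (d' = d \<and> u' = u) \<and> a' \<le> a"
proof -
  show "a' \<le> a \<longleftrightarrow> (d' < d \<or> d' = d \<and> u < u') \<or> (d' = d \<and> u' = u) \<and> a' \<le> a"
    using assms by linarith
  show "b' \<le> b \<longleftrightarrow> (u < u' \<or> u' = u \<and> d' < d) \<or> (d' = d \<and> u' = u) \<and> a' \<le> a"
  proof -
    have "b' \<le> b \<longleftrightarrow> u < u' \<or> u' = u \<and> a' \<le> a"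
      using assms(3) by linarith
    moreover have "a' \<le> a \<longleftrightarrow> d' < d \<or> d' = d \<and> a' \<le> a"
      using assms(1,2) by linarith
    ultimately show ?thesis
      by blast
  qed
qed

section \<open>Positions of endpoints in a Stoimenow matching\<close>

locale stoimenow_matching = perfect_matching +
  assumes stoimenow: "stoimenow M"
begin

lemma adjacent_openers:
  assumes "A \<in> M" "B \<in> M" "opener B = Suc (opener A)"
  shows "closer A < closer B"
proof (rule ccontr)
  assume "\<not> ?thesis"
  then have "closer B < closer A"
    using endpoint_eq(2)[OF assms(1,2)] assms(3) by fastforce
  moreover have "{opener A, closer A} \<in> M" "{opener A + 1, closer B} \<in> M" "opener A + 1 < closer B"
    using arc[OF assms(1)] arc[OF assms(2)] assms by auto
  ultimately show False
    using stoimenow unfolding stoimenow_def by blast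
qed

lemma adjacent_closers:
  assumes "A \<in> M" "B \<in> M" "closer B = Suc (closer A)"
  shows "opener A < opener B"
proof (rule ccontr)
  assume "\<not> ?thesis"
  then have "opener B < opener A"
    using endpoint_eq(1)[OF assms(1,2)] assms(3) by fastforce
  moreover have "{opener B, closer A + 1} \<in> M" "{opener A, closer A} \<in> M" "opener A < closer A"
    using arc[OF assms(1)] arc[OF assms(2)] assms by auto
  ultimately show False
    using stoimenow unfolding stoimenow_def by blast
qed

text \<open>
  Arcs with equal down-sets are opened in the same run of consecutive openers, arcs with equal up-sets are
  closed in the same run of consecutive closers.
\<close>

lemma same_down:
  assumes "A \<in> M" "B \<in> M" "opener A < opener B" "dn A = dn B"
  shows "closer A < closer B"
  using assms
proof (induction "opener B" arbitrary: B rule: less_induct)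
  case less
  show ?case
  proof (cases "opener B = Suc (opener A)")
    case True
    then show ?thesis
      using adjacent_openers less.prems by blast
  next
    case False
    then have p: "1 \<le> opener B - 1" "opener B - 1 \<le> 2 * n" "opener A < opener B - 1"
      using less.prems arc[OF less.prems(2)] by linarith+
    \<comment> \<open>The position just before the opener of B is again an opener: a closer there
      would make the down-set of B larger than that of A.\<close>
    obtain C where C: "C \<in> M" "opener C = opener B - 1"
    proof (cases rule: endpoint_cases[OF p(1,2)])
      case (2 C)
      then have "dn A < dn B"
        using dn_less[OF less.prems(1,2), of C] p by simp
      then show ?thesis
        using less.prems by simp
    qed
    have "dn C = dn A"
      using dn_mono[OF less.prems(1) C(1)] dn_mono[OF C(1) less.prems(2)] C(2) p less.prems(4) by simp
    then have "closer A < closer C"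
      using less.hyps[of C] C p less.prems(1,3) by simp
    moreover have "closer C < closer B"
      using adjacent_openers[OF C(1) less.prems(2)] C(2) p by simp
    ultimately show ?thesis
      by simp
  qed
qed

lemma same_up:
  assumes "A \<in> M" "B \<in> M" "closer A < closer B" "un A = un B"
  shows "opener A < opener B"
  using assms
proof (induction "closer B" arbitrary: B rule: less_induct)
  case less
  show ?case
  proof (cases "closer B = Suc (closer A)")
    case True
    then show ?thesis
      using adjacent_closers less.prems by blast
  next
    case False
    then have p: "1 \<le> closer B - 1" "closer B - 1 \<le> 2 * n" "closer A < closer B - 1"
      using less.prems arc[OF less.prems(2)] by linarith+
    obtain C where C: "C \<in> M" "closer C = closer B - 1"
    proof (cases rule: endpoint_cases[OF p(1,2)])
      case (1 C)
      then have "un B < un A"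
        using un_less[OF less.prems(1,2), of C] p by simp
      then show ?thesis
        using less.prems by simp
    qed
    have "un C = un A"
      using un_mono[OF less.prems(1) C(1)] un_mono[OF C(1) less.prems(2)] C(2) p less.prems(4) by simp
    then have "opener A < opener C"
      using less.hyps[of C] C p less.prems(1,3) by simp
    moreover have "opener C < opener B"
      using adjacent_closers[OF C(1) less.prems(2)] C(2) p by simp
    ultimately show ?thesis
      by simp
  qed
qed

lemma opener_less_iff:
  assumes "A \<in> M" "B \<in> M"
  shows "opener A < opener B \<longleftrightarrow> dn A < dn B \<or> dn A = dn B \<and> closer A < closer B"
proof -
  have "closer A < closer B \<Longrightarrow> dn A = dn B \<Longrightarrow> \<not> opener B < opener A"
    using same_down[OF assms(2,1)] by auto
  moreover have "opener A = opener B \<Longrightarrow> A = B"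
    using endpoint_eq(1)[OF assms] by simp
  ultimately show ?thesis
    using same_down[OF assms] dn_mono[OF assms] dn_mono[OF assms(2,1)] by (metis leD le_eq_less_or_eq linorder_neqE_nat less_irrefl)
qed

lemma closer_less_iff:
  assumes "A \<in> M" "B \<in> M"
  shows "closer A < closer B \<longleftrightarrow> un B < un A \<or> un A = un B \<and> opener A < opener B"
proof -
  have "opener A < opener B \<Longrightarrow> un A = un B \<Longrightarrow> \<not> closer B < closer A"
    using same_up[OF assms(2,1)] by auto
  moreover have "closer A = closer B \<Longrightarrow> A = B"
    using endpoint_eq(2)[OF assms] by simp
  ultimately show ?thesis
    using same_up[OF assms] un_mono[OF assms] un_mono[OF assms(2,1)] by (metis leD le_eq_less_or_eq linorder_neqE_nat less_irrefl)
qed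

text \<open>Down-sets and up-sets of an interval order form chains, so equal sizes mean equal sets:
  the poset cannot tell twins apart, and only their order among themselves remains to be
  fixed.\<close>

definition twins :: "nat set \<Rightarrow> nat set set" where
  "twins A = {B \<in> M. dn B = dn A \<and> un B = un A}"

definition twin_rank :: "nat set \<Rightarrow> nat" where
  "twin_rank A = card {B \<in> twins A. opener B \<le> opener A}"

text \<open>Expresses the position of the opener by isomorphism invariants of the arc poset and the
  rank among twins; together with \<open>closer_rank\<close>, where the same rank occurs, this
  determines the arc.\<close>

lemma opener_rank:
  assumes A: "A \<in> M"
  shows "opener A = dn A + card {B \<in> M. dn B < dn A \<or> dn B = dn A \<and> un A < un B} + twin_rank A"
proof -
  have "opener B \<le> opener A \<longleftrightarrow> (dn B < dn A \<or> dn B = dn A \<and> un A < un B) \<or> B \<in> twins A \<and> opener B \<le> opener A"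
    if B: "B \<in> M" for B
    using rank_arith(1)[OF opener_less_iff[OF A B] opener_less_iff[OF B A] closer_less_iff[OF A B] closer_less_iff[OF B A]] B
    unfolding twins_def by blast
  then have "{B \<in> M. opener B \<le> opener A} =
      {B \<in> M. dn B < dn A \<or> dn B = dn A \<and> un A < un B} \<union> {B \<in> twins A. opener B \<le> opener A}"
    by (auto simp: twins_def)
  moreover have "{B \<in> M. dn B < dn A \<or> dn B = dn A \<and> un A < un B} \<inter> {B \<in> twins A. opener B \<le> opener A} = {}"
    by (auto simp: twins_def)
  moreover have "finite (twins A)"
    using finite_M by (simp add: twins_def)
  ultimately have "card {B \<in> M. opener B \<le> opener A} =
      card {B \<in> M. dn B < dn A \<or> dn B = dn A \<and> un A < un B} + twin_rank A"
    using finite_M by (simp add: card_Un_disjoint twin_rank_def)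
  then show ?thesis
    using opener_eq[OF A] by simp
qed

lemma closer_rank:
  assumes A: "A \<in> M"
  shows "closer A = n - un A + card {B \<in> M. un A < un B \<or> un B = un A \<and> dn B < dn A} + twin_rank A"
proof -
  have "closer B \<le> closer A \<longleftrightarrow> (un A < un B \<or> un B = un A \<and> dn B < dn A) \<or> B \<in> twins A \<and> opener B \<le> opener A"
    if B: "B \<in> M" for B
    using rank_arith(2)[OF opener_less_iff[OF A B] opener_less_iff[OF B A] closer_less_iff[OF A B] closer_less_iff[OF B A]] B
    unfolding twins_def by blast
  then have "{B \<in> M. closer B \<le> closer A} =
      {B \<in> M. un A < un B \<or> un B = un A \<and> dn B < dn A} \<union> {B \<in> twins A. opener B \<le> opener A}"
    by (auto simp: twins_def)
  moreover have "{B \<in> M. un A < un B \<or> un B = un A \<and> dn B < dn A} \<inter> {B \<in> twins A. opener B \<le> opener A} = {}"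
    by (auto simp: twins_def)
  moreover have "finite (twins A)"
    using finite_M by (simp add: twins_def)
  ultimately have "card {B \<in> M. closer B \<le> closer A} =
      card {B \<in> M. un A < un B \<or> un B = un A \<and> dn B < dn A} + twin_rank A"
    using finite_M by (simp add: card_Un_disjoint twin_rank_def)
  then show ?thesis
    using closer_eq[OF A] by simp
qed

lemma twin_of_rank_ex:
  assumes "A \<in> M" "1 \<le> i" "i \<le> card (twins A)"
  shows "\<exists>B\<in>twins A. twin_rank B = i"
proof -
  let ?T = "opener ` twins A"
  have sub: "twins A \<subseteq> M" and fin: "finite (twins A)"
    using finite_M by (auto simp: twins_def)
  have "card ?T = card (twins A)"
    using inj_on_subset[OF inj_endpoints(1) sub] by (rule card_image)
  then have "i \<in> (\<lambda>x. Suc (card {v \<in> ?T. v < x})) ` ?T"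
    using bij_betw_rank[of ?T] fin assms(2,3) unfolding bij_betw_def by simp
  then obtain B where B: "B \<in> twins A" "i = Suc (card {v \<in> ?T. v < opener B})"
    by blast
  have "twins B = twins A"
    using B(1) by (auto simp: twins_def)
  have "{v \<in> ?T. v < opener B} = opener ` {C \<in> twins A. opener C < opener B}"
    by auto
  then have "card {v \<in> ?T. v < opener B} = card {C \<in> twins A. opener C < opener B}"
    using card_image[OF inj_on_subset[OF inj_endpoints(1)], of "{C \<in> twins A. opener C < opener B}"] sub by auto
  moreover have "{C \<in> twins A. opener C \<le> opener B} = insert B {C \<in> twins A. opener C < opener B}"
    using B(1) endpoint_eq(1) sub by (auto simp: order.order_iff_strict)
  ultimately have "twin_rank B = i"
    using fin B(2) by (simp add: twin_rank_def \<open>twins B = twins A\<close>)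
  then show ?thesis
    using B(1) by blast
qed

end

text \<open>The isomorphism f may permute twins, so A is compared not with \<open>f A\<close> but
  with that twin B of \<open>f A\<close> whose rank is the rank of A. By \<open>opener_rank\<close>
  and \<open>closer_rank\<close>, B has the endpoints of A.\<close>

lemma stoimenow_matching_iso_subset:
  assumes "stoimenow_matching n M" "stoimenow_matching n N" and iso: "poset_iso (arc_poset M) (arc_poset N)"
  shows "M \<subseteq> N"
proof
  interpret M: stoimenow_matching n M by fact
  interpret N: stoimenow_matching n N by fact
  obtain f where f: "inj_on f (Field (arc_poset M))" "Field (arc_poset N) = f ` Field (arc_poset M)"
      "\<And>x y. x \<in> Field (arc_poset M) \<Longrightarrow> y \<in> Field (arc_poset M) \<Longrightarrow> (f x, f y) \<in> arc_poset N \<longleftrightarrow> (x, y) \<in> arc_poset M"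
    using poset_isoE[OF iso] by blast
  have fM: "inj_on f M" "N = f ` M"
    using f(1,2) by (simp_all add: Field_arc_poset)
  have du: "N.dn (f B) = M.dn B" "N.un (f B) = M.un B" if "B \<in> M" for B
    using iso_down[OF f] that by (simp_all add: Field_arc_poset)
  have count: "card {B \<in> N. P (N.dn B) (N.un B)} = card {B \<in> M. P (M.dn B) (M.un B)}" for P
  proof -
    have "{B \<in> N. P (N.dn B) (N.un B)} = f ` {B \<in> M. P (M.dn B) (M.un B)}"
    proof (intro equalityI subsetI)
      fix X assume X: "X \<in> {B \<in> N. P (N.dn B) (N.un B)}"
      then obtain B where "B \<in> M" "X = f B"
        using fM(2) by blast
      then show "X \<in> f ` {B \<in> M. P (M.dn B) (M.un B)}"
        using X du by auto
    next
      fix X assume "X \<in> f ` {B \<in> M. P (M.dn B) (M.un B)}"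
      then show "X \<in> {B \<in> N. P (N.dn B) (N.un B)}"
        using du fM(2) by auto
    qed
    then show ?thesis
      using card_image[OF inj_on_subset[OF fM(1)], of "{B \<in> M. P (M.dn B) (M.un B)}"] by auto
  qed
  fix A assume A: "A \<in> M"
  have fA: "f A \<in> N"
    using A fM(2) by blast
  have "card (N.twins (f A)) = card (M.twins A)"
    unfolding N.twins_def M.twins_def du[OF A] by (rule count)
  moreover have "1 \<le> M.twin_rank A" "M.twin_rank A \<le> card (M.twins A)"
  proof -
    have fin: "finite (M.twins A)"
      using M.finite_M by (simp add: M.twins_def)
    then show "M.twin_rank A \<le> card (M.twins A)"
      unfolding M.twin_rank_def by (intro card_mono) auto
    have "A \<in> {B \<in> M.twins A. opener B \<le> opener A}"
      using A by (simp add: M.twins_def)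
    then have "0 < M.twin_rank A"
      unfolding M.twin_rank_def using fin by (auto simp: card_gt_0_iff)
    then show "1 \<le> M.twin_rank A"
      by simp
  qed
  ultimately obtain B where B: "B \<in> N.twins (f A)" "N.twin_rank B = M.twin_rank A"
    using N.twin_of_rank_ex[OF fA] by metis
  have BN: "B \<in> N" "N.dn B = M.dn A" "N.un B = M.un A"
    using B(1) du[OF A] by (auto simp: N.twins_def)
  have "opener B = N.dn B + card {C \<in> N. N.dn C < N.dn B \<or> N.dn C = N.dn B \<and> N.un B < N.un C} + N.twin_rank B"
    by (rule N.opener_rank[OF BN(1)])
  also have "\<dots> = M.dn A + card {C \<in> M. M.dn C < M.dn A \<or> M.dn C = M.dn A \<and> M.un A < M.un C} + M.twin_rank A"
    unfolding BN(2,3) B(2) count[of "\<lambda>d u. d < M.dn A \<or> d = M.dn A \<and> M.un A < u"] ..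
  also have "\<dots> = opener A"
    by (rule M.opener_rank[OF A, symmetric])
  finally have "opener B = opener A" .
  moreover have "closer B = closer A"
  proof -
    have "closer B = n - N.un B + card {C \<in> N. N.un B < N.un C \<or> N.un C = N.un B \<and> N.dn C < N.dn B} + N.twin_rank B"
      by (rule N.closer_rank[OF BN(1)])
    also have "\<dots> = n - M.un A + card {C \<in> M. M.un A < M.un C \<or> M.un C = M.un A \<and> M.dn C < M.dn A} + M.twin_rank A"
      unfolding BN(2,3) B(2) count[of "\<lambda>d u. M.un A < u \<or> u = M.un A \<and> d < M.dn A"] ..
    also have "\<dots> = closer A"
      by (rule M.closer_rank[OF A, symmetric])
    finally show ?thesis .
  qed
  ultimately show "A \<in> N"
    using M.arc(1)[OF A] N.arc(1)[OF BN(1)] BN(1) by metis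
qed

lemma stoimenow_matching_iso_eq:
  assumes "stoimenow_matching n M" "stoimenow_matching n N" "poset_iso (arc_poset M) (arc_poset N)"
  shows "M = N"
  using stoimenow_matching_iso_subset[OF assms] stoimenow_matching_iso_subset[OF assms(2,1) poset_iso_sym[OF assms(3)]]
  by simp

section \<open>Construction of the Stoimenow matching of an interval order\<close>

context
  fixes r :: "nat rel" and n :: nat
  assumes po: "Partial_order r" and fin: "finite (Field r)" and card_F: "card (Field r) = n"
    and free: "\<not> has_2_plus_2 r"
begin

private abbreviation "F \<equiv> Field r"
private abbreviation "dr x \<equiv> card (down r x)"
private abbreviation "ur x \<equiv> card (up r x)"

text \<open>The order of the openers and the order of the closers in the matching to be constructed.\<close>

private definition opre :: "nat \<Rightarrow> nat \<Rightarrow> bool" where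
  "opre y x \<longleftrightarrow> dr y < dr x \<or> dr y = dr x \<and> (ur x < ur y \<or> ur y = ur x \<and> y \<le> x)"

private definition cpre :: "nat \<Rightarrow> nat \<Rightarrow> bool" where
  "cpre y x \<longleftrightarrow> ur x < ur y \<or> ur y = ur x \<and> (dr y < dr x \<or> dr y = dr x \<and> y \<le> x)"

text \<open>This and \<open>cl\<close> are the formulas of \<open>opener_eq\<close> and
  \<open>closer_eq\<close>, with the ranks taken in the prescribed orders. In both orders the last
  tie is broken by the label, so points with the same down-set and up-set receive crossing
  arcs.\<close>

private definition op :: "nat \<Rightarrow> nat" where
  "op x = dr x + card {y \<in> F. opre y x}"

private definition cl :: "nat \<Rightarrow> nat" where
  "cl x = (n - ur x) + card {y \<in> F. cpre y x}"

private lemma fin_du: "finite (down r x)" "finite (up r x)" "dr x \<le> n" "ur x \<le> n"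
  using finite_subset[OF down_subset_Field fin] finite_subset[OF up_subset_Field fin]
    card_mono[OF fin down_subset_Field, of x] card_mono[OF fin up_subset_Field, of x] card_F by simp_all

private lemma down_mono: "dr x \<le> dr y \<Longrightarrow> down r x \<subseteq> down r y"
  using interval_order_down_chain[OF po free, of x y] card_seteq[OF fin_du(1)[of x], of "down r y"] by blast

private lemma up_mono: "ur x \<le> ur y \<Longrightarrow> up r x \<subseteq> up r y"
  using interval_order_up_chain[OF po free, of x y] card_seteq[OF fin_du(2)[of x], of "up r y"] by blast

private lemma pre_linear:
  "opre x x" "opre x y \<Longrightarrow> opre y z \<Longrightarrow> opre x z" "opre x y \<Longrightarrow> opre y x \<Longrightarrow> x = y" "opre x y \<or> opre y x"
  "cpre x x" "cpre x y \<Longrightarrow> cpre y z \<Longrightarrow> cpre x z" "cpre x y \<Longrightarrow> cpre y x \<Longrightarrow> x = y" "cpre x y \<or> cpre y x"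
  unfolding opre_def cpre_def by linarith+

private lemma rank_less:
  assumes "y \<in> F" "x \<noteq> y"
  shows "opre x y \<Longrightarrow> card {z \<in> F. opre z x} < card {z \<in> F. opre z y}"
    and "cpre x y \<Longrightarrow> card {z \<in> F. cpre z x} < card {z \<in> F. cpre z y}"
proof -
  show "card {z \<in> F. opre z x} < card {z \<in> F. opre z y}" if xy: "opre x y"
  proof (rule card_less_if_mem[of _ _ y])
    show "{z \<in> F. opre z x} \<subseteq> {z \<in> F. opre z y}"
      using pre_linear(2)[OF _ xy] by blast
    show "y \<in> {z \<in> F. opre z y}" "y \<notin> {z \<in> F. opre z x}"
      using assms pre_linear(1,3) xy by blast+
  qed (use fin in simp)
  show "card {z \<in> F. cpre z x} < card {z \<in> F. cpre z y}" if xy: "cpre x y"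
  proof (rule card_less_if_mem[of _ _ y])
    show "{z \<in> F. cpre z x} \<subseteq> {z \<in> F. cpre z y}"
      using pre_linear(6)[OF _ xy] by blast
    show "y \<in> {z \<in> F. cpre z y}" "y \<notin> {z \<in> F. cpre z x}"
      using assms pre_linear(5,7) xy by blast+
  qed (use fin in simp)
qed

text \<open>Along the order the size of the down-set grows weakly and the rank strictly. Hence a
  step of exactly one leaves the down-set unchanged, which is what the Stoimenow condition
  needs.\<close>

private lemma op_less:
  assumes "y \<in> F" "x \<noteq> y" "opre x y"
  shows "op x < op y" "op y = Suc (op x) \<Longrightarrow> dr x = dr y"
  using rank_less(1)[OF assms] assms(3) unfolding op_def opre_def by linarith+

private lemma cl_less:
  assumes "y \<in> F" "x \<noteq> y" "cpre x y"
  shows "cl x < cl y" "cl y = Suc (cl x) \<Longrightarrow> ur x = ur y"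
  using rank_less(2)[OF assms] assms(3) fin_du(4)[of x] fin_du(4)[of y] unfolding cl_def cpre_def by linarith+

private lemma op_inj: "x \<in> F \<Longrightarrow> y \<in> F \<Longrightarrow> op x = op y \<longleftrightarrow> x = y"
  using op_less(1)[of y x] op_less(1)[of x y] pre_linear(4)[of x y] by fastforce

private lemma cl_inj: "x \<in> F \<Longrightarrow> y \<in> F \<Longrightarrow> cl x = cl y \<longleftrightarrow> x = y"
  using cl_less(1)[of y x] cl_less(1)[of x y] pre_linear(8)[of x y] by fastforce

private lemma op_less_iff: "x \<in> F \<Longrightarrow> y \<in> F \<Longrightarrow> op x < op y \<longleftrightarrow> opre x y \<and> x \<noteq> y"
  using op_less(1)[of y x] op_less(1)[of x y] pre_linear(4)[of x y] by fastforce

private lemma cl_less_iff: "x \<in> F \<Longrightarrow> y \<in> F \<Longrightarrow> cl x < cl y \<longleftrightarrow> cpre x y \<and> x \<noteq> y"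
  using cl_less(1)[of y x] cl_less(1)[of x y] pre_linear(8)[of x y] by fastforce

private lemma card_not_up: "card (F - up r x) = n - ur x"
  using card_Diff_subset[OF fin_du(2) up_subset_Field] card_F by simp

text \<open>The summands are compared crosswise. Points closed no later than x have at least the
  up-set of x and so lie below y; points not above x have a smaller down-set than y and are opened
  before y, and y itself makes this inequality strict.\<close>

private lemma cl_less_op:
  assumes xy: "(x, y) \<in> strict r"
  shows "cl x < op y"
proof -
  have y: "y \<in> F"
    using xy unfolding strict_iff by (auto intro: FieldI2)
  have "{z \<in> F. cpre z x} \<subseteq> down r y"
  proof
    fix z assume "z \<in> {z \<in> F. cpre z x}"
    then have "up r x \<subseteq> up r z"
      by (intro up_mono) (auto simp: cpre_def)
    then show "z \<in> down r y"
      using xy by (auto simp: up_def down_def)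
  qed
  then have "card {z \<in> F. cpre z x} \<le> dr y"
    by (rule card_mono[OF fin_du(1)])
  moreover have "card (F - up r x) < card {z \<in> F. opre z y}"
  proof (rule card_less_if_mem[of _ _ y])
    show "F - up r x \<subseteq> {z \<in> F. opre z y}"
    proof
      fix z assume z: "z \<in> F - up r x"
      then have "\<not> down r y \<subseteq> down r z"
        using xy by (auto simp: up_def down_def)
      then have "dr z < dr y"
        using down_mono by (meson not_le)
      then show "z \<in> {z \<in> F. opre z y}"
        using z by (simp add: opre_def)
    qed
    show "y \<in> {z \<in> F. opre z y}" "y \<notin> F - up r x"
      using y xy pre_linear(1) by (auto simp: up_def)
  qed (use fin in simp)
  ultimately show ?thesis
    unfolding op_def cl_def card_not_up by linarith
qed

text \<open>The converse comparison, again crosswise: points opened no later than y are not above x,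
  and points below y have a larger up-set than x and close before x. Here x itself gives
  strictness.\<close>

private lemma op_less_cl:
  assumes x: "x \<in> F" and xy: "(x, y) \<notin> strict r"
  shows "op y < cl x"
proof -
  have "{z \<in> F. opre z y} \<subseteq> F - up r x"
  proof
    fix z assume z: "z \<in> {z \<in> F. opre z y}"
    then have "down r z \<subseteq> down r y"
      by (intro down_mono) (auto simp: opre_def)
    then show "z \<in> F - up r x"
      using xy z by (auto simp: up_def down_def)
  qed
  then have "card {z \<in> F. opre z y} \<le> n - ur x"
    unfolding card_not_up[symmetric] using fin by (intro card_mono) auto
  moreover have "dr y < card {z \<in> F. cpre z x}"
  proof (rule card_less_if_mem[of _ _ x])
    show "down r y \<subseteq> {z \<in> F. cpre z x}"
    proof
      fix z assume z: "z \<in> down r y"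
      then have "\<not> up r z \<subseteq> up r x"
        using xy by (auto simp: up_def down_def)
      then have "ur x < ur z"
        using up_mono by (meson not_le)
      moreover have "z \<in> F"
        using subsetD[OF down_subset_Field z] .
      ultimately show "z \<in> {z \<in> F. cpre z x}"
        by (simp add: cpre_def)
    qed
    show "x \<in> {z \<in> F. cpre z x}" "x \<notin> down r y"
      using x xy pre_linear(5) by (auto simp: down_def)
  qed (use fin in simp)
  ultimately show ?thesis
    unfolding op_def cl_def by linarith
qed

private lemma not_strict_self: "(x, x) \<notin> strict r"
  by (simp add: strict_iff)

private lemma op_cl: "x \<in> F \<Longrightarrow> op x < cl x" "x \<in> F \<Longrightarrow> y \<in> F \<Longrightarrow> op x \<noteq> cl y"
proof -
  show "x \<in> F \<Longrightarrow> op x < cl x"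
    using op_less_cl not_strict_self by blast
  show "op x \<noteq> cl y" if "x \<in> F" "y \<in> F"
    using cl_less_op[of y x] op_less_cl[of y x] that by fastforce
qed

private lemma op_cl_range: "x \<in> F \<Longrightarrow> 1 \<le> op x" "x \<in> F \<Longrightarrow> cl x \<le> 2 * n"
proof -
  assume x: "x \<in> F"
  have "x \<in> {y \<in> F. opre y x}" "finite {y \<in> F. opre y x}"
    using x pre_linear(1) fin by auto
  then have "card {y \<in> F. opre y x} \<noteq> 0"
    by auto
  then show "1 \<le> op x"
    by (simp add: op_def)
  have "card {y \<in> F. cpre y x} \<le> n"
    unfolding card_F[symmetric] using fin by (intro card_mono) auto
  then show "cl x \<le> 2 * n"
    by (simp add: cl_def)
qed

private definition arcs :: "nat set set" where
  "arcs = (\<lambda>x. {op x, cl x}) ` F"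

private lemma arc_endpoints: "x \<in> F \<Longrightarrow> opener {op x, cl x} = op x" "x \<in> F \<Longrightarrow> closer {op x, cl x} = cl x"
  using op_cl(1)[of x] by simp_all

private lemma arcsE:
  assumes "{a, b} \<in> arcs" "a < b"
  obtains x where "x \<in> F" "a = op x" "b = cl x"
proof -
  obtain x where x: "x \<in> F" "{a, b} = {op x, cl x}"
    using assms(1) unfolding arcs_def by blast
  then have "a = op x" "b = cl x"
    using op_cl(1)[OF x(1)] assms(2) by (auto simp: doubleton_eq_iff)
  then show ?thesis
    using that x(1) by blast
qed

private lemma matching_arcs: "matching n arcs"
proof -
  have "op ` F \<union> cl ` F = {1..2 * n}"
  \<comment> \<open>The 2n positions are distinct and lie in \<open>{1..2 * n}\<close>, so they
    exhaust it.\<close>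
  proof (rule card_subset_eq)
    show "op ` F \<union> cl ` F \<subseteq> {1..2 * n}"
    proof
      fix i assume "i \<in> op ` F \<union> cl ` F"
      then obtain x where "x \<in> F" "i = op x \<or> i = cl x"
        by blast
      then show "i \<in> {1..2 * n}"
        using op_cl_range[of x] op_cl(1)[of x] by auto
    qed
    have "card (op ` F \<union> cl ` F) = card (op ` F) + card (cl ` F)"
      using fin op_cl(2) by (intro card_Un_disjoint) auto
    also have "card (op ` F) = n"
      using op_inj card_F by (subst card_image) (auto simp: inj_on_def)
    also have "card (cl ` F) = n"
      using cl_inj card_F by (subst card_image) (auto simp: inj_on_def)
    finally show "card (op ` F \<union> cl ` F) = card {1..2 * n}"
      by simp
  qed simp
  moreover have "\<Union>arcs = op ` F \<union> cl ` F"
    by (auto simp: arcs_def)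
  moreover have "disjoint arcs"
  proof (rule disjointI)
    fix A B assume AB: "A \<in> arcs" "B \<in> arcs" "A \<noteq> B"
    obtain x where x: "x \<in> F" "A = {op x, cl x}"
      using AB(1) unfolding arcs_def by blast
    obtain y where y: "y \<in> F" "B = {op y, cl y}"
      using AB(2) unfolding arcs_def by blast
    have "x \<noteq> y"
      using x y AB(3) by blast
    then show "A \<inter> B = {}"
      using op_inj[OF x(1) y(1)] cl_inj[OF x(1) y(1)] op_cl(2)[OF x(1) y(1)] op_cl(2)[OF y(1) x(1)] x(2) y(2) by auto
  qed
  moreover have "{} \<notin> arcs"
    by (auto simp: arcs_def)
  moreover have "card A = 2" if A: "A \<in> arcs" for A
  proof -
    obtain x where "x \<in> F" "A = {op x, cl x}"
      using A unfolding arcs_def by blast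
    then show ?thesis
      using op_cl(1)[of x] by simp
  qed
  ultimately show ?thesis
    unfolding matching_def partition_on_def by simp
qed

text \<open>Neighbouring openers have equal down-sets, so they were ordered by up-set and label,
  which orders their closers in the same way: the arcs cross. Dually for neighbouring
  closers.\<close>

private lemma stoimenow_arcs: "stoimenow arcs"
  unfolding stoimenow_def
proof (intro conjI notI; elim exE conjE)
  fix i k l assume h: "i + 1 < k" "k < l" "{i, l} \<in> arcs" "{i + 1, k} \<in> arcs"
  obtain x where x: "x \<in> F" "i = op x" "l = cl x"
    using arcsE[OF h(3)] h(1,2) by auto
  obtain y where y: "y \<in> F" "i + 1 = op y" "k = cl y"
    using arcsE[OF h(4) h(1)] by blast
  have xy: "opre x y" "x \<noteq> y"
    using op_less_iff[OF x(1) y(1)] x(2) y(2) by simp_all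
  then have "dr x = dr y"
    using op_less(2)[OF y(1) xy(2,1)] x(2) y(2) by simp
  then have "cpre x y"
    using xy(1) by (auto simp: opre_def cpre_def)
  then have "cl x < cl y"
    using cl_less(1)[OF y(1) xy(2)] by blast
  then show False
    using h(2) x(3) y(3) by simp
next
  fix k l j assume h: "k < l" "l < j" "{k, j + 1} \<in> arcs" "{l, j} \<in> arcs"
  obtain x where x: "x \<in> F" "k = op x" "j + 1 = cl x"
    using arcsE[OF h(3)] h(1,2) by auto
  obtain y where y: "y \<in> F" "l = op y" "j = cl y"
    using arcsE[OF h(4) h(2)] by blast
  have yx: "cpre y x" "y \<noteq> x"
    using cl_less_iff[OF y(1) x(1)] x(3) y(3) by simp_all
  then have "ur y = ur x"
    using cl_less(2)[OF x(1) yx(2,1)] x(3) y(3) by simp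
  then have "opre y x"
    using yx(1) by (auto simp: opre_def cpre_def)
  then have "op y < op x"
    using op_less(1)[OF x(1) yx(2)] by blast
  then show False
    using h(1) x(2) y(2) by simp
qed

private lemma iso_arcs: "poset_iso (arc_poset arcs) r"
proof (rule poset_iso_sym, rule poset_isoI[of "\<lambda>x. {op x, cl x}"])
  show "inj_on (\<lambda>x. {op x, cl x}) F"
  proof (rule inj_onI)
    fix x y assume xy: "x \<in> F" "y \<in> F" "{op x, cl x} = {op y, cl y}"
    then have "op x = op y"
      using arc_endpoints(1) by metis
    then show "x = y"
      using op_inj xy by blast
  qed
  show "Field (arc_poset arcs) = (\<lambda>x. {op x, cl x}) ` F"
    by (simp add: Field_arc_poset arcs_def)
  fix x y assume xy: "x \<in> F" "y \<in> F"
  have "{op x, cl x} = {op y, cl y} \<longleftrightarrow> x = y"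
    using op_inj[OF xy] arc_endpoints(1)[OF xy(1)] arc_endpoints(1)[OF xy(2)] by metis
  moreover have "cl x < op y \<longleftrightarrow> (x, y) \<in> strict r"
    using cl_less_op[of x y] op_less_cl[OF xy(1), of y] by fastforce
  moreover have "{op x, cl x} \<in> arcs" "{op y, cl y} \<in> arcs"
    using xy by (simp_all add: arcs_def)
  ultimately have "({op x, cl x}, {op y, cl y}) \<in> arc_poset arcs \<longleftrightarrow> x = y \<or> (x, y) \<in> strict r"
    unfolding arc_poset_iff arc_endpoints(2)[OF xy(1)] arc_endpoints(1)[OF xy(2)] by blast
  then show "({op x, cl x}, {op y, cl y}) \<in> arc_poset arcs \<longleftrightarrow> (x, y) \<in> r"
    using Partial_orderD(3)[OF po xy(1)] by (auto simp: strict_iff)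
qed

lemma stoimenow_matching_ex:
  "\<exists>M. matching n M \<and> stoimenow M \<and> poset_iso (arc_poset M) r"
  using matching_arcs stoimenow_arcs iso_arcs by blast

end

section \<open>Patterns in matchings\<close>

text \<open>Relabelling takes ranks, so it undoes every strictly increasing embedding: among the
  images of 1, ..., m the rank of \<open>h x\<close> is x.\<close>

lemma relabel_strict_mono_image:
  assumes mono: "strict_mono_on {1..m} h" and P: "\<Union>P = {1..m}"
  shows "relabel ((`) h ` P) = P"
proof -
  have U: "\<Union>((`) h ` P) = h ` {1..m}"
    using P by blast
  have rank: "card {u \<in> \<Union>((`) h ` P). u \<le> h x} = x" if x: "x \<in> {1..m}" for x
  proof -
    have "h y \<le> h x \<longleftrightarrow> y \<le> x" if "y \<in> {1..m}" for y
      using strict_mono_on_less_eq[OF mono that x] .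
    then have "{u \<in> \<Union>((`) h ` P). u \<le> h x} = h ` {1..x}"
      unfolding U using x by auto
    moreover have "inj_on h {1..x}"
      using strict_mono_on_imp_inj_on[OF mono] by (rule inj_on_subset) (use x in auto)
    ultimately show ?thesis
      by (simp add: card_image)
  qed
  have "(\<lambda>x. card {u \<in> \<Union>((`) h ` P). u \<le> x}) ` h ` B = B" if "B \<in> P" for B
  proof -
    have "B \<subseteq> {1..m}"
      using that P by blast
    then have "(\<lambda>x. card {u \<in> \<Union>((`) h ` P). u \<le> x}) ` h ` B = (\<lambda>x. x) ` B"
      unfolding image_image by (intro image_cong refl rank) blast
    then show ?thesis
      by simp
  qed
  then show ?thesis
    unfolding relabel_def image_image[of _ "(`) h" P] by simp
qed

lemma matching_contains_if_sorted:
  assumes "sorted_wrt (<) xs" "length xs = m" "\<Union>P = {1..m}"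
    and "\<And>B. B \<in> P \<Longrightarrow> (\<lambda>i. xs ! (i - 1)) ` B \<in> M"
  shows "matching_contains M P"
proof -
  let ?h = "\<lambda>i. xs ! (i - 1)"
  have "strict_mono_on {1..m} ?h"
  proof (rule strict_mono_onI)
    fix i j assume "i \<in> {1..m}" "j \<in> {1..m}" "i < j"
    then show "?h i < ?h j"
      using assms(2) by (intro sorted_wrt_nth_less[OF assms(1)]) auto
  qed
  then have "relabel ((`) ?h ` P) = P"
    using assms(3) by (rule relabel_strict_mono_image)
  moreover have "(`) ?h ` P \<subseteq> M"
    using assms(4) by blast
  ultimately show ?thesis
    unfolding matching_contains_def by blast
qed

lemma pattern_Union: "\<Union>pattern1 = {1..8}" "\<Union>pattern2 = {1..8}"
  unfolding pattern1_def pattern2_def by auto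

context perfect_matching
begin

text \<open>Ranks are weakly increasing in the position, so a strict inequality between labels lifts
  to the positions themselves; the comparabilities of the arcs are read off in this way.\<close>

lemma matching_contains_arcs:
  assumes "matching_contains M P"
  obtains \<rho> :: "nat \<Rightarrow> nat" where "\<And>x y. x \<le> y \<Longrightarrow> \<rho> x \<le> \<rho> y"
    "\<And>a b. {a, b} \<in> P \<Longrightarrow> a < b \<Longrightarrow> \<exists>A\<in>M. \<rho> (opener A) = a \<and> \<rho> (closer A) = b"
proof -
  obtain N where N: "N \<subseteq> M" "relabel N = P"
    using assms unfolding matching_contains_def by blast
  define \<rho> where "\<rho> x = card {u \<in> \<Union>N. u \<le> x}" for x
  have "finite (\<Union>N)"
  proof -
    have "\<Union>N \<subseteq> {1..2 * n}"
      using N(1) matching unfolding matching_def partition_on_def by blast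
    then show ?thesis
      using finite_subset by blast
  qed
  then have mono: "\<rho> x \<le> \<rho> y" if "x \<le> y" for x y
    unfolding \<rho>_def using that by (intro card_mono) auto
  have "\<exists>A\<in>M. \<rho> (opener A) = a \<and> \<rho> (closer A) = b" if ab: "{a, b} \<in> P" "a < b" for a b
  proof -
    obtain A where A: "A \<in> N" "{a, b} = \<rho> ` A"
      using ab(1) unfolding N(2)[symmetric] relabel_def \<rho>_def by blast
    have AM: "A \<in> M"
      using A(1) N(1) by blast
    have "\<rho> ` A = {\<rho> (opener A), \<rho> (closer A)}"
      by (subst arc(1)[OF AM]) simp
    moreover have "\<rho> (opener A) \<le> \<rho> (closer A)"
      using mono arc(2)[OF AM] by simp
    ultimately have "\<rho> (opener A) = a" "\<rho> (closer A) = b"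
      using A(2) ab(2) by (auto simp: doubleton_eq_iff)
    then show ?thesis
      using AM by blast
  qed
  then show ?thesis
    using that mono by blast
qed

lemma not_arc_below:
  assumes "A \<in> M" "B \<in> M"
  shows "(A, B) \<notin> arc_poset M \<longleftrightarrow> A \<noteq> B \<and> opener B < closer A"
  using assms endpoint_eq(3)[OF assms(2,1)] by (auto simp: arc_poset_iff not_less order.order_iff_strict)

text \<open>The arcs [1,3], [4,5], [6,8] are the chain; [2,7] overlaps the first and the last of
  them, which is what \<open>has_3_plus_1\<close> asks of the fourth point.\<close>

lemma has_3_plus_1_if_contains:
  assumes "matching_contains M pattern1"
  shows "has_3_plus_1 (arc_poset M)"
proof -
  obtain \<rho> :: "nat \<Rightarrow> nat" where \<rho>: "\<And>x y. x \<le> y \<Longrightarrow> \<rho> x \<le> \<rho> y"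
    "\<And>a b. {a, b} \<in> pattern1 \<Longrightarrow> a < b \<Longrightarrow> \<exists>A\<in>M. \<rho> (opener A) = a \<and> \<rho> (closer A) = b"
    using matching_contains_arcs[OF assms] by blast
  have less: "x < y" if "\<rho> x < \<rho> y" for x y
    using \<rho>(1)[of y x] that by (meson not_le)
  obtain A where A: "A \<in> M" "\<rho> (opener A) = 1" "\<rho> (closer A) = 3"
    using \<rho>(2)[of 1 3] by (auto simp: pattern1_def)
  obtain B where B: "B \<in> M" "\<rho> (opener B) = 2" "\<rho> (closer B) = 7"
    using \<rho>(2)[of 2 7] by (auto simp: pattern1_def)
  obtain C where C: "C \<in> M" "\<rho> (opener C) = 4" "\<rho> (closer C) = 5"
    using \<rho>(2)[of 4 5] by (auto simp: pattern1_def)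
  obtain D where D: "D \<in> M" "\<rho> (opener D) = 6" "\<rho> (closer D) = 8"
    using \<rho>(2)[of 6 8] by (auto simp: pattern1_def)
  have "closer A < opener C" "closer C < opener D" "opener B < closer A" "opener D < closer B"
    using A B C D by (auto intro: less)
  moreover have "A \<noteq> B" "B \<noteq> D"
    using A B D by auto
  ultimately show ?thesis
    unfolding has_3_plus_1_def strict_arc Field_arc_poset
    using A(1) B(1) C(1) D(1) not_arc_below[OF A(1) B(1)] not_arc_below[OF B(1) D(1)] by blast
qed

text \<open>The arcs [1,3], [2,5], [4,7], [6,8] are, in this order, the points a, b, c, d of
  \<open>has_N\<close>; each overlaps the next, and all other pairs are comparable.\<close>

lemma has_N_if_contains:
  assumes "matching_contains M pattern2"
  shows "has_N (arc_poset M)"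
proof -
  obtain \<rho> :: "nat \<Rightarrow> nat" where \<rho>: "\<And>x y. x \<le> y \<Longrightarrow> \<rho> x \<le> \<rho> y"
    "\<And>a b. {a, b} \<in> pattern2 \<Longrightarrow> a < b \<Longrightarrow> \<exists>A\<in>M. \<rho> (opener A) = a \<and> \<rho> (closer A) = b"
    using matching_contains_arcs[OF assms] by blast
  have less: "x < y" if "\<rho> x < \<rho> y" for x y
    using \<rho>(1)[of y x] that by (meson not_le)
  obtain A where A: "A \<in> M" "\<rho> (opener A) = 1" "\<rho> (closer A) = 3"
    using \<rho>(2)[of 1 3] by (auto simp: pattern2_def)
  obtain B where B: "B \<in> M" "\<rho> (opener B) = 2" "\<rho> (closer B) = 5"
    using \<rho>(2)[of 2 5] by (auto simp: pattern2_def)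
  obtain C where C: "C \<in> M" "\<rho> (opener C) = 4" "\<rho> (closer C) = 7"
    using \<rho>(2)[of 4 7] by (auto simp: pattern2_def)
  obtain D where D: "D \<in> M" "\<rho> (opener D) = 6" "\<rho> (closer D) = 8"
    using \<rho>(2)[of 6 8] by (auto simp: pattern2_def)
  have "closer A < opener C" "closer A < opener D" "closer B < opener D"
      "opener C < closer B" "opener D < closer C" "opener B < closer A"
    using A B C D by (auto intro: less)
  moreover have "A \<noteq> B" "B \<noteq> C" "C \<noteq> D"
    using A B C D by auto
  ultimately show ?thesis
    unfolding has_N_def strict_arc
    using A(1) B(1) C(1) D(1) not_arc_below[OF A(1) B(1)] not_arc_below[OF B(1) C(1)] not_arc_below[OF C(1) D(1)] by blast
qed

end

section \<open>Crossings forced by the Stoimenow condition\<close>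

context stoimenow_matching
begin

text \<open>
  The crossing arc is that of the first closer after the opener of \<open>B\<close>: it closes before \<open>B\<close> does, so it
  cannot have been opened in the same run as \<open>B\<close> or later.
\<close>

lemma crossed_from_left:
  assumes A: "A \<in> M" and B: "B \<in> M" and AB: "opener B < closer A" "closer A < closer B"
  shows "\<exists>C\<in>M. opener C < opener B \<and> opener B < closer C \<and> closer C \<le> closer A"
proof -
  define c where "c = (LEAST c. opener B < c \<and> c \<in> closer ` M)"
  have "opener B < closer A \<and> closer A \<in> closer ` M"
    using A AB(1) by blast
  then have c: "opener B < c" "c \<in> closer ` M" and c_min: "\<And>c'. opener B < c' \<Longrightarrow> c' \<in> closer ` M \<Longrightarrow> c \<le> c'"
    unfolding c_def by (metis (mono_tags, lifting) LeastI Least_le)+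
  then obtain C where C: "C \<in> M" "c = closer C"
    by blast
  have le: "closer C \<le> closer A"
    using c_min[of "closer A"] A AB(1) C(2) by blast
  have "opener C < opener B"
  proof (rule ccontr)
    assume "\<not> ?thesis"
    moreover have "B \<noteq> C"
      using le AB(2) by auto
    ultimately have BC: "opener B < opener C"
      using endpoint_eq(1)[OF B C(1)] by linarith
    have "down (arc_poset M) B = down (arc_poset M) C"
    proof -
      have "closer D < opener B \<longleftrightarrow> closer D < opener C" if D: "D \<in> M" for D
      proof
        assume "closer D < opener C"
        then have "\<not> opener B < closer D"
          using c_min[of "closer D"] D arc(2)[OF C(1)] C(2) by fastforce
        then show "closer D < opener B"
          using endpoint_eq(3)[OF B D] by linarith
      qed (use BC in simp)
      then show ?thesis
        unfolding down_arc[OF B] down_arc[OF C(1)] by blast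
    qed
    then have "closer B < closer C"
      using same_down[OF B C(1) BC] by simp
    then show False
      using le AB(2) by simp
  qed
  then show ?thesis
    using C c(1) le by blast
qed

text \<open>Dual to \<open>crossed_from_left\<close>: C has the last opener before the closer of B.
  If C closed before B, no opener would separate their closers, so their up-sets would agree and C
  would have been opened before B.\<close>

lemma crossed_from_right:
  assumes A: "A \<in> M" and B: "B \<in> M" and AB: "opener B < opener A" "opener A < closer B"
  shows "\<exists>C\<in>M. opener A \<le> opener C \<and> opener C < closer B \<and> closer B < closer C"
proof -
  let ?O = "{C \<in> M. opener C < closer B}"
  define c where "c = Max (opener ` ?O)"
  have fin: "finite (opener ` ?O)" "opener ` ?O \<noteq> {}"
    using finite_M A AB(2) by auto
  obtain C where C: "C \<in> M" "opener C < closer B" "c = opener C"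
    using Max_in[OF fin] unfolding c_def by blast
  have c_max: "opener D \<le> opener C" if "D \<in> M" "opener D < closer B" for D
    unfolding C(3)[symmetric] c_def using that by (intro Max_ge[OF fin(1)]) blast
  have le: "opener A \<le> opener C"
    using c_max[OF A AB(2)] .
  have "closer B < closer C"
  proof (rule ccontr)
    assume "\<not> ?thesis"
    moreover have "B \<noteq> C"
      using le AB(1) by auto
    ultimately have CB: "closer C < closer B"
      using endpoint_eq(2)[OF B C(1)] by linarith
    have "up (arc_poset M) C = up (arc_poset M) B"
    proof -
      have "closer C < opener D \<longleftrightarrow> closer B < opener D" if D: "D \<in> M" for D
      proof
        assume "closer C < opener D"
        then have "\<not> opener D < closer B"
          using c_max[OF D] arc(2)[OF C(1)] by fastforce
        then show "closer B < opener D"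
          using endpoint_eq(3)[OF D B] by linarith
      qed (use CB in simp)
      then show ?thesis
        unfolding up_arc[OF B] up_arc[OF C(1)] by blast
    qed
    then have "opener C < opener B"
      using same_up[OF C(1) B CB] by simp
    then show False
      using le AB(1) by simp
  qed
  then show ?thesis
    using C le by blast
qed

text \<open>The ends A and C of the chain may be nested in D. They are replaced by L and R, which
  cross D from the left and from the right; since L closes no later than A and R opens no earlier
  than C, the middle arc B still lies between them.\<close>

lemma contains_if_has_3_plus_1:
  assumes "has_3_plus_1 (arc_poset M)"
  shows "matching_contains M pattern1"
proof -
  obtain A B C D where h: "A \<in> M" "B \<in> M" "C \<in> M" "D \<in> M" "closer A < opener B" "closer B < opener C"
      "(A, D) \<notin> arc_poset M" "(D, C) \<notin> arc_poset M"
    using assms unfolding has_3_plus_1_def strict_arc Field_arc_poset by blast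
  then have h': "opener D < closer A" "opener C < closer D"
    using not_arc_below by blast+
  note arcs = arc(2)[OF h(1)] arc(2)[OF h(2)] arc(2)[OF h(3)] arc(2)[OF h(4)]
  obtain L where L: "L \<in> M" "opener L < opener D" "opener D < closer L" "closer L \<le> closer A"
    using crossed_from_left[OF h(1,4)] h h' arcs by force
  obtain R where R: "R \<in> M" "opener C \<le> opener R" "opener R < closer D" "closer D < closer R"
    using crossed_from_right[OF h(3,4)] h h' arcs by force
  show ?thesis
  proof (rule matching_contains_if_sorted[of
        "[opener L, opener D, closer L, opener B, closer B, opener R, closer D, closer R]" 8])
    show "sorted_wrt (<) [opener L, opener D, closer L, opener B, closer B, opener R, closer D, closer R]"
      using h h' arcs L R by auto
    fix X assume "X \<in> pattern1"
    then consider "X = {1, 3}" | "X = {2, 7}" | "X = {4, 5}" | "X = {6, 8}"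
      by (auto simp: pattern1_def)
    then show "(\<lambda>i. [opener L, opener D, closer L, opener B, closer B, opener R, closer D, closer R] ! (i - 1)) ` X \<in> M"
      using arc(1)[OF L(1)] arc(1)[OF R(1)] arc(1)[OF h(2)] arc(1)[OF h(4)] L(1) R(1) h(2,4) by cases simp_all
  qed (simp_all add: pattern_Union)
qed

text \<open>Here A may be nested in B, and D in C. The arc L crosses B from the left and closes no
  later than A, hence before C opens; the arc R crosses C from the right and opens no earlier than
  D, hence after B closes.\<close>

lemma contains_if_has_N:
  assumes "has_N (arc_poset M)"
  shows "matching_contains M pattern2"
proof -
  obtain A B C D where h: "A \<in> M" "B \<in> M" "C \<in> M" "D \<in> M" "closer A < opener C" "closer A < opener D" "closer B < opener D"
      "(B, C) \<notin> arc_poset M" "(C, D) \<notin> arc_poset M" "(A, B) \<notin> arc_poset M"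
    using assms unfolding has_N_def strict_arc by blast
  then have h': "opener C < closer B" "opener D < closer C" "opener B < closer A"
    using not_arc_below by blast+
  note arcs = arc(2)[OF h(1)] arc(2)[OF h(2)] arc(2)[OF h(3)] arc(2)[OF h(4)]
  obtain L where L: "L \<in> M" "opener L < opener B" "opener B < closer L" "closer L \<le> closer A"
    using crossed_from_left[OF h(1,2)] h h' arcs by force
  obtain R where R: "R \<in> M" "opener D \<le> opener R" "opener R < closer C" "closer C < closer R"
    using crossed_from_right[OF h(4,3)] h h' arcs by force
  show ?thesis
  proof (rule matching_contains_if_sorted[of
        "[opener L, opener B, closer L, opener C, closer B, opener R, closer C, closer R]" 8])
    show "sorted_wrt (<) [opener L, opener B, closer L, opener C, closer B, opener R, closer C, closer R]"
      using h h' arcs L R by auto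
    fix X assume "X \<in> pattern2"
    then consider "X = {1, 3}" | "X = {2, 5}" | "X = {4, 7}" | "X = {6, 8}"
      by (auto simp: pattern2_def)
    then show "(\<lambda>i. [opener L, opener B, closer L, opener C, closer B, opener R, closer C, closer R] ! (i - 1)) ` X \<in> M"
      using arc(1)[OF L(1)] arc(1)[OF R(1)] arc(1)[OF h(2)] arc(1)[OF h(3)] L(1) R(1) h(2,3) by cases simp_all
  qed (simp_all add: pattern_Union)
qed

section \<open>Statistics of matchings\<close>

lemma min_count_arcs: "min_count (arc_poset M) = card {A \<in> M. down (arc_poset M) A = {}}"
proof -
  have "(\<forall>y. (y, A) \<in> arc_poset M \<longrightarrow> y = A) \<longleftrightarrow> down (arc_poset M) A = {}" for A
    by (auto simp: down_def strict_iff)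
  then show ?thesis
    by (simp add: min_count_def Field_arc_poset)
qed

text \<open>The arc F with opener 1 closes first of all arcs. An arc that crosses F or equals it in
  a crossing is opened before F closes, hence before every closer, and so is minimal. Conversely the
  minimal arcs have equal down-sets, so they open and close in the same order, and all of them are
  opened before the first closer: together they form one crossing, which contains F.\<close>

lemma fcr_eq_min_count: "fcr M = min_count (arc_poset M)"
proof (cases "M = {}")
  case True
  then show ?thesis
    unfolding min_count_arcs by (simp add: fcr_def)
next
  case False
  let ?D = "{A \<in> M. down (arc_poset M) A = {}}"
  have "n \<noteq> 0"
    using False card_M finite_M by auto
  have dn0: "closer B > opener A" if "A \<in> ?D" "B \<in> M" for A B
    using that endpoint_eq(3)[of A B] by (auto simp: down_arc not_less order.order_iff_strict)
  have "1 \<in> opener ` M \<union> closer ` M"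
    unfolding endpoints using \<open>n \<noteq> 0\<close> by simp
  moreover have "closer A \<noteq> 1" if "A \<in> M" for A
    using arc(2,3)[OF that] by simp
  ultimately obtain F where F: "F \<in> M" "opener F = 1"
    by (metis UnE imageE)
  have FD: "F \<in> ?D"
    using F arc(2,3) by (fastforce simp: down_arc)
  have D_mono: "closer A < closer B" if "A \<in> ?D" "B \<in> ?D" "opener A < opener B" for A B
    using same_down[of A B] that by simp
  \<comment> \<open>The arc C with the first closer of all is minimal. As minimal arcs close in the
    order in which they open, F closes no later than C.\<close>
  have first_closer: "closer F \<le> closer B" if B: "B \<in> M" for B
  proof -
    have "Min (closer ` M) \<in> closer ` M"
      using finite_M False by (intro Min_in) simp_all
    then obtain C where C: "Min (closer ` M) = closer C" "C \<in> M"
      by (rule imageE)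
    note C = C(2,1)
    have C_min: "closer C \<le> closer D" if "D \<in> M" for D
      unfolding C(2)[symmetric] using finite_M that by simp
    have "down (arc_poset M) C = {}"
      using C_min arc(2)[OF C(1)] by (fastforce simp: down_arc[OF C(1)])
    then have CD: "C \<in> ?D"
      using C(1) by simp
    have "F = C \<or> opener F < opener C"
      using arc(3)[OF C(1)] F endpoint_eq(1)[OF F(1) C(1)] by linarith
    then have "closer F \<le> closer C"
      using D_mono[OF FD CD] by auto
    then show ?thesis
      using C_min[OF B] by simp
  qed
  let ?X = "{length us | us vs. crossing M us vs \<and> 1 \<in> set us}"
  have upper: "k \<le> card ?D" if k: "k \<in> ?X" for k
  proof -
    obtain us vs where uv: "k = length us" "crossing M us vs" "1 \<in> set us"
      using k by blast
    have len: "length vs = length us" and srt: "sorted_wrt (<) us" "sorted_wrt (<) vs"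
        "\<And>u v. u \<in> set us \<Longrightarrow> v \<in> set vs \<Longrightarrow> u < v"
        and arcs: "\<And>i. i < length us \<Longrightarrow> {us ! i, vs ! i} \<in> M"
      using uv(2) unfolding crossing_def by (auto simp: sorted_wrt_append)
    have oc: "opener {us ! i, vs ! i} = us ! i" "closer {us ! i, vs ! i} = vs ! i" if "i < length us" for i
      using srt(3)[of "us ! i" "vs ! i"] that len by simp_all
    obtain j where j: "j < length us" "us ! j = 1"
      using uv(3) by (auto simp: in_set_conv_nth)
    then have "{us ! j, vs ! j} = F"
      using endpoint_eq(1)[OF arcs[OF j(1)] F(1)] oc(1)[OF j(1)] F(2) by simp
    then have Fj: "closer F = vs ! j"
      using oc(2)[OF j(1)] by simp
    have "(\<lambda>i. {us ! i, vs ! i}) ` {..<length us} \<subseteq> ?D"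
    proof
      fix A assume "A \<in> (\<lambda>i. {us ! i, vs ! i}) ` {..<length us}"
      then obtain i where i: "i < length us" "A = {us ! i, vs ! i}"
        by blast
      have A: "A \<in> M" "opener A = us ! i"
        using arcs[OF i(1)] oc(1)[OF i(1)] i(2) by simp_all
      have "us ! i < closer F"
        using srt(3)[of "us ! i" "vs ! j"] i(1) j(1) len Fj by simp
      then show "A \<in> ?D"
        using first_closer A by (fastforce simp: down_arc[OF A(1)])
    qed
    moreover have "inj_on (\<lambda>i. {us ! i, vs ! i}) {..<length us}"
    proof (rule inj_onI)
      fix i i' assume i: "i \<in> {..<length us}" "i' \<in> {..<length us}" "{us ! i, vs ! i} = {us ! i', vs ! i'}"
      then have "us ! i = us ! i'"
        using oc(1)[of i] oc(1)[of i'] by simp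
      moreover have "distinct us"
        using srt(1) by (simp add: strict_sorted_iff)
      ultimately show "i = i'"
        using i(1,2) by (simp add: nth_eq_iff_index_eq)
    qed
    ultimately have "card {..<length us} \<le> card ?D"
      using finite_M by (intro card_inj_on_le) auto
    then show ?thesis
      using uv(1) by simp
  qed
  have "card ?D \<in> ?X"
  proof -
    define us where "us = sorted_list_of_set (opener ` ?D)"
    define f where "f u = (THE A. A \<in> M \<and> opener A = u)" for u
    have f: "f (opener A) = A" if "A \<in> M" for A
      unfolding f_def using endpoint_eq(1) that by (intro the_equality) auto
    have us: "set us = opener ` ?D" "sorted_wrt (<) us" "length us = card ?D"
    proof -
      have "card (opener ` ?D) = card ?D"
        using inj_on_subset[OF inj_endpoints(1)] by (intro card_image) auto
      then show "set us = opener ` ?D" "sorted_wrt (<) us" "length us = card ?D"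
        using finite_M by (simp_all add: us_def)
    qed
    have in_D: "f u \<in> ?D" "opener (f u) = u" if "u \<in> set us" for u
      using that f unfolding us(1) by auto
    define vs where "vs = map (\<lambda>u. closer (f u)) us"
    have "crossing M us vs"
      unfolding crossing_def
    proof (intro conjI allI impI)
      show "us \<noteq> []"
        using FD us(1) by auto
      show "length us = length vs"
        by (simp add: vs_def)
      have "closer (f u) < closer (f v)" if "u \<in> set us" "v \<in> set us" "u < v" for u v
        using D_mono[OF in_D(1)[OF that(1)] in_D(1)[OF that(2)]] in_D(2)[OF that(1)] in_D(2)[OF that(2)] that(3)
        by simp
      then have "sorted_wrt (\<lambda>u v. closer (f u) < closer (f v)) us"
        by (rule sorted_wrt_mono_rel[OF _ us(2)])
      then have "sorted_wrt (<) vs"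
        by (simp add: vs_def sorted_wrt_map)
      moreover have "u < v" if "u \<in> set us" "v \<in> set vs" for u v
      proof -
        obtain w where w: "w \<in> set us" "v = closer (f w)"
          using \<open>v \<in> set vs\<close> by (auto simp: vs_def)
        then show ?thesis
          using dn0[OF in_D(1)[OF \<open>u \<in> set us\<close>], of "f w"] in_D[OF w(1)] in_D(2)[OF \<open>u \<in> set us\<close>] by simp
      qed
      ultimately show "sorted_wrt (<) (us @ vs)"
        using us(2) by (simp add: sorted_wrt_append)
      fix i assume i: "i < length us"
      then have "f (us ! i) \<in> M" "opener (f (us ! i)) = us ! i"
        using in_D[of "us ! i"] by simp_all
      then show "{us ! i, vs ! i} \<in> M"
        using arc(1)[of "f (us ! i)"] i by (simp add: vs_def)
    qed
    moreover have "1 \<in> set us"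
      unfolding us(1) using FD F(2) by force
    ultimately show ?thesis
      using us(3) by (intro CollectI exI[of _ us] exI[of _ vs]) simp
  qed
  moreover have "finite ?X"
    using upper by (meson finite_nat_set_iff_bounded_le)
  ultimately have "Max ?X = card ?D"
    using upper by (intro Max_eqI) auto
  then show ?thesis
    using False by (simp add: fcr_def min_count_arcs)
qed

end

section \<open>Juxtaposition of matchings and ordinal sums\<close>

definition shift :: "nat \<Rightarrow> nat set set \<Rightarrow> nat set set" where
  "shift k M = (\<lambda>B. (\<lambda>x. k + x) ` B) ` M"

lemma juxtapose_Cons: "juxtapose (M # Ms) = M \<union> shift (2 * card M) (juxtapose Ms)"
  by (simp add: shift_def)

lemma opener_closer_shift:
  "finite B \<Longrightarrow> B \<noteq> {} \<Longrightarrow> opener ((\<lambda>x. k + x) ` B) = k + opener B"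
  "finite B \<Longrightarrow> B \<noteq> {} \<Longrightarrow> closer ((\<lambda>x. k + x) ` B) = k + closer B"
  by (simp_all add: mono_Min_commute[symmetric] mono_Max_commute[symmetric] monoI)

lemma inj_image_shift: "inj (\<lambda>B. (\<lambda>x. k + x) ` B :: nat set)"
  by (rule injI, rule inj_image_eq_iff[THEN iffD1, of "\<lambda>x. k + x"]) simp_all

lemma perfect_matchingI: "matching n M \<Longrightarrow> perfect_matching n M"
  by unfold_locales

lemma matching_card: "matching n M \<Longrightarrow> card M = n"
  using perfect_matching.card_M[OF perfect_matchingI] .

lemma matching_finite: "matching n M \<Longrightarrow> finite M"
  using perfect_matching.finite_M[OF perfect_matchingI] .

lemma arc_finite: "matching n M \<Longrightarrow> B \<in> M \<Longrightarrow> finite B \<and> B \<noteq> {}"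
  unfolding matching_def by (metis card.empty card.infinite zero_neq_numeral)

lemma card_image_shift: "card ((\<lambda>x. k + x) ` B) = card B" for k :: nat
  by (rule card_image) simp

lemma partition_on_Un:
  assumes P: "partition_on A P" and Q: "partition_on B Q" and "A \<inter> B = {}"
  shows "partition_on (A \<union> B) (P \<union> Q)"
proof (rule partition_onI)
  fix p q assume pq: "p \<in> P \<union> Q" "q \<in> P \<union> Q" "p \<noteq> q"
  have sub: "r \<in> P \<Longrightarrow> r \<subseteq> A" "r \<in> Q \<Longrightarrow> r \<subseteq> B" for r
    using partition_onD1[OF P] partition_onD1[OF Q] by blast+
  have "disjnt p q" if "p \<in> P" "q \<in> P"
    using pairwiseD[OF partition_onD2[OF P] that pq(3)] .
  moreover have "disjnt p q" if "p \<in> Q" "q \<in> Q"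
    using pairwiseD[OF partition_onD2[OF Q] that pq(3)] .
  moreover have "disjnt p q" if "p \<in> P \<and> q \<in> Q \<or> p \<in> Q \<and> q \<in> P"
    using that sub[of p] sub[of q] assms(3) unfolding disjnt_def by blast
  ultimately show "disjnt p q"
    using pq(1,2) by blast
next
  show "\<Union>(P \<union> Q) = A \<union> B"
    using partition_onD1[OF P] partition_onD1[OF Q] by simp
  show "{} \<notin> P \<union> Q"
    using partition_onD3[OF P] partition_onD3[OF Q] by simp
qed

lemma matching_append:
  assumes M: "matching a M" and N: "matching b N"
  shows "matching (a + b) (M \<union> shift (2 * a) N)"
proof -
  have "partition_on ((\<lambda>x. 2 * a + x) ` {1..2 * b}) (shift (2 * a) N - {{}})"
    unfolding shift_def using N by (intro partition_on_inj_image) (simp_all add: matching_def)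
  moreover have "{} \<notin> shift (2 * a) N"
    using arc_finite[OF N] by (auto simp: shift_def)
  moreover have "(\<lambda>x. 2 * a + x) ` {1..2 * b} = {2 * a + 1..2 * a + 2 * b}"
    by simp
  ultimately have "partition_on {2 * a + 1..2 * a + 2 * b} (shift (2 * a) N)"
    by (simp add: add.commute)
  moreover have "partition_on {1..2 * a} M"
    using M by (simp add: matching_def)
  ultimately have "partition_on ({1..2 * a} \<union> {2 * a + 1..2 * a + 2 * b}) (M \<union> shift (2 * a) N)"
    by (intro partition_on_Un) auto
  moreover have "{1..2 * a} \<union> {2 * a + 1..2 * a + 2 * b} = {1..2 * (a + b)}"
    by auto
  moreover have "card B = 2" if "B \<in> M \<union> shift (2 * a) N" for B
    using that M N by (auto simp: matching_def shift_def card_image_shift)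
  ultimately show ?thesis
    by (simp add: matching_def)
qed

lemma arc_poset_shift:
  assumes N: "matching b N"
  shows "poset_iso (arc_poset N) (arc_poset (shift k N))"
proof (rule poset_isoI[of "\<lambda>B. (\<lambda>x. k + x) ` B"])
  show "inj_on (\<lambda>B. (\<lambda>x. k + x) ` B) (Field (arc_poset N))"
    using inj_image_shift by (rule inj_on_subset) simp
  show "Field (arc_poset (shift k N)) = (\<lambda>B. (\<lambda>x. k + x) ` B) ` Field (arc_poset N)"
    by (simp add: Field_arc_poset shift_def)
  fix A B assume "A \<in> Field (arc_poset N)" "B \<in> Field (arc_poset N)"
  then have AB: "A \<in> N" "B \<in> N"
    by (simp_all add: Field_arc_poset)
  have "(\<lambda>x. k + x) ` A = (\<lambda>x. k + x) ` B \<longleftrightarrow> A = B"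
    using injD[OF inj_image_shift] by blast
  moreover have "(\<lambda>x. k + x) ` A \<in> shift k N" "(\<lambda>x. k + x) ` B \<in> shift k N"
    using AB by (simp_all add: shift_def)
  ultimately show "((\<lambda>x. k + x) ` A, (\<lambda>x. k + x) ` B) \<in> arc_poset (shift k N) \<longleftrightarrow> (A, B) \<in> arc_poset N"
    using AB arc_finite[OF N AB(1)] arc_finite[OF N AB(2)] by (simp add: arc_poset_iff opener_closer_shift)
qed

text \<open>All endpoints of M precede those of the shifted matching, so every arc of the first lies
  below every arc of the second.\<close>

lemma arc_poset_append:
  assumes M: "matching a M" and N: "matching b N"
  shows "arc_poset (M \<union> shift (2 * a) N) = ordinal_sum (arc_poset M) (arc_poset (shift (2 * a) N))"
    and "M \<inter> shift (2 * a) N = {}"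
proof -
  interpret M: perfect_matching a M
    using M by (rule perfect_matchingI)
  interpret N: perfect_matching b N
    using N by (rule perfect_matchingI)
  have shift: "2 * a < opener B \<and> opener B < closer B" if B: "B \<in> shift (2 * a) N" for B
  proof -
    obtain C where C: "C \<in> N" "B = (\<lambda>x. 2 * a + x) ` C"
      using B unfolding shift_def by blast
    then have "opener B = 2 * a + opener C" "closer B = 2 * a + closer C"
      using arc_finite[OF N C(1)] opener_closer_shift[of C "2 * a"] by blast+
    then show ?thesis
      using N.arc(2,3)[OF C(1)] by linarith
  qed
  have less: "closer A < opener B" if "A \<in> M" "B \<in> shift (2 * a) N" for A B
    using M.arc(4)[OF that(1)] shift[OF that(2)] by simp
  have not_less: "\<not> closer B < opener A" if "A \<in> M" "B \<in> shift (2 * a) N" for A B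
    using less[OF that] M.arc(2)[OF that(1)] shift[OF that(2)] by simp
  have "A \<noteq> B" if "A \<in> M" "B \<in> shift (2 * a) N" for A B
    using less[OF that] M.arc(2)[OF that(1)] by auto
  then show disj: "M \<inter> shift (2 * a) N = {}"
    by blast
  show "arc_poset (M \<union> shift (2 * a) N) = ordinal_sum (arc_poset M) (arc_poset (shift (2 * a) N))"
  proof (intro subset_antisym subrelI)
    fix A B assume "(A, B) \<in> arc_poset (M \<union> shift (2 * a) N)"
    then show "(A, B) \<in> ordinal_sum (arc_poset M) (arc_poset (shift (2 * a) N))"
      using not_less unfolding ordinal_sum_def Un_iff mem_Sigma_iff Field_arc_poset arc_poset_iff by blast
  next
    fix A B assume "(A, B) \<in> ordinal_sum (arc_poset M) (arc_poset (shift (2 * a) N))"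
    then show "(A, B) \<in> arc_poset (M \<union> shift (2 * a) N)"
      using less unfolding ordinal_sum_def Un_iff mem_Sigma_iff Field_arc_poset arc_poset_iff by blast
  qed
qed

lemma card_cuts_append:
  assumes M: "matching a M" and N: "matching b N"
  shows "card (cuts (arc_poset (M \<union> shift (2 * a) N))) = card (cuts (arc_poset M)) + card (cuts (arc_poset N))"
proof -
  have "finite (shift (2 * a) N)"
    using matching_finite[OF N] by (simp add: shift_def)
  then have "card (cuts (arc_poset (M \<union> shift (2 * a) N))) = card (cuts (arc_poset M)) + card (cuts (arc_poset (shift (2 * a) N)))"
    unfolding arc_poset_append(1)[OF M N] using arc_poset_append(2)[OF M N] matching_finite[OF M]
    by (intro card_cuts_ordinal_sum) (simp_all add: Field_arc_poset)
  then show ?thesis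
    using poset_iso_cuts[OF arc_poset_shift[OF N]] by simp
qed

context perfect_matching
begin

lemma openers_eq: "openers M = opener ` M" and closers_eq: "closers M = closer ` M"
proof -
  have "a \<in> opener ` M" "b \<in> closer ` M" if "{a, b} \<in> M" "a < b" for a b
  proof -
    have "opener {a, b} = a" "closer {a, b} = b"
      using that(2) by simp_all
    then show "a \<in> opener ` M" "b \<in> closer ` M"
      using that(1) by (metis imageI)+
  qed
  moreover have "\<exists>b. opener A < b \<and> {opener A, b} \<in> M" "\<exists>a. a < closer A \<and> {a, closer A} \<in> M" if "A \<in> M" for A
    using arc(1,2)[OF that] that by auto
  ultimately show "openers M = opener ` M" "closers M = closer ` M"
    unfolding openers_def closers_def by blast+
qed

lemma card_endpoints_upto:
  "card (openers M \<inter> {1..i}) = card {A \<in> M. opener A \<le> i}"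
  "card (closers M \<inter> {1..i}) = card {A \<in> M. closer A \<le> i}"
proof -
  have "openers M \<inter> {1..i} = opener ` {A \<in> M. opener A \<le> i}"
    using arc(3) by (auto simp: openers_eq)
  then show "card (openers M \<inter> {1..i}) = card {A \<in> M. opener A \<le> i}"
    using card_image[OF inj_on_subset[OF inj_endpoints(1)], of "{A \<in> M. opener A \<le> i}"] by auto
  have "closers M \<inter> {1..i} = closer ` {A \<in> M. closer A \<le> i}"
    using arc(2,3) by (force simp: closers_eq)
  then show "card (closers M \<inter> {1..i}) = card {A \<in> M. closer A \<le> i}"
    using card_image[OF inj_on_subset[OF inj_endpoints(2)], of "{A \<in> M. closer A \<le> i}"] by auto
qed

text \<open>A nonempty cut produces a balanced position: up to the last closer of its arcs there are
  only endpoints of arcs of the cut, equally many openers and closers.\<close>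

lemma cuts_arc_poset_irreducible:
  assumes "M \<noteq> {}" "\<not> reducible_matching M"
  shows "cuts (arc_poset M) = {{}}"
proof -
  have "A = {}" if A: "A \<in> cuts (arc_poset M)" for A
  proof (rule ccontr)
    assume ne: "A \<noteq> {}"
    have sub: "A \<subset> M"
      using A by (simp add: cuts_def Field_arc_poset)
    have cut: "closer B < opener C" if "B \<in> A" "C \<in> M" "C \<notin> A" for B C
    proof -
      have "(B, C) \<in> arc_poset M"
        using A that unfolding cuts_def Field_arc_poset by blast
      then show ?thesis
        using that by (auto simp: arc_poset_iff)
    qed
    have fin: "finite A"
      using sub finite_M finite_subset by blast
    define q where "q = Max (closer ` A)"
    have q: "\<And>B. B \<in> A \<Longrightarrow> closer B \<le> q" "q \<in> closer ` A"
      unfolding q_def using fin ne by simp_all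
    then obtain B where B: "B \<in> A" "q = closer B"
      by blast
    have BM: "B \<in> M"
      using B(1) sub by blast
    have "C \<in> A \<longleftrightarrow> opener C \<le> q" "C \<in> A \<longleftrightarrow> closer C \<le> q" if C: "C \<in> M" for C
      using q(1)[of C] cut[OF B(1) C] B(2) arc(2)[OF C] by fastforce+
    then have sets: "{C \<in> M. opener C \<le> q} = A" "{C \<in> M. closer C \<le> q} = A"
      using sub by blast+
    then have "q = 2 * card A"
      using count_endpoints[of q] arc(4)[OF BM] B(2) by simp
    then have "card (openers M \<inter> {1..2 * card A}) = card (closers M \<inter> {1..2 * card A})"
      unfolding card_endpoints_upto using sets by simp
    moreover have "1 \<le> card A"
      using ne fin by (simp add: Suc_leI card_gt_0_iff)
    moreover have "card A < card M"
      using psubset_card_mono[OF finite_M sub] .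
    ultimately show False
      using assms(2) unfolding reducible_matching_def by blast
  qed
  moreover have "{} \<in> cuts (arc_poset M)"
    using assms(1) by (auto simp: cuts_def Field_arc_poset)
  ultimately show ?thesis
    by blast
qed

text \<open>An arc closed within the first 2i positions is also opened there; if the numbers agree,
  every arc opened there is closed there, so no arc straddles the end of this segment.\<close>

lemma balanced_split:
  assumes "i \<le> n" "card (openers M \<inter> {1..2 * i}) = card (closers M \<inter> {1..2 * i})"
  obtains M1 M2 where "matching i M1" "matching (n - i) M2" "M = M1 \<union> shift (2 * i) M2"
    "M1 = {A \<in> M. opener A \<le> 2 * i}"
proof -
  define M1 where "M1 = {A \<in> M. opener A \<le> 2 * i}"
  have sub: "{A \<in> M. closer A \<le> 2 * i} \<subseteq> M1"
    using arc(2) by (fastforce simp: M1_def)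
  moreover have "card M1 = card {A \<in> M. closer A \<le> 2 * i}"
    using assms(2) unfolding card_endpoints_upto by (simp add: M1_def)
  ultimately have M1': "{A \<in> M. closer A \<le> 2 * i} = M1"
    using finite_M by (intro card_subset_eq) (auto simp: M1_def)
  have part: "\<Union>M = {1..2 * n}" "{} \<notin> M" "\<And>B. B \<in> M \<Longrightarrow> card B = 2" "disjoint M"
    using matching by (auto simp: matching_def partition_on_def)
  have M1_le: "x \<le> 2 * i" if "A \<in> M1" "x \<in> A" for A x
  proof -
    have "A \<in> M" "closer A \<le> 2 * i"
      using that(1) M1' by blast+
    then show ?thesis
      using that(2) arc(1,2)[of A] by (metis insertE le_trans less_imp_le singletonD)
  qed
  have M2_ge: "2 * i < x" if "A \<in> M" "A \<notin> M1" "x \<in> A" for A x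
  proof -
    have "2 * i < opener A"
      using that(1,2) by (simp add: M1_def)
    then show ?thesis
      using that(1,3) arc(1,2)[of A] by (metis insertE less_trans singletonD)
  qed
  have U1: "\<Union>M1 = {1..2 * i}"
  proof (intro equalityI subsetI)
    fix x assume "x \<in> \<Union>M1"
    then obtain A where "A \<in> M1" "x \<in> A"
      by blast
    moreover from this have "x \<in> \<Union>M"
      by (auto simp: M1_def)
    ultimately show "x \<in> {1..2 * i}"
      using M1_le[of A x] part(1) by simp
  next
    fix x assume x: "x \<in> {1..2 * i}"
    then have "x \<in> \<Union>M"
      using part(1) assms(1) by simp
    then obtain A where "A \<in> M" "x \<in> A"
      by blast
    then have "A \<in> M1"
      using M2_ge[of A x] x by fastforce
    then show "x \<in> \<Union>M1"
      using \<open>x \<in> A\<close> by blast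
  qed
  have "disjoint M1"
    using part(4) by (rule pairwise_subset) (auto simp: M1_def)
  then have m1: "matching i M1"
    unfolding matching_def partition_on_def using U1 part by (auto simp: M1_def)
  define N where "N = M - M1"
  have "partition_on {2 * i + 1..2 * n} N"
  proof -
    have "\<Union>N = {2 * i + 1..2 * n}"
    proof (intro equalityI subsetI)
      fix x assume "x \<in> \<Union>N"
      then obtain A where A: "A \<in> M" "A \<notin> M1" "x \<in> A"
        by (auto simp: N_def)
      then have "x \<in> \<Union>M"
        by blast
      then show "x \<in> {2 * i + 1..2 * n}"
        using M2_ge[OF A] part(1) by simp
    next
      fix x assume x: "x \<in> {2 * i + 1..2 * n}"
      then have "x \<in> \<Union>M"
        using part(1) by simp
      then obtain A where "A \<in> M" "x \<in> A"
        by blast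
      then show "x \<in> \<Union>N"
        using M1_le[of A x] x by (fastforce simp: N_def)
    qed
    moreover have "disjoint N"
      using part(4) by (rule pairwise_subset) (auto simp: N_def)
    ultimately show ?thesis
      using part(2) by (auto simp: partition_on_def N_def)
  qed
  then have "partition_on ((\<lambda>x. x - 2 * i) ` {2 * i + 1..2 * n}) ((`) (\<lambda>x. x - 2 * i) ` N - {{}})"
    by (rule partition_on_inj_image) (auto simp: inj_on_def)
  moreover have "(\<lambda>x. x - 2 * i) ` {2 * i + 1..2 * n} = {1..2 * (n - i)}"
  proof (intro equalityI subsetI)
    fix y assume "y \<in> {1..2 * (n - i)}"
    then show "y \<in> (\<lambda>x. x - 2 * i) ` {2 * i + 1..2 * n}"
      by (intro image_eqI[of _ _ "y + 2 * i"]) auto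
  qed auto
  moreover have "{} \<notin> (`) (\<lambda>x. x - 2 * i) ` N"
    using part(2) by (auto simp: N_def)
  moreover have "card B = 2" if B: "B \<in> (`) (\<lambda>x. x - 2 * i) ` N" for B
  proof -
    obtain A where A: "A \<in> M" "A \<notin> M1" "B = (\<lambda>x. x - 2 * i) ` A"
      using B by (auto simp: N_def)
    then have "inj_on (\<lambda>x. x - 2 * i) A"
      using M2_ge[OF A(1,2)] by (intro inj_onI) (metis diff_add_inverse2 le_add_diff_inverse2 less_imp_le)
    then show ?thesis
      using A part(3) by (simp add: card_image)
  qed
  ultimately have m2: "matching (n - i) ((`) (\<lambda>x. x - 2 * i) ` N)"
    by (simp add: matching_def)
  have "(\<lambda>x. 2 * i + x) ` (\<lambda>x. x - 2 * i) ` A = A" if A: "A \<in> N" for A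
  proof -
    have "2 * i + (x - 2 * i) = x" if "x \<in> A" for x
      using M2_ge[of A x] A that by (simp add: N_def)
    then have "(\<lambda>x. 2 * i + (x - 2 * i)) ` A = (\<lambda>x. x) ` A"
      by (intro image_cong refl)
    then show ?thesis
      by (simp add: image_image)
  qed
  then have "shift (2 * i) ((`) (\<lambda>x. x - 2 * i) ` N) = N"
    unfolding shift_def image_image[of _ "(`) (\<lambda>x. x - 2 * i)"] by simp
  moreover have "M = M1 \<union> N"
    by (auto simp: N_def M1_def)
  ultimately show ?thesis
    using that[OF m1 m2] M1_def by simp
qed

end

text \<open>Each irreducible block contributes one cut of the arc poset, so the number of blocks is
  the same in every decomposition and is the value of the definite description in
  \<open>bl\<close>.\<close>

lemma juxtapose_irreducible:
  "\<forall>N\<in>set Ms. irreducible_block N \<Longrightarrow>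
     matching (card (juxtapose Ms)) (juxtapose Ms) \<and> card (cuts (arc_poset (juxtapose Ms))) = length Ms"
proof (induction Ms)
  case Nil
  have "matching 0 {}"
    by (simp add: matching_def partition_on_empty)
  moreover have "arc_poset {} = {}"
    by (simp add: arc_poset_def)
  ultimately show ?case
    by (simp add: cuts_empty)
next
  case (Cons N Ms)
  then have N: "matching (card N) N" "N \<noteq> {}" "\<not> reducible_matching N"
    by (simp_all add: irreducible_block_def)
  have IH: "matching (card (juxtapose Ms)) (juxtapose Ms)" "card (cuts (arc_poset (juxtapose Ms))) = length Ms"
    using Cons by simp_all
  have m: "matching (card N + card (juxtapose Ms)) (juxtapose (N # Ms))"
    unfolding juxtapose_Cons using matching_append[OF N(1) IH(1)] .
  moreover have "cuts (arc_poset N) = {{}}"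
    using perfect_matching.cuts_arc_poset_irreducible[OF perfect_matchingI[OF N(1)] N(2,3)] .
  then have "card (cuts (arc_poset (juxtapose (N # Ms)))) = length (N # Ms)"
    unfolding juxtapose_Cons card_cuts_append[OF N(1) IH(1)] IH(2) by simp
  ultimately show ?case
    using matching_card[OF m] by simp
qed

text \<open>Split at the first balanced position: a balanced position inside the first part would
  also be one of M, so that part is irreducible. The position 2n is always balanced, hence a first
  one exists.\<close>

lemma irreducible_blocks_ex:
  "matching n M \<Longrightarrow> \<exists>Ms. (\<forall>N\<in>set Ms. irreducible_block N) \<and> juxtapose Ms = M"
proof (induction n arbitrary: M rule: less_induct)
  case (less n)
  interpret perfect_matching n M
    using less.prems by (rule perfect_matchingI)
  show ?case
  proof (cases "M = {}")
    case True
    then show ?thesis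
      by (intro exI[of _ "[]"]) simp
  next
    case False
    then have "0 < n"
      using card_M finite_M by (metis card_gt_0_iff)
    let ?P = "\<lambda>i. 1 \<le> i \<and> i \<le> n \<and> card (openers M \<inter> {1..2 * i}) = card (closers M \<inter> {1..2 * i})"
    have "?P n"
    proof -
      have "{A \<in> M. opener A \<le> 2 * n} = M" "{A \<in> M. closer A \<le> 2 * n} = M"
        using arc by fastforce+
      then show ?thesis
        using \<open>0 < n\<close> unfolding card_endpoints_upto by simp
    qed
    then obtain i where i: "?P i" "\<And>j. j < i \<Longrightarrow> \<not> ?P j"
      using exists_least_iff[of ?P] by blast
    obtain M1 M2 where m: "matching i M1" "matching (n - i) M2" "M = M1 \<union> shift (2 * i) M2" "M1 = {A \<in> M. opener A \<le> 2 * i}"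
      using balanced_split[of i] i(1) by blast
    interpret M1: perfect_matching i M1
      using m(1) by (rule perfect_matchingI)
    have "\<not> reducible_matching M1"
    proof
      assume "reducible_matching M1"
      then obtain j where j: "1 \<le> j" "j < i" "card (openers M1 \<inter> {1..2 * j}) = card (closers M1 \<inter> {1..2 * j})"
        unfolding reducible_matching_def M1.card_M by blast
      have "{A \<in> M1. opener A \<le> 2 * j} = {A \<in> M. opener A \<le> 2 * j}"
        using j(2) unfolding m(4) by auto
      moreover have "{A \<in> M1. closer A \<le> 2 * j} = {A \<in> M. closer A \<le> 2 * j}"
        using j(2) arc(2) unfolding m(4) by fastforce
      ultimately have "?P j"
        using j i(1) unfolding card_endpoints_upto M1.card_endpoints_upto by simp
      then show False
        using i(2) j(2) by blast
    qed
    moreover have "M1 \<noteq> {}"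
      using i(1) M1.card_M by auto
    ultimately have "irreducible_block M1"
      using m(1) M1.card_M by (simp add: irreducible_block_def)
    moreover obtain Ms where "\<forall>N\<in>set Ms. irreducible_block N" "juxtapose Ms = M2"
      using less.IH[OF _ m(2)] i(1) \<open>0 < n\<close> by (metis diff_less less_le_trans zero_less_one)
    ultimately have "(\<forall>N\<in>set (M1 # Ms). irreducible_block N) \<and> juxtapose (M1 # Ms) = M"
      unfolding juxtapose_Cons M1.card_M using m(3) by simp
    then show ?thesis
      by blast
  qed
qed

lemma bl_eq_ssd:
  assumes "matching n M"
  shows "bl M = ssd (arc_poset M)"
proof -
  interpret perfect_matching n M
    using assms by (rule perfect_matchingI)
  obtain Ms where Ms: "\<forall>N\<in>set Ms. irreducible_block N" "juxtapose Ms = M"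
    using irreducible_blocks_ex[OF assms] by blast
  have "length Ns = card (cuts (arc_poset M))" if "\<forall>N\<in>set Ns. irreducible_block N" "juxtapose Ns = M" for Ns
    using juxtapose_irreducible[OF that(1)] that(2) by simp
  then have "bl M = card (cuts (arc_poset M))"
    unfolding bl_def using Ms by (intro the_equality) blast+
  then show ?thesis
    using ssd_eq_card_cuts[OF Partial_order_arcs] finite_M by (simp add: Field_arc_poset)
qed

lemma equidist_sym:
  assumes "equidist A f g B f' g'"
  shows "equidist B f' g' A f g"
proof -
  obtain h where h: "bij_betw h A B" "\<forall>x\<in>A. f' (h x) = f x \<and> g' (h x) = g x"
    using assms unfolding equidist_def by blast
  have k: "inv_into A h y \<in> A" "h (inv_into A h y) = y" if "y \<in> B" for y
    using that bij_betw_inv_into[OF h(1)] bij_betw_inv_into_right[OF h(1)] by (auto dest: bij_betwE)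
  show ?thesis
    by (rule equidistI[OF bij_betw_inv_into[OF h(1)]]) (use k h(2) in metis)+
qed

text \<open>The arc posets serve as the models of \<open>equidist_posets_avoiding\<close>, indexed
  by the matchings themselves; \<open>has\<close> mediates between the pattern P in a matching and
  the subposet X in the labelled copies of its arc poset.\<close>

lemma equidist_matchings_posets:
  fixes has :: "nat set rel \<Rightarrow> bool"
  assumes contains: "\<And>M. stoimenow_matching n M \<Longrightarrow> matching_contains M P \<longleftrightarrow> has (arc_poset M)"
    and poset: "\<And>q (r :: nat rel). Partial_order q \<Longrightarrow> poset_iso q r \<Longrightarrow> has q \<longleftrightarrow> poset_contains r X"
  shows "equidist (matchings_avoiding P n) fcr bl (posets_avoiding X n) (class_stat min_count) (class_stat ssd)"
proof (rule equidist_posets_avoiding[of _ arc_poset])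
  have st: "stoimenow_matching n M" if "M \<in> matchings_avoiding P n" for M
    using that by unfold_locales (simp_all add: matchings_avoiding_def)
  {
    fix M assume M: "M \<in> matchings_avoiding P n"
    interpret stoimenow_matching n M
      using st[OF M] .
    show "Partial_order (arc_poset M) \<and> finite (Field (arc_poset M)) \<and> card (Field (arc_poset M)) = n"
      using Partial_order_arcs finite_M card_M by (simp add: Field_arc_poset)
    show "\<not> has_2_plus_2 (arc_poset M)"
      by (rule no_2_plus_2)
    fix r :: "nat rel" assume iso: "poset_iso (arc_poset M) r"
    have "\<not> matching_contains M P"
      using M by (simp add: matchings_avoiding_def)
    then show "\<not> poset_contains r X"
      using contains[OF st[OF M]] poset[OF Partial_order_arcs iso] by simp
    show "min_count r = fcr M \<and> ssd r = bl M"
      using poset_iso_min_count[OF iso] poset_iso_ssd[OF iso Partial_order_arcs] finite_M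
        fcr_eq_min_count bl_eq_ssd[OF matching] by (simp add: Field_arc_poset)
  }
  {
    fix M N assume "M \<in> matchings_avoiding P n" "N \<in> matchings_avoiding P n" "poset_iso (arc_poset M) (arc_poset N)"
    then show "M = N"
      using stoimenow_matching_iso_eq st by blast
  }
  fix r :: "nat rel" assume r: "partial_order_on {1..n} r" "\<not> has_2_plus_2 r" "\<not> poset_contains r X"
  have "Field r = {1..n}" "Partial_order r"
    using Field_partial_order_on[OF r(1)] Partial_order_if_partial_order_on[OF r(1)] by simp_all
  then obtain M where M: "matching n M" "stoimenow M" "poset_iso (arc_poset M) r"
    using stoimenow_matching_ex[of r n] r(2) by auto
  interpret stoimenow_matching n M
    using M(1,2) by unfold_locales
  have "\<not> matching_contains M P"
    using r(3) poset[OF Partial_order_arcs M(3)] contains[OF stoimenow_matching_axioms] by simp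
  then have "M \<in> matchings_avoiding P n"
    using M(1,2) by (simp add: matchings_avoiding_def)
  then show "\<exists>M\<in>matchings_avoiding P n. poset_iso (arc_poset M) r"
    using M(3) by blast
qed

lemma equidist_matchings:
  "equidist (trees n) left_spine right_spine (matchings_avoiding pattern1 n) fcr bl"
  "equidist (trees n) left_spine right_spine (matchings_avoiding pattern2 n) fcr bl"
proof -
  have "equidist (matchings_avoiding pattern1 n) fcr bl
      (posets_avoiding poset_3_plus_1 n) (class_stat min_count) (class_stat ssd)"
  proof (rule equidist_matchings_posets[of _ _ has_3_plus_1])
    fix M assume "stoimenow_matching n M"
    then interpret stoimenow_matching n M .
    show "matching_contains M pattern1 \<longleftrightarrow> has_3_plus_1 (arc_poset M)"
      using contains_if_has_3_plus_1 has_3_plus_1_if_contains by blast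
  next
    fix q :: "nat set rel" and r :: "nat rel"
    assume q: "Partial_order q" "poset_iso q r"
    show "has_3_plus_1 q \<longleftrightarrow> poset_contains r poset_3_plus_1"
      unfolding has_3_plus_1_iff[OF poset_iso_Partial_order[OF q(2,1)]]
      using poset_iso_has_3_plus_1[OF q(2)] poset_iso_has_3_plus_1[OF poset_iso_sym[OF q(2)]] by blast
  qed
  then show "equidist (trees n) left_spine right_spine (matchings_avoiding pattern1 n) fcr bl"
    using equidist_trans[OF equidist_posets_3_plus_1 equidist_sym] by blast
  have "equidist (matchings_avoiding pattern2 n) fcr bl
      (posets_avoiding poset_N n) (class_stat min_count) (class_stat ssd)"
  proof (rule equidist_matchings_posets[of _ _ has_N])
    fix M assume "stoimenow_matching n M"
    then interpret stoimenow_matching n M .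
    show "matching_contains M pattern2 \<longleftrightarrow> has_N (arc_poset M)"
      using contains_if_has_N has_N_if_contains by blast
  next
    fix q :: "nat set rel" and r :: "nat rel"
    assume q: "Partial_order q" "poset_iso q r"
    show "has_N q \<longleftrightarrow> poset_contains r poset_N"
      unfolding has_N_iff[OF poset_iso_Partial_order[OF q(2,1)]]
      using poset_iso_has_N[OF q(2)] poset_iso_has_N[OF poset_iso_sym[OF q(2)]] by blast
  qed
  \<comment> \<open>Blocks correspond to \<open>ssd\<close>, so the version of the N-free case with
    \<open>ssd\<close> in place of \<open>smc\<close> is the one to compose with.\<close>
  then show "equidist (trees n) left_spine right_spine (matchings_avoiding pattern2 n) fcr bl"
    using equidist_trans[OF equidist_posets_N(2) equidist_sym] by blast
qed

section \<open>The joint distribution\<close>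

lemma equidist_ascent_seqs: "equidist (trees n) left_spine right_spine (ascent_seqs_101 n) zero_count rmin"
  using generating_tree_equidist[OF generating_tree_ascent_seqs] .

lemma equidist_fishburn_perms: "equidist (trees n) left_spine right_spine (fishburn_perms_3142 n) idr lmax"
  using generating_tree_equidist[OF generating_tree_fishburn] .

theorem theorem1p5:
  fixes y z t s :: "coeff_field fps"
  defines "y \<equiv> fps_const y_var"
    and "z \<equiv> fps_const z_var"
    and "t \<equiv> fps_X"
    and "s \<equiv> sqrt_1_minus_4t"
  shows
    "joint_gf (matchings_avoiding pattern1) fcr bl
       = joint_gf (matchings_avoiding pattern2) fcr bl
     \<and> joint_gf (matchings_avoiding pattern2) fcr bl
       = joint_gf (posets_avoiding poset_3_plus_1) (class_stat min_count) (class_stat ssd)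
     \<and> joint_gf (posets_avoiding poset_3_plus_1) (class_stat min_count) (class_stat ssd)
       = joint_gf (posets_avoiding poset_N) (class_stat min_count) (class_stat smc)
     \<and> joint_gf (posets_avoiding poset_N) (class_stat min_count) (class_stat smc)
       = joint_gf ascent_seqs_101 zero_count rmin
     \<and> joint_gf ascent_seqs_101 zero_count rmin
       = joint_gf fishburn_perms_3142 idr lmax
     \<and> joint_gf fishburn_perms_3142 idr lmax
       = 1 + 4 * y * z * t / ((2 - y * (1 - s)) * (2 - z * (1 - s)))
     \<and> 1 + 4 * y * z * t / ((2 - y * (1 - s)) * (2 - z * (1 - s)))
       = 1 + y * z * t * catalan_gf2 y * catalan_gf2 z
     \<and> symmetric_joint (matchings_avoiding pattern1) fcr bl
     \<and> symmetric_joint (matchings_avoiding pattern2) fcr bl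
     \<and> symmetric_joint (posets_avoiding poset_3_plus_1) (class_stat min_count) (class_stat ssd)
     \<and> symmetric_joint (posets_avoiding poset_N) (class_stat min_count) (class_stat smc)
     \<and> symmetric_joint ascent_seqs_101 zero_count rmin
     \<and> symmetric_joint fishburn_perms_3142 idr lmax"
proof -
  note equidist = equidist_matchings equidist_posets_3_plus_1 equidist_posets_N(1) equidist_ascent_seqs
    equidist_fishburn_perms
  note gf = equidist[THEN joint_gf_if_equidist]
  have "1 + 4 * y * z * t / ((2 - y * (1 - s)) * (2 - z * (1 - s)))
      = 1 + y * z * t * catalan_gf2 y * catalan_gf2 z"
    unfolding y_def z_def t_def s_def by (rule closed_form_eq)
  moreover have "tree_gf y_var z_var = 1 + y * z * t * catalan_gf2 y * catalan_gf2 z"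
    unfolding y_def z_def t_def by (rule tree_gf_closed)
  ultimately show ?thesis
    unfolding gf using equidist[THEN symmetric_joint_if_equidist] by simp
qed

end
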